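(* Let $(H,G)$ be a crossed module of topological groups, and let $E(H,G)\to B(H,G)$ be the $(H,G)$ bibundle of topological groups described in the context. Then $E(H,G)\to B(H,G)$ is a classifying bibundle which preserves group structures, in the sense that for any paracompact space $M$ there is an isomorphism of groups $$\pi_0\mathbf{Bibun}_{(H,G)}(M)\;\cong\;[M,B(H,G)]_{H/t(G)},$$ whose inverse sends $[F]$ to $[F^*E(H,G)]$.
   Context: A crossed module $(H,G)$ consists of topological groups $G,H$ and homomorphisms $t\colon G\to H$ (continuous) and $\alpha\colon H\to\operatorname{Aut}(G)$ (giving a continuous action of $H$ on $G$) with $t(\alpha(h)(g))=h\,t(g)\,h^{-1}$ and $\alpha(t(g))(g')=gg'g^{-1}$. Then $G_1=\ker t$ is central in $G$ and $t(G)$ is normal in $H$. Standing assumptions: the projections $G\to G/G_1$ and $H\to H/t(G)$ admit local sections, and $t(G)$ is identified with $G/G_1$ as a topological group. Paracompact spaces are understood to be Hausdorff. An $(H,G)$ bibundle on $M$ is a (locally trivial, right) principal $G$-bundle $P\to M$ with a continuous structure map $\psi\colon P\to H$ satisfying $\psi(pg)=\psi(p)t(g)$. An isomorphism of bibundles on $M$ is an isomorphism of principal $G$-bundles over the identity of $M$ commuting with structure maps; $\pi_0\mathbf{Bibun}_{(H,G)}(M)$ is the set of isomorphism classes. $P$ has a left $G$-action $gp=p\,\alpha(\psi(p))^{-1}(g)$. The set $\pi_0\mathbf{Bibun}_{(H,G)}(M)$ is a group under $[P][Q]=[P\otimes Q]$, where $P\otimes Q=(P\times_MQ)/G$ for the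 action $(p,q)g=(pg,g^{-1}q)$, with right action $(p\otimes q)g=p\otimes qg$ and structure map $p\otimes q\mapsto\psi_P(p)\psi_Q(q)$. For $F\colon M\to N$ the pullback $F^*P=M\times_NP$ has structure map the composite $F^*P\to P\to H$. Construction of $E(H,G)$: choose a model of the (contractible) total space $EG$ of the universal principal $G$-bundle that is a topological group containing $G$ as a closed subgroup (with $EG\to EG/G=BG$ the universal $G$-bundle, $G$ acting by right multiplication), such that the action of $H$ on $G$ extends to a continuous action $\alpha$ of $H$ on $EG$ by group automorphisms, with $\alpha(t(g))(e)=geg^{-1}$ for $g\in G$, $e\in EG$. Let $E(H,G)=EG\rtimes H$, with product $(e,h)(e',h')=(e\,\alpha(h)(e'),hh')$. The map $g\mapsto(g^{-1},t(g))$ embeds $G$ as a normal subgroup of $E(H,G)$; $B(H,G)$ is the quotient group. $E(H,G)\to B(H,G)$ is an $(H,G)$ bibundle with right action $(e,h)g=(e,h)(g^{-1},t(g))$ and structure map $(e,h)\mapsto h$. Its type map $\Phi\colon B(H,G)\to H/t(G)$, $[e,h]\mapsto[h]$, is a group homomorphism. $[M,B(H,G)]_{H/t(G)}$ denotes the set of continuous maps $M\to B(H,G)$ modulo homotopy over $H/t(G)$: $F_0\sim F_1$ if there is a homotopy $h\colon M\times I\to B(H,G)$ from $F_0$ to $F_1$ such that $\Phi\circ h(m,s)$ is independent of $s\in I$ for each $m$. It is a group under pointwise multiplication of maps. *)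

theory Defs
  imports "HOL-Analysis.Analysis" "HOL-Algebra.Coset" "HOL-Algebra.Bij"
begin

section \<open>Topology\<close>

definition paracompact_space :: "'a topology \<Rightarrow> bool" where
  "paracompact_space X \<longleftrightarrow> Hausdorff_space X \<and>
     (\<forall>\<U>. (\<forall>U\<in>\<U>. openin X U) \<and> \<Union>\<U> = topspace X \<longrightarrow>
        (\<exists>\<V>. (\<forall>V\<in>\<V>. openin X V) \<and> \<Union>\<V> = topspace X \<and>
             (\<forall>V\<in>\<V>. \<exists>U\<in>\<U>. V \<subseteq> U) \<and> locally_finite_in X \<V>))"

definition quotient_topology :: "'a topology \<Rightarrow> ('a \<Rightarrow> 'b) \<Rightarrow> 'b topology" where
  "quotient_topology X q =
     topology (\<lambda>U. U \<subseteq> q ` topspace X \<and> openin X {x \<in> topspace X. q x \<in> U})"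

lemma openin_quotient_topology:
  "openin (quotient_topology X q) U \<longleftrightarrow>
     U \<subseteq> q ` topspace X \<and> openin X {x \<in> topspace X. q x \<in> U}"
proof -
  have "istopology (\<lambda>U. U \<subseteq> q ` topspace X \<and> openin X {x \<in> topspace X. q x \<in> U})"
    unfolding istopology_def
  proof (rule conjI; clarify)
    fix S T
    assume "openin X {x \<in> topspace X. q x \<in> S}" "openin X {x \<in> topspace X. q x \<in> T}"
      and *: "S \<subseteq> q ` topspace X" "T \<subseteq> q ` topspace X"
    then have "openin X ({x \<in> topspace X. q x \<in> S} \<inter> {x \<in> topspace X. q x \<in> T})"
      by (intro openin_Int)
    moreover have "{x \<in> topspace X. q x \<in> S} \<inter> {x \<in> topspace X. q x \<in> T}
        = {x \<in> topspace X. q x \<in> S \<inter> T}"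
      by auto
    ultimately show "S \<inter> T \<subseteq> q ` topspace X \<and> openin X {x \<in> topspace X. q x \<in> S \<inter> T}"
      using * by auto
  next
    fix \<K>
    assume *: "\<forall>K\<in>\<K>. K \<subseteq> q ` topspace X \<and> openin X {x \<in> topspace X. q x \<in> K}"
    have "openin X (\<Union>K\<in>\<K>. {x \<in> topspace X. q x \<in> K})"
      using * by auto
    moreover have "(\<Union>K\<in>\<K>. {x \<in> topspace X. q x \<in> K}) = {x \<in> topspace X. q x \<in> \<Union>\<K>}"
      by auto
    ultimately show "\<Union>\<K> \<subseteq> q ` topspace X \<and> openin X {x \<in> topspace X. q x \<in> \<Union>\<K>}"
      using * by auto
  qed
  then show ?thesis
    by (simp add: quotient_topology_def topology_inverse')
qed

lemma topspace_quotient_topology [simp]: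
  "topspace (quotient_topology X q) = q ` topspace X"
proof
  show "topspace (quotient_topology X q) \<subseteq> q ` topspace X"
    using openin_quotient_topology openin_topspace by metis
  have "{x \<in> topspace X. q x \<in> q ` topspace X} = topspace X"
    by auto
  then show "q ` topspace X \<subseteq> topspace (quotient_topology X q)"
    by (intro openin_subset) (simp add: openin_quotient_topology)
qed

lemma quotient_map_quotient_topology: "quotient_map X (quotient_topology X q) q"
  by (simp add: quotient_map_def openin_quotient_topology)

definition has_local_sections :: "'a topology \<Rightarrow> 'b topology \<Rightarrow> ('a \<Rightarrow> 'b) \<Rightarrow> bool" where
  "has_local_sections X Y p \<longleftrightarrow>
     (\<forall>y\<in>topspace Y. \<exists>U s. openin Y U \<and> y \<in> U \<and>
        continuous_map (subtopology Y U) X s \<and> (\<forall>u\<in>U. p (s u) = u))"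

section \<open>Topological groups and crossed modules\<close>

record 'a topgroup = "'a monoid" + gtop :: "'a topology"

locale topological_group = group T for T :: "'a topgroup" +
  assumes topspace_gtop: "topspace (gtop T) = carrier T"
    and continuous_mult:
      "continuous_map (prod_topology (gtop T) (gtop T)) (gtop T) (\<lambda>(x, y). x \<otimes>\<^bsub>T\<^esub> y)"
    and continuous_inv: "continuous_map (gtop T) (gtop T) (\<lambda>x. inv\<^bsub>T\<^esub> x)"

definition topquot :: "'a topgroup \<Rightarrow> 'a set \<Rightarrow> 'a set topgroup" where
  "topquot T N = monoid.extend (T Mod N)
     (topgroup.fields (quotient_topology (gtop T) (\<lambda>x. N #>\<^bsub>T\<^esub> x)))"

lemma topquot_simps [simp]:
  "carrier (topquot T N) = carrier (T Mod N)"
  "mult (topquot T N) = mult (T Mod N)"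
  "one (topquot T N) = one (T Mod N)"
  "gtop (topquot T N) = quotient_topology (gtop T) (\<lambda>x. N #>\<^bsub>T\<^esub> x)"
  by (simp_all add: topquot_def monoid.defs topgroup.defs)

locale crossed_module =
  H: topological_group H + G: topological_group G
  for H :: "'h topgroup" and G :: "'g topgroup" +
  fixes t :: "'g \<Rightarrow> 'h" and \<alpha> :: "'h \<Rightarrow> 'g \<Rightarrow> 'g"
  assumes t_hom: "t \<in> hom G H"
    and t_continuous: "continuous_map (gtop G) (gtop H) t"
    and action_hom: "\<alpha> \<in> hom H (AutoGroup G)"
    and action_continuous:
      "continuous_map (prod_topology (gtop H) (gtop G)) (gtop G) (\<lambda>(h, g). \<alpha> h g)"
    and t_action: "\<lbrakk>h \<in> carrier H; g \<in> carrier G\<rbrakk>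
      \<Longrightarrow> t (\<alpha> h g) = h \<otimes>\<^bsub>H\<^esub> t g \<otimes>\<^bsub>H\<^esub> inv\<^bsub>H\<^esub> h"
    and action_t: "\<lbrakk>g \<in> carrier G; g' \<in> carrier G\<rbrakk>
      \<Longrightarrow> \<alpha> (t g) g' = g \<otimes>\<^bsub>G\<^esub> g' \<otimes>\<^bsub>G\<^esub> inv\<^bsub>G\<^esub> g"

text \<open>In \<open>standard_crossed_module\<close>, \<open>t(G)\<close> carries the subspace topology of \<open>H\<close>, and
  \<open>\<lambda>X. the_elem (t ` X)\<close> is the map \<open>G/G\<^sub>1 \<rightarrow> t(G)\<close> induced by \<open>t\<close>
  (as in \<open>FactGroup_iso\<close>).\<close>

locale standard_crossed_module = crossed_module +
  assumes G_local_sections: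
      "has_local_sections (gtop G) (gtop (topquot G (kernel G H t)))
         (\<lambda>g. kernel G H t #>\<^bsub>G\<^esub> g)"
    and H_local_sections:
      "has_local_sections (gtop H) (gtop (topquot H (t ` carrier G)))
         (\<lambda>h. (t ` carrier G) #>\<^bsub>H\<^esub> h)"
    and image_identification:
      "homeomorphic_map (gtop (topquot G (kernel G H t)))
         (subtopology (gtop H) (t ` carrier G)) (\<lambda>X. the_elem (t ` X))"

section \<open>Principal bundles and bibundles\<close>

record ('p, 'm, 'g) pbundle =
  total :: "'p topology"
  proj :: "'p \<Rightarrow> 'm"
  ract :: "'p \<Rightarrow> 'g \<Rightarrow> 'p"

record ('p, 'm, 'g, 'h) bibundle = "('p, 'm, 'g) pbundle" +
  str :: "'p \<Rightarrow> 'h"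

definition principal_bundle ::
  "'g topgroup \<Rightarrow> 'm topology \<Rightarrow> ('p, 'm, 'g, 'x) pbundle_scheme \<Rightarrow> bool" where
  "principal_bundle G M P \<longleftrightarrow>
     continuous_map (total P) M (proj P) \<and>
     continuous_map (prod_topology (total P) (gtop G)) (total P) (\<lambda>(p, g). ract P p g) \<and>
     (\<forall>p\<in>topspace (total P). ract P p \<one>\<^bsub>G\<^esub> = p) \<and>
     (\<forall>p\<in>topspace (total P). \<forall>g\<in>carrier G. \<forall>g'\<in>carrier G.
        ract P (ract P p g) g' = ract P p (g \<otimes>\<^bsub>G\<^esub> g')) \<and>
     (\<forall>p\<in>topspace (total P). \<forall>g\<in>carrier G. proj P (ract P p g) = proj P p) \<and>
     (\<forall>m\<in>topspace M. \<exists>U \<phi>. openin M U \<and> m \<in> U \<and>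
        homeomorphic_map (prod_topology (subtopology M U) (gtop G))
          (subtopology (total P) {p \<in> topspace (total P). proj P p \<in> U}) \<phi> \<and>
        (\<forall>u\<in>U. \<forall>g\<in>carrier G. proj P (\<phi> (u, g)) = u) \<and>
        (\<forall>u\<in>U. \<forall>g\<in>carrier G. \<forall>g'\<in>carrier G.
           \<phi> (u, g \<otimes>\<^bsub>G\<^esub> g') = ract P (\<phi> (u, g)) g'))"

definition is_bibundle ::
  "'h topgroup \<Rightarrow> 'g topgroup \<Rightarrow> ('g \<Rightarrow> 'h) \<Rightarrow> 'm topology \<Rightarrow>
     ('p, 'm, 'g, 'h) bibundle \<Rightarrow> bool" where
  "is_bibundle H G t M P \<longleftrightarrow> principal_bundle G M P \<and>
     continuous_map (total P) (gtop H) (str P) \<and>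
     (\<forall>p\<in>topspace (total P). \<forall>g\<in>carrier G. str P (ract P p g) = str P p \<otimes>\<^bsub>H\<^esub> t g)"

definition bibundle_iso ::
  "'g topgroup \<Rightarrow> ('p, 'm, 'g, 'h) bibundle \<Rightarrow> ('q, 'm, 'g, 'h) bibundle \<Rightarrow> bool" where
  "bibundle_iso G P Q \<longleftrightarrow> (\<exists>f. homeomorphic_map (total P) (total Q) f \<and>
     (\<forall>p\<in>topspace (total P). proj Q (f p) = proj P p \<and> str Q (f p) = str P p \<and>
        (\<forall>g\<in>carrier G. f (ract P p g) = ract Q (f p) g)))"

definition left_act ::
  "'h topgroup \<Rightarrow> ('h \<Rightarrow> 'g \<Rightarrow> 'g) \<Rightarrow> ('p, 'm, 'g, 'h) bibundle \<Rightarrow> 'g \<Rightarrow> 'p \<Rightarrow> 'p" where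
  "left_act H \<alpha> P g p = ract P p (\<alpha> (inv\<^bsub>H\<^esub> str P p) g)"

definition fibre_product ::
  "('p, 'm, 'g, 'h) bibundle \<Rightarrow> ('q, 'm, 'g, 'h) bibundle \<Rightarrow> ('p \<times> 'q) topology" where
  "fibre_product P Q =
     subtopology (prod_topology (total P) (total Q)) {(p, q). proj P p = proj Q q}"

definition tensor_class ::
  "'h topgroup \<Rightarrow> 'g topgroup \<Rightarrow> ('h \<Rightarrow> 'g \<Rightarrow> 'g) \<Rightarrow> ('p, 'm, 'g, 'h) bibundle \<Rightarrow>
     ('q, 'm, 'g, 'h) bibundle \<Rightarrow> 'p \<times> 'q \<Rightarrow> ('p \<times> 'q) set" where
  "tensor_class H G \<alpha> P Q = (\<lambda>(p, q).
     {(ract P p g, left_act H \<alpha> Q (inv\<^bsub>G\<^esub> g) q) |g. g \<in> carrier G})"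

text \<open>Below, and in \<open>type_map\<close>, \<open>the_elem (f ` X)\<close> is the value at the class \<open>X\<close> of
  the map induced by a function \<open>f\<close> that is constant on classes.\<close>

definition tensor ::
  "'h topgroup \<Rightarrow> 'g topgroup \<Rightarrow> ('h \<Rightarrow> 'g \<Rightarrow> 'g) \<Rightarrow> ('p, 'm, 'g, 'h) bibundle \<Rightarrow>
     ('q, 'm, 'g, 'h) bibundle \<Rightarrow> (('p \<times> 'q) set, 'm, 'g, 'h) bibundle" where
  "tensor H G \<alpha> P Q =
     \<lparr>total = quotient_topology (fibre_product P Q) (tensor_class H G \<alpha> P Q),
      proj = (\<lambda>X. the_elem ((\<lambda>(p, q). proj P p) ` X)),
      ract = (\<lambda>X g. the_elem ((\<lambda>(p, q). tensor_class H G \<alpha> P Q (p, ract Q q g)) ` X)),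
      str = (\<lambda>X. the_elem ((\<lambda>(p, q). str P p \<otimes>\<^bsub>H\<^esub> str Q q) ` X))\<rparr>"

definition unit_bibundle ::
  "'g topgroup \<Rightarrow> ('g \<Rightarrow> 'h) \<Rightarrow> 'm topology \<Rightarrow> ('m \<times> 'g, 'm, 'g, 'h) bibundle" where
  "unit_bibundle G t M =
     \<lparr>total = prod_topology M (gtop G), proj = fst,
      ract = (\<lambda>(m, x) g. (m, x \<otimes>\<^bsub>G\<^esub> g)), str = (\<lambda>(m, x). t x)\<rparr>"

definition pullback_bibundle ::
  "'m topology \<Rightarrow> ('m \<Rightarrow> 'n) \<Rightarrow> ('p, 'n, 'g, 'h) bibundle \<Rightarrow>
     ('m \<times> 'p, 'm, 'g, 'h) bibundle" where
  "pullback_bibundle M F P =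
     \<lparr>total = subtopology (prod_topology M (total P)) {(m, p). F m = proj P p}, proj = fst,
      ract = (\<lambda>(m, p) g. (m, ract P p g)), str = (\<lambda>(m, p). str P p)\<rparr>"

text \<open>The total spaces of all bibundles on \<open>M\<close> do not form a type, so isomorphism classes are
  taken among the bibundles whose total space is carried by a fixed type \<open>'p\<close>; the
  class in \<open>'p\<close> of a bibundle carried by another type consists of its copies in \<open>'p\<close>.
  By \<open>bibundle_copy_exists\<close> below nothing is lost if \<open>topspace M \<times> carrier G\<close> injects
  into \<open>'p\<close>.\<close>

definition bibundle_class ::
  "'h topgroup \<Rightarrow> 'g topgroup \<Rightarrow> ('g \<Rightarrow> 'h) \<Rightarrow> 'm topology \<Rightarrow>
     ('q, 'm, 'g, 'h) bibundle \<Rightarrow> ('p, 'm, 'g, 'h) bibundle set" where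
  "bibundle_class H G t M P = {R. is_bibundle H G t M R \<and> bibundle_iso G P R}"

lemma bibundle_copy_exists:
  fixes P :: "('q, 'm, 'g, 'h) bibundle" and j :: "'m \<times> 'g \<Rightarrow> 'p"
  assumes G: "topological_group G" and P: "is_bibundle H G t M P"
    and j: "inj_on j (topspace M \<times> carrier G)"
  shows "\<exists>R :: ('p, 'm, 'g, 'h) bibundle. is_bibundle H G t M R \<and> bibundle_iso G P R"
proof -
  interpret G: topological_group G by fact
  let ?X = "topspace (total P)"
  have pb: "principal_bundle G M P" and strc: "continuous_map (total P) (gtop H) (str P)"
    and strt: "\<And>p g. p \<in> ?X \<Longrightarrow> g \<in> carrier G \<Longrightarrow> str P (ract P p g) = str P p \<otimes>\<^bsub>H\<^esub> t g"
    using P by (auto simp: is_bibundle_def)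
  have projc: "continuous_map (total P) M (proj P)"
    and ractc: "continuous_map (prod_topology (total P) (gtop G)) (total P) (\<lambda>(p, g). ract P p g)"
    and ract1: "\<And>p. p \<in> ?X \<Longrightarrow> ract P p \<one>\<^bsub>G\<^esub> = p"
    and ractm: "\<And>p g g'. p \<in> ?X \<Longrightarrow> g \<in> carrier G \<Longrightarrow> g' \<in> carrier G \<Longrightarrow>
        ract P (ract P p g) g' = ract P p (g \<otimes>\<^bsub>G\<^esub> g')"
    and projr: "\<And>p g. p \<in> ?X \<Longrightarrow> g \<in> carrier G \<Longrightarrow> proj P (ract P p g) = proj P p"
    and triv: "\<And>m. m \<in> topspace M \<Longrightarrow> \<exists>U \<phi>. openin M U \<and> m \<in> U \<and>
        homeomorphic_map (prod_topology (subtopology M U) (gtop G))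
          (subtopology (total P) {p \<in> topspace (total P). proj P p \<in> U}) \<phi> \<and>
        (\<forall>u\<in>U. \<forall>g\<in>carrier G. proj P (\<phi> (u, g)) = u) \<and>
        (\<forall>u\<in>U. \<forall>g\<in>carrier G. \<forall>g'\<in>carrier G.
           \<phi> (u, g \<otimes>\<^bsub>G\<^esub> g') = ract P (\<phi> (u, g)) g')"
    using pb by (auto simp: principal_bundle_def)
  have projM: "proj P p \<in> topspace M" if "p \<in> ?X" for p
    using projc that by (auto simp: continuous_map_def)
  have ractX: "ract P p g \<in> ?X" if "p \<in> ?X" "g \<in> carrier G" for p g
    using ractc that by (force simp: continuous_map_def G.topspace_gtop)
  have transitive: "\<exists>g\<in>carrier G. q = ract P p g"
    if p: "p \<in> ?X" and q: "q \<in> ?X" and pq: "proj P p = proj P q" for p q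
  proof -
    obtain U \<phi> where U: "openin M U" "proj P p \<in> U"
      and \<phi>: "homeomorphic_map (prod_topology (subtopology M U) (gtop G))
          (subtopology (total P) {p \<in> ?X. proj P p \<in> U}) \<phi>"
      and \<phi>p: "\<And>u g. u \<in> U \<Longrightarrow> g \<in> carrier G \<Longrightarrow> proj P (\<phi> (u, g)) = u"
      and \<phi>m: "\<And>u g g'. u \<in> U \<Longrightarrow> g \<in> carrier G \<Longrightarrow> g' \<in> carrier G \<Longrightarrow>
           \<phi> (u, g \<otimes>\<^bsub>G\<^esub> g') = ract P (\<phi> (u, g)) g'"
      using triv[OF projM[OF p]] by blast
    have UM: "U \<subseteq> topspace M"
      using U(1) by (rule openin_subset)
    have im: "\<phi> ` (U \<times> carrier G) = {p \<in> ?X. proj P p \<in> U}"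
      using homeomorphic_imp_surjective_map[OF \<phi>] UM
      by (simp add: G.topspace_gtop Int_absorb1 Int_absorb2)
    obtain u a where ua: "u \<in> U" "a \<in> carrier G" "p = \<phi> (u, a)"
    proof -
      have "p \<in> \<phi> ` (U \<times> carrier G)"
        unfolding im using p U(2) by blast
      then show ?thesis
        using that by blast
    qed
    obtain v b where vb: "v \<in> U" "b \<in> carrier G" "q = \<phi> (v, b)"
    proof -
      have "q \<in> \<phi> ` (U \<times> carrier G)"
        unfolding im using q U(2) pq by simp
      then show ?thesis
        using that by blast
    qed
    have "u = v"
      using ua vb \<phi>p pq by metis
    moreover have "b = a \<otimes>\<^bsub>G\<^esub> (inv\<^bsub>G\<^esub> a \<otimes>\<^bsub>G\<^esub> b)"
      using ua vb by (simp add: G.m_assoc[symmetric])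
    ultimately have "q = ract P p (inv\<^bsub>G\<^esub> a \<otimes>\<^bsub>G\<^esub> b)"
      using \<phi>m[of u a "inv\<^bsub>G\<^esub> a \<otimes>\<^bsub>G\<^esub> b"] ua vb by simp
    then show ?thesis
      using ua vb by auto
  qed
  define s where "s m = (SOME p. p \<in> ?X \<and> proj P p = m)" for m
  have s: "s (proj P p) \<in> ?X \<and> proj P (s (proj P p)) = proj P p" if "p \<in> ?X" for p
  proof -
    have "\<exists>q. q \<in> ?X \<and> proj P q = proj P p"
      using that by blast
    then show ?thesis
      unfolding s_def by (rule someI_ex)
  qed
  define c where "c p = (SOME g. g \<in> carrier G \<and> p = ract P (s (proj P p)) g)" for p
  have c: "c p \<in> carrier G \<and> p = ract P (s (proj P p)) (c p)" if "p \<in> ?X" for p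
  proof -
    have "\<exists>g. g \<in> carrier G \<and> p = ract P (s (proj P p)) g"
      using transitive s that by blast
    then show ?thesis
      unfolding c_def by (rule someI_ex)
  qed
  define k where "k p = j (proj P p, c p)" for p
  have k: "inj_on k ?X"
  proof (rule inj_onI)
    fix p q
    assume p: "p \<in> ?X" and q: "q \<in> ?X" and "k p = k q"
    then have "(proj P p, c p) = (proj P q, c q)"
      using c projM unfolding k_def by (intro inj_onD[OF j]) auto
    then show "p = q"
      using c[OF p] c[OF q] by auto
  qed
  define Y where "Y = quotient_topology (total P) k"
  have kh: "homeomorphic_map (total P) Y k"
    unfolding homeomorphic_map_def Y_def by (simp add: quotient_map_quotient_topology k)
  then obtain k' where kk: "homeomorphic_maps (total P) Y k k'"
    using homeomorphic_map_maps by blast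
  have kc: "continuous_map (total P) Y k" and k'c: "continuous_map Y (total P) k'"
    and k'k: "\<And>p. p \<in> ?X \<Longrightarrow> k' (k p) = p"
    and kY: "\<And>p. p \<in> ?X \<Longrightarrow> k p \<in> topspace Y"
    and k'X: "\<And>y. y \<in> topspace Y \<Longrightarrow> k' y \<in> ?X"
    and k_k': "\<And>y. y \<in> topspace Y \<Longrightarrow> k (k' y) = y"
    using kk by (auto simp: homeomorphic_maps_def continuous_map_def)
  define R :: "('p, 'm, 'g, 'h) bibundle" where
    "R = \<lparr>total = Y, proj = proj P \<circ> k', ract = (\<lambda>y g. k (ract P (k' y) g)), str = str P \<circ> k'\<rparr>"
  have R: "total R = Y" "proj R = proj P \<circ> k'" "ract R = (\<lambda>y g. k (ract P (k' y) g))"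
    "str R = str P \<circ> k'"
    by (simp_all add: R_def)
  have "continuous_map (prod_topology Y (gtop G)) (prod_topology (total P) (gtop G))
      (\<lambda>(y, g). (k' y, g))"
    using k'c by (simp add: continuous_map_prod_top id_def[symmetric])
  then have "continuous_map (prod_topology Y (gtop G)) Y
      (k \<circ> (\<lambda>(p, g). ract P p g) \<circ> (\<lambda>(y, g). (k' y, g)))"
    using kc ractc by (meson continuous_map_compose)
  moreover have "k \<circ> (\<lambda>(p, g). ract P p g) \<circ> (\<lambda>(y, g). (k' y, g))
      = (\<lambda>(y, g). k (ract P (k' y) g))"
    by auto
  ultimately have 1: "continuous_map (prod_topology Y (gtop G)) Y (\<lambda>(y, g). k (ract P (k' y) g))"
    by simp
  have 2: "\<exists>U \<phi>. openin M U \<and> m \<in> U \<and>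
        homeomorphic_map (prod_topology (subtopology M U) (gtop G))
          (subtopology Y {y \<in> topspace Y. proj P (k' y) \<in> U}) \<phi> \<and>
        (\<forall>u\<in>U. \<forall>g\<in>carrier G. proj P (k' (\<phi> (u, g))) = u) \<and>
        (\<forall>u\<in>U. \<forall>g\<in>carrier G. \<forall>g'\<in>carrier G.
           \<phi> (u, g \<otimes>\<^bsub>G\<^esub> g') = k (ract P (k' (\<phi> (u, g))) g'))"
    if m: "m \<in> topspace M" for m
  proof -
    obtain U \<phi> where U: "openin M U" "m \<in> U"
      and \<phi>: "homeomorphic_map (prod_topology (subtopology M U) (gtop G))
          (subtopology (total P) {p \<in> ?X. proj P p \<in> U}) \<phi>"
      and \<phi>p: "\<And>u g. u \<in> U \<Longrightarrow> g \<in> carrier G \<Longrightarrow> proj P (\<phi> (u, g)) = u"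
      and \<phi>m: "\<And>u g g'. u \<in> U \<Longrightarrow> g \<in> carrier G \<Longrightarrow> g' \<in> carrier G \<Longrightarrow>
           \<phi> (u, g \<otimes>\<^bsub>G\<^esub> g') = ract P (\<phi> (u, g)) g'"
      using triv[OF m] by blast
    have UM: "U \<subseteq> topspace M"
      using U(1) by (rule openin_subset)
    have \<phi>X: "\<phi> (u, g) \<in> ?X" if "u \<in> U" "g \<in> carrier G" for u g
    proof -
      have "(u, g) \<in> topspace (prod_topology (subtopology M U) (gtop G))"
        using that UM by (auto simp: G.topspace_gtop)
      then show ?thesis
        using homeomorphic_imp_surjective_map[OF \<phi>] by fastforce
    qed
    have "k ` (?X \<inter> {p \<in> ?X. proj P p \<in> U}) = topspace Y \<inter> {y \<in> topspace Y. proj P (k' y) \<in> U}"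
    proof (intro equalityI subsetI)
      fix y assume "y \<in> topspace Y \<inter> {y \<in> topspace Y. proj P (k' y) \<in> U}"
      then have "y = k (k' y)" "k' y \<in> ?X \<inter> {p \<in> ?X. proj P p \<in> U}"
        using k'X k_k' by auto
      then show "y \<in> k ` (?X \<inter> {p \<in> ?X. proj P p \<in> U})"
        by (rule image_eqI)
    qed (auto simp: k'k kY)
    then have "homeomorphic_map (subtopology (total P) {p \<in> ?X. proj P p \<in> U})
        (subtopology Y {y \<in> topspace Y. proj P (k' y) \<in> U}) k"
      by (rule homeomorphic_map_subtopologies[OF kh])
    then have "homeomorphic_map (prod_topology (subtopology M U) (gtop G))
        (subtopology Y {y \<in> topspace Y. proj P (k' y) \<in> U}) (k \<circ> \<phi>)"
      using \<phi> homeomorphic_map_compose by blast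
    then show ?thesis
      using U \<phi>p \<phi>m \<phi>X by (intro exI[of _ U] exI[of _ "k \<circ> \<phi>"]) (simp add: k'k)
  qed
  have "principal_bundle G M R"
    unfolding principal_bundle_def R
    using 1 2 continuous_map_compose[OF k'c projc]
    by (simp add: k'X k_k' k'k ractX ract1 ractm projr)
  then have "is_bibundle H G t M R"
    unfolding is_bibundle_def R using continuous_map_compose[OF k'c strc]
    by (simp add: k'X k'k ractX strt)
  moreover have "bibundle_iso G P R"
    unfolding bibundle_iso_def R using kh by (intro exI[of _ k]) (simp add: k'k)
  ultimately show ?thesis
    by blast
qed

definition pi0_Bibun ::
  "'h topgroup \<Rightarrow> 'g topgroup \<Rightarrow> ('g \<Rightarrow> 'h) \<Rightarrow> ('h \<Rightarrow> 'g \<Rightarrow> 'g) \<Rightarrow> 'm topology \<Rightarrow>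
     ('p, 'm, 'g, 'h) bibundle set monoid" where
  "pi0_Bibun H G t \<alpha> M =
     \<lparr>carrier = bibundle_class H G t M ` {P :: ('p, 'm, 'g, 'h) bibundle. is_bibundle H G t M P},
      mult = (\<lambda>X Y. \<Union>P\<in>X. \<Union>Q\<in>Y. bibundle_class H G t M (tensor H G \<alpha> P Q)),
      one = bibundle_class H G t M (unit_bibundle G t M)\<rparr>"

section \<open>The bibundle \<open>E(H,G) \<rightarrow> B(H,G)\<close>\<close>

text \<open>The universal bundle \<open>EG \<rightarrow> EG/G\<close>, where the inclusion of \<open>G\<close> into \<open>EG\<close> is the map \<open>i\<close>:
  \<open>G\<close> acts from the right, so its orbits are the left cosets.\<close>

definition EG_bundle ::
  "'g topgroup \<Rightarrow> 'e topgroup \<Rightarrow> ('g \<Rightarrow> 'e) \<Rightarrow> ('e, 'e set, 'g) pbundle" where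
  "EG_bundle G EG i =
     \<lparr>total = gtop EG, proj = (\<lambda>e. e <#\<^bsub>EG\<^esub> (i ` carrier G)),
      ract = (\<lambda>e g. e \<otimes>\<^bsub>EG\<^esub> i g)\<rparr>"

locale EG_model = crossed_module H G t \<alpha> + EG: topological_group EG
  for H :: "'h topgroup" and G :: "'g topgroup" and t \<alpha> and EG :: "'e topgroup" +
  fixes i :: "'g \<Rightarrow> 'e" and \<epsilon> :: "'h \<Rightarrow> 'e \<Rightarrow> 'e"
  assumes i_hom: "i \<in> hom G EG"
    and i_embedding: "embedding_map (gtop G) (gtop EG) i"
    and i_closed: "closedin (gtop EG) (i ` carrier G)"
    and EG_contractible: "contractible_space (gtop EG)"
    and EG_principal: "principal_bundle G
      (quotient_topology (gtop EG) (\<lambda>e. e <#\<^bsub>EG\<^esub> (i ` carrier G))) (EG_bundle G EG i)"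
    and ext_action_hom: "\<epsilon> \<in> hom H (AutoGroup EG)"
    and ext_action_continuous:
      "continuous_map (prod_topology (gtop H) (gtop EG)) (gtop EG) (\<lambda>(h, e). \<epsilon> h e)"
    and ext_action_extends: "\<lbrakk>h \<in> carrier H; g \<in> carrier G\<rbrakk> \<Longrightarrow> \<epsilon> h (i g) = i (\<alpha> h g)"
    and ext_action_t: "\<lbrakk>g \<in> carrier G; e \<in> carrier EG\<rbrakk>
      \<Longrightarrow> \<epsilon> (t g) e = i g \<otimes>\<^bsub>EG\<^esub> e \<otimes>\<^bsub>EG\<^esub> inv\<^bsub>EG\<^esub> (i g)"

definition E_group ::
  "'h topgroup \<Rightarrow> 'e topgroup \<Rightarrow> ('h \<Rightarrow> 'e \<Rightarrow> 'e) \<Rightarrow> ('e \<times> 'h) topgroup" where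
  "E_group H EG \<epsilon> =
     \<lparr>carrier = carrier EG \<times> carrier H,
      mult = (\<lambda>(e, h) (e', h'). (e \<otimes>\<^bsub>EG\<^esub> \<epsilon> h e', h \<otimes>\<^bsub>H\<^esub> h')),
      one = (\<one>\<^bsub>EG\<^esub>, \<one>\<^bsub>H\<^esub>),
      gtop = prod_topology (gtop EG) (gtop H)\<rparr>"

definition E_embed ::
  "'g topgroup \<Rightarrow> ('g \<Rightarrow> 'h) \<Rightarrow> ('g \<Rightarrow> 'e) \<Rightarrow> 'g \<Rightarrow> 'e \<times> 'h" where
  "E_embed G t i g = (i (inv\<^bsub>G\<^esub> g), t g)"

definition B_group ::
  "'h topgroup \<Rightarrow> 'g topgroup \<Rightarrow> ('g \<Rightarrow> 'h) \<Rightarrow> 'e topgroup \<Rightarrow> ('g \<Rightarrow> 'e) \<Rightarrow>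
     ('h \<Rightarrow> 'e \<Rightarrow> 'e) \<Rightarrow> ('e \<times> 'h) set topgroup" where
  "B_group H G t EG i \<epsilon> = topquot (E_group H EG \<epsilon>) (E_embed G t i ` carrier G)"

definition E_bibundle ::
  "'h topgroup \<Rightarrow> 'g topgroup \<Rightarrow> ('g \<Rightarrow> 'h) \<Rightarrow> 'e topgroup \<Rightarrow> ('g \<Rightarrow> 'e) \<Rightarrow>
     ('h \<Rightarrow> 'e \<Rightarrow> 'e) \<Rightarrow> ('e \<times> 'h, ('e \<times> 'h) set, 'g, 'h) bibundle" where
  "E_bibundle H G t EG i \<epsilon> =
     \<lparr>total = gtop (E_group H EG \<epsilon>),
      proj = (\<lambda>x. (E_embed G t i ` carrier G) #>\<^bsub>E_group H EG \<epsilon>\<^esub> x),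
      ract = (\<lambda>x g. x \<otimes>\<^bsub>E_group H EG \<epsilon>\<^esub> E_embed G t i g),
      str = snd\<rparr>"

definition type_map ::
  "'h topgroup \<Rightarrow> 'g topgroup \<Rightarrow> ('g \<Rightarrow> 'h) \<Rightarrow> ('e \<times> 'h) set \<Rightarrow> 'h set" where
  "type_map H G t X = the_elem ((\<lambda>(e, h). (t ` carrier G) #>\<^bsub>H\<^esub> h) ` X)"

section \<open>Homotopy classes over a space\<close>

definition homotopic_over ::
  "('b \<Rightarrow> 'c) \<Rightarrow> 'm topology \<Rightarrow> 'b topology \<Rightarrow> ('m \<Rightarrow> 'b) \<Rightarrow> ('m \<Rightarrow> 'b) \<Rightarrow> bool" where
  "homotopic_over \<Phi> M B F0 F1 \<longleftrightarrow>
     homotopic_with (\<lambda>F. \<forall>m\<in>topspace M. \<Phi> (F m) = \<Phi> (F0 m)) M B F0 F1"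

definition homotopy_class_over ::
  "('b \<Rightarrow> 'c) \<Rightarrow> 'm topology \<Rightarrow> 'b topology \<Rightarrow> ('m \<Rightarrow> 'b) \<Rightarrow> ('m \<Rightarrow> 'b) set" where
  "homotopy_class_over \<Phi> M B F = {F'. homotopic_over \<Phi> M B F F'}"

definition homotopy_classes_over ::
  "('b \<Rightarrow> 'c) \<Rightarrow> 'm topology \<Rightarrow> 'b topgroup \<Rightarrow> ('m \<Rightarrow> 'b) set monoid" where
  "homotopy_classes_over \<Phi> M B =
     \<lparr>carrier = homotopy_class_over \<Phi> M (gtop B) ` {F. continuous_map M (gtop B) F},
      mult = (\<lambda>X Y. \<Union>F\<in>X. \<Union>F'\<in>Y. homotopy_class_over \<Phi> M (gtop B) (\<lambda>m. F m \<otimes>\<^bsub>B\<^esub> F' m)),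
      one = homotopy_class_over \<Phi> M (gtop B) (\<lambda>m. \<one>\<^bsub>B\<^esub>)\<rparr>"

end

theory Submission
  imports Defs
begin

text \<open>The map \<open>[F] \<mapsto> [F\<^sup>*E(H,G)]\<close> is multiplicative: bundle maps \<open>a: P \<rightarrow> E\<close> over \<open>F\<close> and
  \<open>b: Q \<rightarrow> E\<close> over \<open>F'\<close> multiply to \<open>p \<otimes> q \<mapsto> a(p) b(q)\<close> over \<open>F F'\<close>, the tensor relation
  being the set of fibres of this map. So the group structure of the bibundles can be transported
  from the maps, and well-definedness and injectivity have to be checked at the constant map only.

  The pullback \<open>K\<^sup>*E\<close> is trivial iff \<open>K\<close> lifts to a map into \<open>EG \<times> {1}\<close>. Such a map can be
  contracted in \<open>EG\<close>. Conversely, a homotopy \<open>h\<close> over \<open>H/t(G)\<close> from \<open>1\<close> to \<open>K\<close> is, over the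
  paracompact \<open>M\<close>, a locally finite product of small increments \<open>h(s,m)\<^sup>-\<^sup>1 h(s',m)\<close>, and these
  are lifted by a section near the unit.

  Surjectivity asks for a map \<open>\<phi>: P \<rightarrow> EG\<close> that is equivariant for the left action of \<open>G\<close> on \<open>P\<close>.
  Local ones exist; two of them differ by a \<open>G\<close>-invariant factor with values in \<open>EG\<close>, and
  contracting this factor glues them along a locally finite family of functions.\<close>

section \<open>Paracompact spaces\<close>

text \<open>Two obstacles decide the form. \<open>EG\<close> is contractible but has no convex
  combinations, so local equivariant maps cannot be averaged; indices are glued in one at a time,
  and infinitely many of them are handled by Zorn's lemma. The other obstacle is the structure map
  to \<open>H\<close>: an isomorphism must preserve it, so a lift of a null homotopic map must have
  \<open>H\<close>-component \<open>1\<close>, which a section of \<open>E \<rightarrow> B\<close>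
  need not have. For homotopies over \<open>H/t(G)\<close> this can be repaired: the increments lie
  in the kernel of \<Phi>, so the \<open>H\<close>-component of a section lies in
  \<open>t(G)\<close> and is cancelled by some \<open>\<nu> g\<close>, where \<open>g\<close> is
  chosen by a local section of \<open>G \<rightarrow> G/G\<^sub>1\<close>. The identification of
  \<open>t(G)\<close> with \<open>G/G\<^sub>1\<close> makes this choice continuous. Conversely,
  \<open>EG \<times> {1}\<close> maps into a single fibre of \<Phi>, so a contraction of
  \<open>EG\<close> induces a homotopy of the required kind. Two maps \<open>F\<close> and
  \<open>F'\<close> are compared through \<open>F\<^sup>-\<^sup>1 F'\<close>.\<close>

text \<open>Stated with separate local formulas \<open>g\<close>, because the functions it serves
  are given by choice, by cases or by sums over varying index sets, and only their local formulas
  are visibly continuous.\<close>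

lemma continuous_map_locally:
  assumes "\<And>x. x \<in> topspace X \<Longrightarrow> \<exists>U g. openin X U \<and> x \<in> U \<and>
      continuous_map (subtopology X U) Y g \<and> (\<forall>y\<in>U. f y = g y)"
  shows "continuous_map X Y f"
proof -
  obtain U g where U: "\<And>x. x \<in> topspace X \<Longrightarrow> openin X (U x) \<and> x \<in> U x \<and>
      continuous_map (subtopology X (U x)) Y (g x) \<and> (\<forall>y\<in>U x. f y = g x y)"
    using assms by metis
  show ?thesis
  proof (rule pasting_lemma[of "topspace X" X U Y g])
    show "g i x = g j x" if "i \<in> topspace X" "j \<in> topspace X" "x \<in> topspace X \<inter> U i \<inter> U j" for i j x
      using U[OF that(1)] U[OF that(2)] that(3) by (metis Int_iff)
  qed (use U in auto)
qed

lemma paracompact_refinement: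
  assumes "paracompact_space X" "\<forall>U\<in>\<U>. openin X U" "\<Union>\<U> = topspace X"
  shows "\<exists>\<V>. (\<forall>V\<in>\<V>. openin X V) \<and>
      \<Union>\<V> = topspace X \<and> (\<forall>V\<in>\<V>. \<exists>U\<in>\<U>. V \<subseteq> U) \<and> locally_finite_in X \<V>"
proof -
  have "(\<forall>U\<in>\<U>. openin X U) \<and> \<Union>\<U> = topspace X \<longrightarrow> (\<exists>\<V>. (\<forall>V\<in>\<V>. openin X V) \<and>
      \<Union>\<V> = topspace X \<and> (\<forall>V\<in>\<V>. \<exists>U\<in>\<U>. V \<subseteq> U) \<and> locally_finite_in X \<V>)"
    using assms(1) unfolding paracompact_space_def by (elim conjE allE[of _ \<U>])
  then show ?thesis using assms(2,3) by simp
qed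

text \<open>The closure of a locally finite union is the union of the closures, so neighbourhoods
  that individually stay away from \<open>K\<close> can be combined into a neighbourhood of
  \<open>C\<close> that does. With \<open>K\<close> a point this yields regularity; with
  \<open>K\<close> closed, and regularity at hand, it yields normality.\<close>

lemma paracompact_separation:
  assumes X: "paracompact_space X" and C: "closedin X C"
    and W: "\<And>y. y \<in> C \<Longrightarrow> \<exists>W. openin X W \<and> y \<in> W \<and> disjnt (X closure_of W) K"
  obtains A where "openin X A" "C \<subseteq> A" "disjnt (X closure_of A) K"
proof -
  let ?U = "insert (topspace X - C) {W. openin X W \<and> disjnt (X closure_of W) K}"
  have 1: "\<forall>U\<in>?U. openin X U"
    using C by auto
  have 2: "\<Union>?U = topspace X"
  proof
    show "\<Union>?U \<subseteq> topspace X" using 1 openin_subset by blast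
    show "topspace X \<subseteq> \<Union>?U" using W by blast
  qed
  obtain \<V> where *: "(\<forall>V\<in>\<V>. openin X V) \<and> \<Union>\<V> = topspace X \<and>
      (\<forall>V\<in>\<V>. \<exists>U\<in>?U. V \<subseteq> U) \<and> locally_finite_in X \<V>"
    using paracompact_refinement[OF X 1 2] by (rule exE)
  note V = *[THEN conjunct1] *[THEN conjunct2, THEN conjunct1]
    *[THEN conjunct2, THEN conjunct2, THEN conjunct1] *[THEN conjunct2, THEN conjunct2, THEN conjunct2]
  \<comment> \<open>A member that meets \<open>C\<close> cannot lie in the complement of
    \<open>C\<close>, so it lies in one of the sets whose closure avoids \<open>K\<close>.\<close>
  define \<A> where "\<A> = {V\<in>\<V>. V \<inter> C \<noteq> {}}"
  have lf: "locally_finite_in X \<A>"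
    using V(4) by (rule locally_finite_in_subset) (auto simp: \<A>_def)
  have "disjnt (X closure_of V) K" if "V \<in> \<A>" for V
  proof -
    obtain U where "U \<in> ?U" "V \<subseteq> U" using V(3) \<open>V \<in> \<A>\<close> unfolding \<A>_def by blast
    then have "V \<subseteq> U \<and> disjnt (X closure_of U) K" using \<open>V \<in> \<A>\<close> unfolding \<A>_def by blast
    then show ?thesis using closure_of_mono disjnt_subset1 by metis
  qed
  then have "disjnt (X closure_of \<Union>\<A>) K"
    unfolding closure_of_locally_finite_Union[OF lf] by (auto simp: disjnt_def)
  moreover have "openin X (\<Union>\<A>)" using V(1) by (auto simp: \<A>_def)
  moreover have "C \<subseteq> \<Union>\<A>"
    using V(2) closedin_subset[OF C] unfolding \<A>_def by blast
  ultimately show ?thesis using that by blast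
qed

lemma paracompact_imp_regular_space:
  assumes X: "paracompact_space X" shows "regular_space X"
  unfolding regular_space_def
proof (intro allI impI, elim conjE)
  fix C a assume C: "closedin X C" and a: "a \<in> topspace X - C"
  have "\<exists>W. openin X W \<and> y \<in> W \<and> disjnt (X closure_of W) {a}" if "y \<in> C" for y
  proof -
    have "y \<in> topspace X" "a \<noteq> y" using that C a closedin_subset by auto
    then obtain U V where "openin X U" "openin X V" "y \<in> U" "a \<in> V" "disjnt U V"
      using X a unfolding paracompact_space_def Hausdorff_space_def by (metis DiffD1)
    then show ?thesis
      by (intro exI[of _ U]) (auto simp: in_closure_of disjnt_def)
  qed
  then obtain A where A: "openin X A" "C \<subseteq> A" "disjnt (X closure_of A) {a}"
    using paracompact_separation[OF X C] by blast
  have "openin X (topspace X - X closure_of A)" by auto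
  moreover have "disjnt (topspace X - X closure_of A) A"
    using A(1) by (auto simp: disjnt_def dest: closure_of_subset[OF openin_subset])
  ultimately show "\<exists>U V. openin X U \<and> openin X V \<and> a \<in> U \<and> C \<subseteq> V \<and> disjnt U V"
    using A a by (meson DiffD1 DiffI disjnt_insert2)
qed

lemma paracompact_imp_normal_space:
  assumes X: "paracompact_space X" shows "normal_space X"
  unfolding normal_space
proof (intro allI impI, elim conjE)
  fix S T assume S: "closedin X S" and T: "closedin X T" and ST: "disjnt S T"
  have "\<exists>W. openin X W \<and> y \<in> W \<and> disjnt (X closure_of W) T" if "y \<in> S" for y
  proof -
    have "y \<in> topspace X - T"
      using that S ST closedin_subset by (fastforce simp: disjnt_def)
    then show ?thesis
      using paracompact_imp_regular_space[OF X] T unfolding regular_space by (metis disjnt_sym)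
  qed
  then obtain A where "openin X A" "S \<subseteq> A" "disjnt (X closure_of A) T"
    using paracompact_separation[OF X S] by blast
  then show "\<exists>U. openin X U \<and> S \<subseteq> U \<and> disjnt T (X closure_of U)"
    by (metis disjnt_sym)
qed

text \<open>Urysohn functions for a shrinking of the cover. They are not normalized to sum 1, since
  later only their positivity and quotients of their sums matter.\<close>

lemma paracompact_subordinate_functions:
  assumes X: "paracompact_space X" and U: "\<forall>U\<in>\<U>. openin X U" "\<Union>\<U> = topspace X"
  obtains \<V> and \<rho> :: "'a set \<Rightarrow> 'a \<Rightarrow> real" where
    "locally_finite_in X \<V>" "\<And>V. V \<in> \<V> \<Longrightarrow> openin X V" "\<And>V. V \<in> \<V> \<Longrightarrow> \<exists>U\<in>\<U>. V \<subseteq> U"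
    "\<And>V. V \<in> \<V> \<Longrightarrow> continuous_map X euclideanreal (\<rho> V)"
    "\<And>V x. V \<in> \<V> \<Longrightarrow> x \<in> topspace X \<Longrightarrow> 0 \<le> \<rho> V x"
    "\<And>V x. V \<in> \<V> \<Longrightarrow> x \<in> topspace X \<Longrightarrow> \<rho> V x \<noteq> 0 \<Longrightarrow> x \<in> V"
    "\<And>x. x \<in> topspace X \<Longrightarrow> \<exists>V\<in>\<V>. 0 < \<rho> V x"
proof -
  obtain \<V> where *: "(\<forall>V\<in>\<V>. openin X V) \<and> \<Union>\<V> = topspace X \<and>
      (\<forall>V\<in>\<V>. \<exists>U\<in>\<U>. V \<subseteq> U) \<and> locally_finite_in X \<V>"
    using paracompact_refinement[OF X U] by (rule exE)
  note V = *[THEN conjunct1] *[THEN conjunct2, THEN conjunct1]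
    *[THEN conjunct2, THEN conjunct2, THEN conjunct1] *[THEN conjunct2, THEN conjunct2, THEN conjunct2]
  let ?W = "{W. openin X W \<and> (\<exists>V\<in>\<V>. X closure_of W \<subseteq> V)}"
  have "\<exists>W\<in>?W. x \<in> W" if x: "x \<in> topspace X" for x
  proof -
    obtain V where "V \<in> \<V>" "x \<in> V" using V(2) x by blast
    then have "closedin X (topspace X - V)" "x \<in> topspace X - (topspace X - V)"
      using V(1) x by auto
    then obtain W where "openin X W" "x \<in> W" "disjnt (topspace X - V) (X closure_of W)"
      using paracompact_imp_regular_space[OF X] unfolding regular_space by meson
    moreover from this have "X closure_of W \<subseteq> V"
      using closure_of_subset_topspace by (fastforce simp: disjnt_def)
    ultimately show ?thesis using \<open>V \<in> \<V>\<close> by blast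
  qed
  then have 2: "\<Union>?W = topspace X"
    by (auto dest: openin_subset)
  have 1: "\<forall>W\<in>?W. openin X W" by blast
  obtain \<W> where *: "(\<forall>V\<in>\<W>. openin X V) \<and> \<Union>\<W> = topspace X \<and>
      (\<forall>V\<in>\<W>. \<exists>U\<in>?W. V \<subseteq> U) \<and> locally_finite_in X \<W>"
    using paracompact_refinement[OF X 1 2] by (rule exE)
  note W = *[THEN conjunct1] *[THEN conjunct2, THEN conjunct1]
    *[THEN conjunct2, THEN conjunct2, THEN conjunct1] *[THEN conjunct2, THEN conjunct2, THEN conjunct2]
  \<comment> \<open>\<open>C V\<close> collects the closures that fit into \<open>V\<close>. Local
    finiteness makes it closed, and every member of the second refinement fits into some
    \<open>V\<close>, so at each point one of the functions takes the value 1.\<close>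
  define C where "C V = \<Union>((closure_of) X ` {W \<in> \<W>. X closure_of W \<subseteq> V})" for V
  have C: "closedin X (C V)" for V
    unfolding C_def
    by (rule closedin_Union_locally_finite_closure, rule locally_finite_in_subset[OF W(4)]) auto
  have "\<exists>f. continuous_map X (top_of_set {0..1::real}) f \<and> f ` (topspace X - V) \<subseteq> {0} \<and> f ` C V \<subseteq> {1}"
    if "V \<in> \<V>" for V
  proof -
    have "closedin X (topspace X - V)" "disjnt (topspace X - V) (C V)"
      using V(1) that by (auto simp: C_def disjnt_def)
    then show ?thesis
      using Urysohn_lemma[OF paracompact_imp_normal_space[OF X] _ C, of "topspace X - V" V 0 1]
      by (metis zero_le_one)
  qed
  then obtain \<rho> where rho: "\<And>V. V \<in> \<V> \<Longrightarrow> continuous_map X (top_of_set {0..1::real}) (\<rho> V) \<and>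
      \<rho> V ` (topspace X - V) \<subseteq> {0} \<and> \<rho> V ` C V \<subseteq> {1}"
    by metis
  show ?thesis
  proof
    show "locally_finite_in X \<V>" by fact
    show "openin X V" if "V \<in> \<V>" for V using V that by blast
    show "\<exists>U\<in>\<U>. V \<subseteq> U" if "V \<in> \<V>" for V using V that by blast
    show "continuous_map X euclideanreal (\<rho> V)" if "V \<in> \<V>" for V
      using rho[OF that] by (simp add: continuous_map_in_subtopology)
    show "0 \<le> \<rho> V x" if "V \<in> \<V>" "x \<in> topspace X" for V x
    proof -
      have "\<rho> V ` topspace X \<subseteq> topspace (top_of_set {0..1})"
        using rho[OF that(1)] by (elim conjE) (rule continuous_map_image_subset_topspace)
      then show ?thesis using that(2) by auto
    qed
    show "x \<in> V" if "V \<in> \<V>" "x \<in> topspace X" "\<rho> V x \<noteq> 0" for V x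
      using rho[OF that(1)] that(2,3) by blast
    show "\<exists>V\<in>\<V>. 0 < \<rho> V x" if x: "x \<in> topspace X" for x
    proof -
      obtain W where WW: "W \<in> \<W>" "x \<in> W" using x W(2) by blast
      then obtain V where VV: "V \<in> \<V>" "X closure_of W \<subseteq> V"
        using W(3) closure_of_mono by (smt (verit) mem_Collect_eq subset_trans)
      have "W \<subseteq> X closure_of W"
        using W(1) WW(1) by (intro closure_of_subset openin_subset) (rule bspec)
      then have "x \<in> X closure_of W" using WW(2) by (rule subsetD)
      then have "x \<in> C V" unfolding C_def using WW(1) VV(2) by blast
      then have "\<rho> V x = 1" using rho[OF VV(1)] by blast
      then show ?thesis using VV by (intro bexI[of _ V]) auto
    qed
  qed
qed

section \<open>Locally finite sums of real functions\<close>

definition locally_finite_support :: "'a topology \<Rightarrow> 'i set \<Rightarrow> ('i \<Rightarrow> 'a \<Rightarrow> real) \<Rightarrow> bool" where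
  "locally_finite_support X I \<rho> \<longleftrightarrow> (\<forall>x\<in>topspace X. \<exists>N. openin X N \<and> x \<in> N \<and>
     finite {i \<in> I. \<exists>y\<in>N. \<rho> i y \<noteq> 0})"

lemma locally_finite_support_subset:
  assumes "locally_finite_support X I \<rho>" "J \<subseteq> I"
  shows "locally_finite_support X J \<rho>"
  unfolding locally_finite_support_def
proof
  fix x assume "x \<in> topspace X"
  then obtain N where N: "openin X N" "x \<in> N" "finite {i \<in> I. \<exists>y\<in>N. \<rho> i y \<noteq> 0}"
    using assms(1) unfolding locally_finite_support_def by blast
  have "finite {i \<in> J. \<exists>y\<in>N. \<rho> i y \<noteq> 0}"
    by (rule finite_subset[OF _ N(3)]) (use assms(2) in auto)
  then show "\<exists>N. openin X N \<and> x \<in> N \<and> finite {i \<in> J. \<exists>y\<in>N. \<rho> i y \<noteq> 0}"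
    using N by blast
qed

lemma locally_finite_support_finite:
  assumes "locally_finite_support X I \<rho>" "x \<in> topspace X"
  shows "finite {i \<in> I. \<rho> i x \<noteq> 0}"
proof -
  obtain N where N: "x \<in> N" "finite {i \<in> I. \<exists>y\<in>N. \<rho> i y \<noteq> 0}"
    using assms unfolding locally_finite_support_def by blast
  show ?thesis by (rule finite_subset[OF _ N(2)]) (use N(1) in auto)
qed

text \<open>The restriction to the indices that are nonzero at \<open>x\<close> matters: a sum over
  an infinite set is 0 by convention.\<close>

definition support_sum :: "('i \<Rightarrow> 'a \<Rightarrow> real) \<Rightarrow> 'i set \<Rightarrow> 'a \<Rightarrow> real" where
  "support_sum \<rho> J x = (\<Sum>i\<in>{i \<in> J. \<rho> i x \<noteq> 0}. \<rho> i x)"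

lemma continuous_map_support_sum:
  assumes lf: "locally_finite_support X I \<rho>"
    and c: "\<And>i. i \<in> I \<Longrightarrow> continuous_map X euclideanreal (\<rho> i)"
  shows "continuous_map X euclideanreal (support_sum \<rho> I)"
proof (rule continuous_map_locally)
  fix x assume "x \<in> topspace X"
  then obtain N where N: "openin X N" "x \<in> N" "finite {i \<in> I. \<exists>y\<in>N. \<rho> i y \<noteq> 0}"
    using lf unfolding locally_finite_support_def by blast
  let ?F = "{i \<in> I. \<exists>y\<in>N. \<rho> i y \<noteq> 0}"
  have "continuous_map X euclideanreal (\<lambda>y. \<Sum>i\<in>?F. \<rho> i y)"
    using N(3) c by (intro continuous_map_sum) auto
  moreover have "support_sum \<rho> I y = (\<Sum>i\<in>?F. \<rho> i y)" if "y \<in> N" for y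
    unfolding support_sum_def by (rule sum.mono_neutral_left) (use N(3) that in auto)
  ultimately show "\<exists>U g. openin X U \<and> x \<in> U \<and>
      continuous_map (subtopology X U) euclideanreal g \<and> (\<forall>y\<in>U. support_sum \<rho> I y = g y)"
    using N continuous_map_from_subtopology by blast
qed

lemma support_sum_nonneg:
  "(\<And>i. i \<in> J \<Longrightarrow> 0 \<le> \<rho> i x) \<Longrightarrow> 0 \<le> support_sum \<rho> J x"
  unfolding support_sum_def by (rule sum_nonneg) auto

lemma support_sum_pos_iff:
  assumes "finite {i \<in> J. \<rho> i x \<noteq> 0}" "\<And>i. i \<in> J \<Longrightarrow> 0 \<le> \<rho> i x"
  shows "0 < support_sum \<rho> J x \<longleftrightarrow> (\<exists>i\<in>J. 0 < \<rho> i x)"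
proof
  assume "0 < support_sum \<rho> J x"
  then have "{i \<in> J. \<rho> i x \<noteq> 0} \<noteq> {}"
    unfolding support_sum_def by (metis less_irrefl sum.empty)
  then show "\<exists>i\<in>J. 0 < \<rho> i x" using assms(2) by (metis (mono_tags, lifting) empty_Collect_eq less_le)
next
  assume "\<exists>i\<in>J. 0 < \<rho> i x"
  then obtain i where "i \<in> {i \<in> J. \<rho> i x \<noteq> 0}" "0 < \<rho> i x" by auto
  then show "0 < support_sum \<rho> J x"
    unfolding support_sum_def by (intro sum_pos2[OF assms(1)]) (use assms(2) in auto)
qed

lemma locally_finite_support_of_sets:
  assumes "locally_finite_in X \<V>" "\<And>V x. V \<in> \<V> \<Longrightarrow> x \<in> topspace X \<Longrightarrow> \<rho> V x \<noteq> 0 \<Longrightarrow> x \<in> V"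
  shows "locally_finite_support X \<V> \<rho>"
  unfolding locally_finite_support_def
proof
  fix x assume "x \<in> topspace X"
  then obtain N where N: "openin X N" "x \<in> N" "finite {V \<in> \<V>. V \<inter> N \<noteq> {}}"
    using assms(1) unfolding locally_finite_in_def by blast
  have "finite {V \<in> \<V>. \<exists>y\<in>N. \<rho> V y \<noteq> 0}"
    by (rule finite_subset[OF _ N(3)]) (use assms(2) openin_subset[OF N(1)] in blast)
  then show "\<exists>N. openin X N \<and> x \<in> N \<and> finite {V \<in> \<V>. \<exists>y\<in>N. \<rho> V y \<noteq> 0}"
    using N by blast
qed

text \<open>A weighted average of the local bounds \<open>d V\<close> is continuous. At a point it
  is at most the largest \<open>d V\<close> of positive weight there, and that \<open>V\<close>
  contains the point, so this largest bound is good and by \<open>down\<close> the average is good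
  too. It provides the variable mesh in \<open>null_homotopic_lift\<close>.\<close>

lemma paracompact_continuous_choice:
  fixes good :: "'a \<Rightarrow> real \<Rightarrow> bool"
  assumes X: "paracompact_space X"
    and loc: "\<And>x. x \<in> topspace X \<Longrightarrow> \<exists>U d. openin X U \<and> x \<in> U \<and> 0 < d \<and> (\<forall>y\<in>U. good y d)"
    and down: "\<And>x d d'. good x d \<Longrightarrow> 0 < d' \<Longrightarrow> d' \<le> d \<Longrightarrow> good x d'"
  obtains \<delta> where "continuous_map X euclideanreal \<delta>"
    "\<And>x. x \<in> topspace X \<Longrightarrow> 0 < \<delta> x \<and> good x (\<delta> x)"
proof -
  let ?U = "{U. openin X U \<and> (\<exists>d>0. \<forall>y\<in>U. good y d)}"
  have U1: "\<forall>U\<in>?U. openin X U" by blast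
  have U2: "\<Union>?U = topspace X"
  proof
    show "\<Union>?U \<subseteq> topspace X" by (auto dest: openin_subset)
    show "topspace X \<subseteq> \<Union>?U" using loc by blast
  qed
  obtain \<V> and \<rho> :: "'a set \<Rightarrow> 'a \<Rightarrow> real" where
    V: "locally_finite_in X \<V>" "\<And>V. V \<in> \<V> \<Longrightarrow> openin X V" "\<And>V. V \<in> \<V> \<Longrightarrow> \<exists>U\<in>?U. V \<subseteq> U"
    and rho: "\<And>V. V \<in> \<V> \<Longrightarrow> continuous_map X euclideanreal (\<rho> V)"
    "\<And>V x. V \<in> \<V> \<Longrightarrow> x \<in> topspace X \<Longrightarrow> 0 \<le> \<rho> V x"
    "\<And>V x. V \<in> \<V> \<Longrightarrow> x \<in> topspace X \<Longrightarrow> \<rho> V x \<noteq> 0 \<Longrightarrow> x \<in> V"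
    "\<And>x. x \<in> topspace X \<Longrightarrow> \<exists>V\<in>\<V>. 0 < \<rho> V x"
    using paracompact_subordinate_functions[OF X U1 U2] by blast
  have "\<forall>V\<in>\<V>. \<exists>d>0. \<forall>y\<in>V. good y d"
    using V(3) by blast
  then obtain d where d: "\<And>V. V \<in> \<V> \<Longrightarrow> 0 < d V" "\<And>V y. V \<in> \<V> \<Longrightarrow> y \<in> V \<Longrightarrow> good y (d V)"
    by metis
  define \<sigma> where "\<sigma> V x = d V * \<rho> V x" for V x
  have s0: "\<sigma> V x \<noteq> 0 \<longleftrightarrow> \<rho> V x \<noteq> 0" if "V \<in> \<V>" for V x
    using d(1)[OF that] by (simp add: \<sigma>_def)
  have lfr: "locally_finite_support X \<V> \<rho>"
    by (rule locally_finite_support_of_sets[OF V(1) rho(3)])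
  have lfs: "locally_finite_support X \<V> \<sigma>"
    by (rule locally_finite_support_of_sets[OF V(1)]) (use s0 rho(3) in blast)
  define \<delta> where "\<delta> x = support_sum \<sigma> \<V> x / support_sum \<rho> \<V> x" for x
  have pos: "0 < support_sum \<rho> \<V> x" if "x \<in> topspace X" for x
    using support_sum_pos_iff[where J=\<V> and \<rho>=\<rho> and x=x] locally_finite_support_finite[OF lfr that] rho(2,4) that by blast
  have "continuous_map X euclideanreal \<delta>"
    unfolding \<delta>_def
  proof (rule continuous_map_real_divide)
    show "continuous_map X euclideanreal (support_sum \<sigma> \<V>)"
      by (rule continuous_map_support_sum[OF lfs])
        (auto simp: \<sigma>_def[abs_def] intro!: continuous_map_real_mult_left rho(1))
    show "continuous_map X euclideanreal (support_sum \<rho> \<V>)"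
      by (rule continuous_map_support_sum[OF lfr rho(1)])
  qed (use pos in force)
  moreover have "0 < \<delta> x \<and> good x (\<delta> x)" if x: "x \<in> topspace X" for x
  proof -
    let ?S = "{V \<in> \<V>. \<rho> V x \<noteq> 0}"
    have S: "finite ?S" "?S \<noteq> {}"
      using locally_finite_support_finite[OF lfr x] rho(4)[OF x] by auto
    then have "Max (d ` ?S) \<in> d ` ?S" by (intro Max_in) auto
    then obtain W where W: "W \<in> \<V>" "\<rho> W x \<noteq> 0" "d W = Max (d ` ?S)" by auto
    have "support_sum \<sigma> \<V> x = (\<Sum>V\<in>?S. d V * \<rho> V x)"
      unfolding support_sum_def using s0 by (intro sum.cong) (auto simp: \<sigma>_def)
    also have "\<dots> \<le> (\<Sum>V\<in>?S. d W * \<rho> V x)"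
      using S rho(2)[OF _ x] by (intro sum_mono mult_right_mono) (auto simp: W(3))
    also have "\<dots> = d W * support_sum \<rho> \<V> x"
      by (simp add: support_sum_def sum_distrib_left)
    finally have "\<delta> x \<le> d W" using pos[OF x] by (simp add: \<delta>_def divide_le_eq)
    moreover have "0 < support_sum \<sigma> \<V> x"
      unfolding support_sum_def
    proof (rule sum_pos)
      show "finite {i \<in> \<V>. \<sigma> i x \<noteq> 0}" by (rule locally_finite_support_finite[OF lfs x])
      show "{i \<in> \<V>. \<sigma> i x \<noteq> 0} \<noteq> {}" using W s0 by blast
      show "0 < \<sigma> i x" if "i \<in> {i \<in> \<V>. \<sigma> i x \<noteq> 0}" for i
        using that d(1)[of i] rho(2)[of i x] x by (auto simp: \<sigma>_def less_le)
    qed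
    then have "0 < \<delta> x" using pos[OF x] by (simp add: \<delta>_def)
    ultimately show ?thesis
      using down d(2)[OF W(1) rho(3)[OF W(1) x W(2)]] by blast
  qed
  ultimately show ?thesis using that by blast
qed

section \<open>Topological groups\<close>

context topological_group
begin

lemma continuous_map_multI:
  assumes "continuous_map X (gtop T) f" "continuous_map X (gtop T) g"
  shows "continuous_map X (gtop T) (\<lambda>x. f x \<otimes>\<^bsub>T\<^esub> g x)"
  using continuous_map_compose[OF continuous_map_pairedI[OF assms] continuous_mult]
  by (simp add: o_def)

lemma continuous_map_invI:
  assumes "continuous_map X (gtop T) f"
  shows "continuous_map X (gtop T) (\<lambda>x. inv\<^bsub>T\<^esub> f x)"
  using continuous_map_compose[OF assms continuous_inv] by (simp add: o_def)

lemma continuous_map_carrier: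
  "continuous_map X (gtop T) f \<Longrightarrow> x \<in> topspace X \<Longrightarrow> f x \<in> carrier T"
  using continuous_map_image_subset_topspace[of X "gtop T" f] by (auto simp: topspace_gtop)

lemma contractible_contraction:
  assumes "contractible_space (gtop T)"
  obtains c a where "continuous_map (prod_topology (top_of_set {0..1::real}) (gtop T)) (gtop T) c"
    "a \<in> carrier T" "\<And>x. x \<in> carrier T \<Longrightarrow> c (0, x) = x" "\<And>x. x \<in> carrier T \<Longrightarrow> c (1, x) = a"
proof -
  have "gtop T \<noteq> trivial_topology"
    using one_closed topspace_gtop by (metis empty_iff topspace_discrete_topology)
  then obtain a where a: "a \<in> carrier T" "homotopic_with (\<lambda>x. True) (gtop T) (gtop T) id (\<lambda>x. a)"
    using assms unfolding contractible_space topspace_gtop by blast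
  from a(2) obtain c where
    c: "continuous_map (prod_topology (top_of_set {0..1::real}) (gtop T)) (gtop T) c"
    "\<forall>x. c (0, x) = id x" "\<forall>x. c (1, x) = a"
    unfolding homotopic_with_def by (elim exE conjE)
  from that[OF c(1) a(1)] c(2,3) show ?thesis by simp
qed

end

section \<open>Gluing equivariant maps into a contractible group\<close>

text \<open>A triple \<open>(x, y, w) \<in> R\<close> stands for a point \<open>y\<close> of the orbit of \<open>x\<close>, at which the map to be
  constructed is required to have the value at \<open>x\<close> times \<open>w\<close>.\<close>

locale gluing = topological_group T for T :: "'a topgroup" +
  fixes X :: "'x topology" and I :: "'i set" and \<rho> :: "'i \<Rightarrow> 'x \<Rightarrow> real"
    and \<kappa> :: "'i \<Rightarrow> 'x \<Rightarrow> 'a" and R :: "('x \<times> 'x \<times> 'a) set"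
  assumes contractible: "contractible_space (gtop T)"
    and lf: "locally_finite_support X I \<rho>"
    and rho_cont: "i \<in> I \<Longrightarrow> continuous_map X euclideanreal (\<rho> i)"
    and rho_nonneg: "i \<in> I \<Longrightarrow> x \<in> topspace X \<Longrightarrow> 0 \<le> \<rho> i x"
    and rho_cover: "x \<in> topspace X \<Longrightarrow> \<exists>i\<in>I. 0 < \<rho> i x"
    and kappa_cont: "i \<in> I \<Longrightarrow>
      continuous_map (subtopology X {x \<in> topspace X. 0 < \<rho> i x}) (gtop T) (\<kappa> i)"
    and R_closed: "(x, y, w) \<in> R \<Longrightarrow> x \<in> topspace X \<and> y \<in> topspace X \<and> w \<in> carrier T"
    and rho_R: "(x, y, w) \<in> R \<Longrightarrow> i \<in> I \<Longrightarrow> \<rho> i y = \<rho> i x"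
    and kappa_R: "(x, y, w) \<in> R \<Longrightarrow> i \<in> I \<Longrightarrow> 0 < \<rho> i x \<Longrightarrow> \<kappa> i y = \<kappa> i x \<otimes>\<^bsub>T\<^esub> w"
begin

definition positive_set :: "'i set \<Rightarrow> 'x set" where
  "positive_set J = {x \<in> topspace X. \<exists>i\<in>J. 0 < \<rho> i x}"

text \<open>The value off \<open>positive_set J\<close> is fixed to be \<open>undefined\<close>,
  because otherwise two solutions could differ only where nothing is required of them and
  \<open>extended_by\<close> would not be antisymmetric.\<close>

definition partial_solution :: "'i set \<times> ('x \<Rightarrow> 'a) \<Rightarrow> bool" where
  "partial_solution = (\<lambda>(J, \<phi>). J \<subseteq> I \<and> continuous_map (subtopology X (positive_set J)) (gtop T) \<phi> \<and>
     (\<forall>x y w. (x, y, w) \<in> R \<longrightarrow> x \<in> positive_set J \<longrightarrow> \<phi> y = \<phi> x \<otimes>\<^bsub>T\<^esub> w) \<and>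
     (\<forall>x. x \<notin> positive_set J \<longrightarrow> \<phi> x = undefined))"

text \<open>The extension may differ from the old solution wherever a new index is active, since a
  new local map has to take over gradually on an overlap. Local finiteness makes this weak form of
  extension sufficient: near a point only finitely many indices are active, so along a chain the
  values there no longer change once these are included.\<close>

definition extended_by :: "'i set \<times> ('x \<Rightarrow> 'a) \<Rightarrow> 'i set \<times> ('x \<Rightarrow> 'a) \<Rightarrow> bool" where
  "extended_by = (\<lambda>(J, \<phi>) (K, \<psi>). J \<subseteq> K \<and>
     (\<forall>x\<in>positive_set J. (\<forall>i\<in>K - J. \<rho> i x = 0) \<longrightarrow> \<psi> x = \<phi> x))"

lemma positive_set_mono: "J \<subseteq> K \<Longrightarrow> positive_set J \<subseteq> positive_set K"
  by (auto simp: positive_set_def)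

lemma positive_set_eq_if_zero:
  "J \<subseteq> K \<Longrightarrow> x \<in> positive_set K \<Longrightarrow> (\<And>i. i \<in> K - J \<Longrightarrow> \<rho> i x = 0) \<Longrightarrow> x \<in> positive_set J"
  unfolding positive_set_def by (force simp: less_le)

lemma positive_set_R: "(x, y, w) \<in> R \<Longrightarrow> J \<subseteq> I \<Longrightarrow> y \<in> positive_set J \<longleftrightarrow> x \<in> positive_set J"
  using R_closed[of x y w] rho_R[of x y w] unfolding positive_set_def by (auto simp: subset_iff)

lemma extended_by_trans:
  assumes "extended_by p q" "extended_by q r" shows "extended_by p r"
proof -
  obtain J \<phi> K \<psi> L \<theta> where eq: "p = (J, \<phi>)" "q = (K, \<psi>)" "r = (L, \<theta>)"
    by (metis surj_pair)
  note s = assms[unfolded eq extended_by_def split]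
  have JK: "J \<subseteq> K" and KL: "K \<subseteq> L"
    and 1: "\<And>x. x \<in> positive_set J \<Longrightarrow> (\<forall>i\<in>K - J. \<rho> i x = 0) \<Longrightarrow> \<psi> x = \<phi> x"
    and 2: "\<And>x. x \<in> positive_set K \<Longrightarrow> (\<forall>i\<in>L - K. \<rho> i x = 0) \<Longrightarrow> \<theta> x = \<psi> x"
    using s by auto
  have "\<theta> x = \<phi> x" if "x \<in> positive_set J" "\<forall>i\<in>L - J. \<rho> i x = 0" for x
  proof -
    have "x \<in> positive_set K" using positive_set_mono[OF JK] that(1) by blast
    then have "\<theta> x = \<psi> x" using 2 that(2) JK by blast
    also have "\<dots> = \<phi> x" using 1 that KL by blast
    finally show ?thesis .
  qed
  then show ?thesis using JK KL unfolding eq extended_by_def by auto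
qed

lemma partial_order:
  "partial_order_on {p. partial_solution p} (relation_of extended_by {p. partial_solution p})"
proof (rule partial_order_on_relation_ofI)
  show "extended_by p p" for p by (simp add: extended_by_def case_prod_beta)
  show "extended_by p q \<Longrightarrow> extended_by q r \<Longrightarrow> extended_by p r" for p q r
    by (rule extended_by_trans)
  fix p q assume p: "p \<in> {p. partial_solution p}" and q: "q \<in> {p. partial_solution p}"
    and pq: "extended_by p q" "extended_by q p"
  obtain J \<phi> K \<psi> where eq: "p = (J, \<phi>)" "q = (K, \<psi>)" by (metis surj_pair)
  have "J = K" using pq by (auto simp: eq extended_by_def)
  moreover have "\<phi> x = \<psi> x" for x
    using pq p q \<open>J = K\<close> unfolding eq extended_by_def partial_solution_def
    by (cases "x \<in> positive_set J") auto
  ultimately show "p = q" by (auto simp: eq)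
qed

text \<open>Near a point only finitely many indices of the union \<open>L\<close> are active, and
  one member of the chain contains them all. From that member on the values near the point stay the
  same; the bound takes these final values, and continuity and equivariance are inherited from that
  member.\<close>

lemma chain_bound:
  assumes C: "C \<in> Chains (relation_of extended_by {p. partial_solution p})"
  shows "\<exists>u\<in>{p. partial_solution p}. \<forall>p\<in>C. extended_by p u"
proof -
  have Cs: "partial_solution p" if "p \<in> C" for p
    using C that by (force simp: Chains_def relation_of_def)
  have Cc: "extended_by p q \<or> extended_by q p" if "p \<in> C" "q \<in> C" for p q
    using C that by (auto simp: Chains_def relation_of_def)
  define L where "L = (\<Union>p\<in>C. fst p)"
  have LI: "L \<subseteq> I" using Cs unfolding L_def partial_solution_def by fastforce
  \<comment> \<open>The chain may be empty; a nonempty \<open>F\<close> inside \<open>L\<close> is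
    what guarantees a member.\<close>
  have cover: "\<exists>p\<in>C. F \<subseteq> fst p" if F: "finite F" "F \<subseteq> L" "F \<noteq> {}" for F
  proof -
    have "\<exists>B\<in>fst ` C. F \<subseteq> B"
    proof (rule finite_subset_Union_chain[of F "fst ` C" UNIV])
      show "subset.chain UNIV (fst ` C)"
        unfolding subset.chain_def using Cc by (fastforce simp: extended_by_def)
    qed (use F in \<open>auto simp: L_def\<close>)
    then show ?thesis by blast
  qed
  \<comment> \<open>\<open>p\<close> is late enough at \<open>x\<close>: it contains every index of
    \<open>L\<close> that is active there. Two such members agree at \<open>x\<close>, so the choice
    in the definition of \<phi> does not influence the value.\<close>
  define good where "good x p \<longleftrightarrow> p \<in> C \<and> {i \<in> L. \<rho> i x \<noteq> 0} \<subseteq> fst p" for x p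
  define \<phi> where "\<phi> x = (if x \<in> positive_set L then snd (SOME p. good x p) x else undefined)" for x
  have phi: "\<phi> x = snd p x" if x: "x \<in> positive_set L" and p: "good x p" for x p
  proof -
    let ?q = "SOME q. good x q"
    have q: "good x ?q" using p by (rule someI)
    have sub: "fst r \<subseteq> L" "x \<in> positive_set (fst r)" if "good x r" for r
    proof -
      show 1: "fst r \<subseteq> L" using that unfolding good_def L_def by blast
      show "x \<in> positive_set (fst r)"
        by (rule positive_set_eq_if_zero[OF 1 x]) (use that in \<open>auto simp: good_def\<close>)
    qed
    have *: "snd r x = snd s x" if "good x r" "good x s" "extended_by r s" for r s
    proof -
      have "\<forall>i\<in>fst s - fst r. \<rho> i x = 0" using that(1,2) sub(1) unfolding good_def by blast
      then show ?thesis using that(3) sub(2)[OF that(1)] unfolding extended_by_def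
        by (auto simp: case_prod_beta)
    qed
    have "snd ?q x = snd p x"
    proof -
      have "extended_by ?q p \<or> extended_by p ?q" using Cc p q unfolding good_def by blast
      then show ?thesis
      proof
        assume "extended_by ?q p" then show ?thesis by (rule *[OF q p])
      next
        assume "extended_by p ?q" then show ?thesis using *[OF p q] by simp
      qed
    qed
    then show ?thesis using x by (simp add: \<phi>_def)
  qed
  have local: "\<exists>N p. openin X N \<and> x \<in> N \<and> p \<in> C \<and> (\<forall>y\<in>N. y \<in> positive_set L \<longrightarrow> y \<in> positive_set (fst p) \<and> \<phi> y = snd p y)"
    if x: "x \<in> positive_set L" for x
  proof -
    have xX: "x \<in> topspace X" using x by (simp add: positive_set_def)
    obtain N where N: "openin X N" "x \<in> N" "finite {i \<in> L. \<exists>y\<in>N. \<rho> i y \<noteq> 0}"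
      using locally_finite_support_subset[OF lf LI] xX unfolding locally_finite_support_def by blast
    have "{i \<in> L. \<exists>y\<in>N. \<rho> i y \<noteq> 0} \<noteq> {}"
      using x N(2) unfolding positive_set_def by force
    then obtain p where p: "p \<in> C" "{i \<in> L. \<exists>y\<in>N. \<rho> i y \<noteq> 0} \<subseteq> fst p"
      using cover[OF N(3)] by blast
    have "y \<in> positive_set (fst p) \<and> \<phi> y = snd p y" if "y \<in> N" "y \<in> positive_set L" for y
    proof
      have g: "good y p" using p that(1) unfolding good_def by blast
      then show "\<phi> y = snd p y" using phi that(2) by blast
      have "fst p \<subseteq> L" using p(1) by (auto simp: L_def)
      then show "y \<in> positive_set (fst p)"
        using g by (intro positive_set_eq_if_zero[OF _ that(2)]) (auto simp: good_def)
    qed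
    then show ?thesis using N p by blast
  qed
  have "continuous_map (subtopology X (positive_set L)) (gtop T) \<phi>"
  proof (rule continuous_map_locally)
    fix x assume "x \<in> topspace (subtopology X (positive_set L))"
    then have "x \<in> positive_set L" by simp
    from local[OF this] obtain N p where N: "openin X N" "x \<in> N" "p \<in> C"
      "\<And>y. y \<in> N \<Longrightarrow> y \<in> positive_set L \<Longrightarrow> y \<in> positive_set (fst p) \<and> \<phi> y = snd p y" by blast
    have "continuous_map (subtopology X (positive_set (fst p))) (gtop T) (snd p)"
      using Cs[OF N(3)] by (simp add: partial_solution_def case_prod_beta)
    then have "continuous_map (subtopology X (positive_set L \<inter> (N \<inter> positive_set L))) (gtop T) (snd p)"
      by (rule continuous_map_from_subtopology_mono) (use N(4) in auto)
    moreover have "openin (subtopology X (positive_set L)) (N \<inter> positive_set L)"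
      using N(1) by (rule openin_subtopology_Int)
    ultimately show "\<exists>U g. openin (subtopology X (positive_set L)) U \<and> x \<in> U \<and>
        continuous_map (subtopology (subtopology X (positive_set L)) U) (gtop T) g \<and> (\<forall>y\<in>U. \<phi> y = g y)"
      using N \<open>x \<in> positive_set L\<close> by (intro exI[of _ "N \<inter> positive_set L"] exI[of _ "snd p"])
        (simp add: subtopology_subtopology)
  qed
  moreover have "\<phi> y = \<phi> x \<otimes>\<^bsub>T\<^esub> w" if r: "(x, y, w) \<in> R" and x: "x \<in> positive_set L" for x y w
  proof -
    have y: "y \<in> positive_set L" using positive_set_R[OF r LI] x by blast
    obtain p where p: "p \<in> C" "x \<in> positive_set (fst p)" "good x p"
    proof -
      have "x \<in> topspace X" using x by (simp add: positive_set_def)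
      then have "finite {i \<in> L. \<rho> i x \<noteq> 0}"
        by (rule locally_finite_support_finite[OF locally_finite_support_subset[OF lf LI]])
      moreover have "{i \<in> L. \<rho> i x \<noteq> 0} \<noteq> {}" using x by (force simp: positive_set_def)
      ultimately obtain p where p: "p \<in> C" "{i \<in> L. \<rho> i x \<noteq> 0} \<subseteq> fst p"
        using cover[of "{i \<in> L. \<rho> i x \<noteq> 0}"] by blast
      moreover have "x \<in> positive_set (fst p)"
        by (rule positive_set_eq_if_zero[OF _ x]) (use p in \<open>auto simp: L_def\<close>)
      ultimately show ?thesis using that unfolding good_def by blast
    qed
    have "{i \<in> L. \<rho> i y \<noteq> 0} = {i \<in> L. \<rho> i x \<noteq> 0}" using rho_R[OF r] LI by auto
    then have "good y p" using p(3) by (simp add: good_def)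
    then show ?thesis
      using Cs[OF p(1)] r p(2) phi[OF x p(3)] phi[OF y] by (simp add: partial_solution_def case_prod_beta)
  qed
  ultimately have "partial_solution (L, \<phi>)"
    using LI by (simp add: partial_solution_def \<phi>_def)
  moreover have "extended_by p (L, \<phi>)" if p: "p \<in> C" for p
  proof -
    have 1: "fst p \<subseteq> L" using p by (auto simp: L_def)
    have "\<phi> x = snd p x" if "x \<in> positive_set (fst p)" "\<forall>i\<in>L - fst p. \<rho> i x = 0" for x
    proof (rule phi)
      show "x \<in> positive_set L" using positive_set_mono[OF 1] that(1) by blast
      show "good x p" using p that(2) by (auto simp: good_def)
    qed
    then show ?thesis using 1 by (simp add: extended_by_def case_prod_beta)
  qed
  ultimately show ?thesis by blast
qed

text \<open>The factor \<open>\<phi> \<kappa>\<^sub>k\<^sup>-\<^sup>1\<close> is constant on orbits, so a contraction of the group may be applied to it: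
  this deforms \<open>\<phi>\<close> into \<open>\<kappa>\<^sub>k\<close> up to a constant, as \<open>\<rho>\<^sub>k\<close> grows relative to the other \<open>\<rho>\<^sub>i\<close>.\<close>

lemma extension_step:
  assumes \<phi>: "partial_solution (J, \<phi>)" and k: "k \<in> I" "k \<notin> J"
  shows "\<exists>\<psi>. partial_solution (insert k J, \<psi>) \<and> extended_by (J, \<phi>) (insert k J, \<psi>)"
proof -
  have JI: "J \<subseteq> I" and phic: "continuous_map (subtopology X (positive_set J)) (gtop T) \<phi>"
    and phiR: "\<And>x y w. (x, y, w) \<in> R \<Longrightarrow> x \<in> positive_set J \<Longrightarrow> \<phi> y = \<phi> x \<otimes>\<^bsub>T\<^esub> w"
    using \<phi> by (auto simp: partial_solution_def)
  let ?K = "insert k J"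
  have KI: "?K \<subseteq> I" using JI k by simp
  obtain c a where c: "continuous_map (prod_topology (top_of_set {0..1::real}) (gtop T)) (gtop T) c"
    and a: "a \<in> carrier T" and c0: "\<And>x. x \<in> carrier T \<Longrightarrow> c (0, x) = x"
    and c1: "\<And>x. x \<in> carrier T \<Longrightarrow> c (1, x) = a"
    using contractible_contraction[OF contractible] by blast
  let ?\<sigma> = "support_sum \<rho> J"
  have \<sigma>pos: "0 < ?\<sigma> x \<longleftrightarrow> x \<in> positive_set J" and \<sigma>nn: "0 \<le> ?\<sigma> x" if "x \<in> topspace X" for x
  proof -
    show "0 < ?\<sigma> x \<longleftrightarrow> x \<in> positive_set J"
      using support_sum_pos_iff[where J=J and \<rho>=\<rho> and x=x]
        locally_finite_support_finite[OF locally_finite_support_subset[OF lf JI] that]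
        rho_nonneg JI that by (auto simp: positive_set_def)
    show "0 \<le> ?\<sigma> x" using rho_nonneg[OF _ that] JI by (intro support_sum_nonneg) auto
  qed
  have \<sigma>c: "continuous_map X euclideanreal ?\<sigma>"
    using JI by (intro continuous_map_support_sum locally_finite_support_subset[OF lf] rho_cont) auto
  have \<sigma>R: "?\<sigma> y = ?\<sigma> x" if "(x, y, w) \<in> R" for x y w
  proof -
    have "{i \<in> J. \<rho> i y \<noteq> 0} = {i \<in> J. \<rho> i x \<noteq> 0}" using rho_R[OF that] JI by auto
    then show ?thesis
      unfolding support_sum_def using rho_R[OF that] JI by (intro sum.cong) auto
  qed
  define u where "u x = (\<rho> k x - ?\<sigma> x) / (\<rho> k x + ?\<sigma> x)" for x
  have pos: "0 < \<rho> k x + ?\<sigma> x" if "x \<in> positive_set ?K" for x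
  proof -
    have x: "x \<in> topspace X" using that by (simp add: positive_set_def)
    then have "0 < \<rho> k x \<or> x \<in> positive_set J" using that by (auto simp: positive_set_def)
    then show ?thesis using \<sigma>pos[OF x] \<sigma>nn[OF x] rho_nonneg[OF k(1) x] by linarith
  qed
  let ?Y = "subtopology X (positive_set ?K)"
  have uc: "continuous_map ?Y euclideanreal u"
    unfolding u_def
    by (intro continuous_map_real_divide continuous_map_diff continuous_map_add
        continuous_map_from_subtopology rho_cont k \<sigma>c) (use pos in force)
  have u1: "x \<in> positive_set J" if "x \<in> positive_set ?K" "u x < 1" for x
  proof -
    have x: "x \<in> topspace X" using that by (simp add: positive_set_def)
    have "\<rho> k x - ?\<sigma> x < \<rho> k x + ?\<sigma> x"
      using that pos[OF that(1)] by (simp add: u_def divide_less_eq)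
    then show ?thesis using \<sigma>pos[OF x] by linarith
  qed
  have u0: "0 < \<rho> k x" if "x \<in> positive_set ?K" "u x > -1" for x
  proof -
    have "-(\<rho> k x + ?\<sigma> x) < \<rho> k x - ?\<sigma> x"
      using that pos[OF that(1)] by (simp add: u_def less_divide_eq)
    then show ?thesis by linarith
  qed
  \<comment> \<open>The time of the contraction: 0 up to \<open>u = 1/4\<close> and 1 from
    \<open>u = 1/2\<close> on. Both thresholds lie strictly inside the range where \<phi> and
    \<open>\<kappa> k\<close> coexist, so \<open>h\<close> agrees with the two outer formulas on the
    open overlaps \<open>0 < u < 1/4\<close> and \<open>1/2 < u < 1\<close>, and continuity can be
    checked on three open sets.\<close>
  define s where "s x = max 0 (min 1 (4 * u x - 1))" for x
  have sc: "continuous_map ?Y (top_of_set {0..1}) s"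
    unfolding continuous_map_in_subtopology s_def
    by (auto intro!: continuous_map_real_max continuous_map_real_min continuous_map_diff
        continuous_map_real_mult_left uc)
  define h where "h x = c (s x, \<phi> x \<otimes>\<^bsub>T\<^esub> inv\<^bsub>T\<^esub> \<kappa> k x) \<otimes>\<^bsub>T\<^esub> \<kappa> k x" for x
  define \<psi> where "\<psi> x = (if x \<in> positive_set ?K then
      if u x < 1/4 then \<phi> x else if 1/2 < u x then a \<otimes>\<^bsub>T\<^esub> \<kappa> k x else h x else undefined)" for x
  let ?O = "\<lambda>S. {x \<in> topspace ?Y. u x \<in> S}"
  have oO: "openin ?Y (?O S)" if "open S" for S
    using openin_continuous_map_preimage[OF uc] that by simp
  have phiO: "continuous_map (subtopology ?Y (?O S)) (gtop T) \<phi>" if "S \<subseteq> {..<1}" for S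
    unfolding subtopology_subtopology
    by (rule continuous_map_from_subtopology_mono[OF phic]) (use that u1 in auto)
  have kapO: "continuous_map (subtopology ?Y (?O S)) (gtop T) (\<kappa> k)" if "S \<subseteq> {-1<..}" for S
    unfolding subtopology_subtopology
    by (rule continuous_map_from_subtopology_mono[OF kappa_cont[OF k(1)]]) (use that u0 in auto)
  have phiC: "\<phi> x \<in> carrier T" if "x \<in> positive_set J" for x
    using continuous_map_carrier[OF phic] that by (simp add: positive_set_def)
  have kapC: "\<kappa> k x \<in> carrier T" if "x \<in> positive_set ?K" "u x > -1" for x
    using continuous_map_carrier[OF kappa_cont[OF k(1)], of x] u0[OF that] that(1) by (simp add: positive_set_def)
  have hc: "continuous_map (subtopology ?Y (?O {-1<..<1})) (gtop T) h"
  proof -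
    let ?Z = "subtopology ?Y (?O {-1<..<1})"
    have "continuous_map ?Z (gtop T) (\<lambda>x. \<phi> x \<otimes>\<^bsub>T\<^esub> inv\<^bsub>T\<^esub> \<kappa> k x)"
      by (intro continuous_map_multI continuous_map_invI phiO kapO) auto
    then have "continuous_map ?Z (prod_topology (top_of_set {0..1}) (gtop T))
        (\<lambda>x. (s x, \<phi> x \<otimes>\<^bsub>T\<^esub> inv\<^bsub>T\<^esub> \<kappa> k x))"
      by (intro continuous_map_pairedI continuous_map_from_subtopology[OF sc])
    then have "continuous_map ?Z (gtop T) (\<lambda>x. c (s x, \<phi> x \<otimes>\<^bsub>T\<^esub> inv\<^bsub>T\<^esub> \<kappa> k x))"
      using continuous_map_compose[OF _ c] by (force simp: o_def)
    then show ?thesis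
      unfolding h_def by (intro continuous_map_multI kapO) auto
  qed
  have cont: "continuous_map ?Y (gtop T) \<psi>"
  proof (rule continuous_map_locally)
    fix x assume x: "x \<in> topspace ?Y"
    consider "u x < 1/4" | "0 < u x" "u x < 1" | "1/2 < u x" by linarith
    then show "\<exists>U g. openin ?Y U \<and> x \<in> U \<and> continuous_map (subtopology ?Y U) (gtop T) g \<and>
        (\<forall>y\<in>U. \<psi> y = g y)"
    proof cases
      case 1
      then show ?thesis
        using x oO[of "{..<1/4}"] phiO[of "{..<1/4}"]
        by (intro exI[of _ "?O {..<1/4}"] exI[of _ \<phi>]) (auto simp: \<psi>_def)
    next
      case 2
      have "\<psi> y = h y" if "y \<in> positive_set ?K" "0 < u y" "u y < 1" for y
      proof -
        have C: "\<phi> y \<in> carrier T" "\<kappa> k y \<in> carrier T"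
          using phiC u1 kapC that by auto
        consider "u y < 1/4" | "1/2 < u y" | "\<not> u y < 1/4" "\<not> 1/2 < u y" by blast
        then show ?thesis
        proof cases
          case 1
          then show ?thesis using C that by (simp add: \<psi>_def h_def s_def c0 m_assoc)
        next
          case 2
          then have "s y = 1" by (simp add: s_def)
          then show ?thesis using 2 C that by (simp add: \<psi>_def h_def c1)
        qed (use that in \<open>simp add: \<psi>_def\<close>)
      qed
      moreover have "continuous_map (subtopology ?Y (?O {0<..<1})) (gtop T) h"
        unfolding subtopology_subtopology
        by (rule continuous_map_from_subtopology_mono[OF hc[unfolded subtopology_subtopology]]) auto
      ultimately show ?thesis
        using x 2 oO[of "{0<..<1}"]
        by (intro exI[of _ "?O {0<..<1}"] exI[of _ h]) auto
    next
      case 3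
      have "continuous_map (subtopology ?Y (?O {1/2<..})) (gtop T) (\<lambda>x. a \<otimes>\<^bsub>T\<^esub> \<kappa> k x)"
        by (intro continuous_map_multI kapO) (auto simp: topspace_gtop a)
      then show ?thesis
        using x 3 oO[of "{1/2<..}"]
        by (intro exI[of _ "?O {1/2<..}"] exI[of _ "\<lambda>x. a \<otimes>\<^bsub>T\<^esub> \<kappa> k x"]) (auto simp: \<psi>_def)
    qed
  qed
  have "\<psi> y = \<psi> x \<otimes>\<^bsub>T\<^esub> w" if r: "(x, y, w) \<in> R" and x: "x \<in> positive_set ?K" for x y w
  proof -
    have y: "y \<in> positive_set ?K" using positive_set_R[OF r KI] x by blast
    have w: "w \<in> carrier T" using R_closed[OF r] by blast
    have uu: "u y = u x" using rho_R[OF r k(1)] \<sigma>R[OF r] by (simp add: u_def)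
    then have ss: "s y = s x" by (simp add: s_def)
    have pR: "\<phi> y = \<phi> x \<otimes>\<^bsub>T\<^esub> w" "\<phi> x \<in> carrier T" if "u x < 1"
      using phiR[OF r] u1[OF x that] phiC by auto
    have kR: "\<kappa> k y = \<kappa> k x \<otimes>\<^bsub>T\<^esub> w" "\<kappa> k x \<in> carrier T" if "u x > -1"
      using kappa_R[OF r k(1)] u0[OF x that] kapC[OF x that] by auto
    show ?thesis
    proof (cases "u x < 1/4 \<or> 1/2 < u x")
      case True
      then show ?thesis using x y uu pR(1) kR a w by (auto simp: \<psi>_def m_assoc)
    next
      case False
      then have *: "u x > -1" "u x < 1" by auto
      note pk = pR[OF *(2)] kR[OF *(1)]
      have "\<phi> x \<otimes>\<^bsub>T\<^esub> w \<otimes>\<^bsub>T\<^esub> inv\<^bsub>T\<^esub> (\<kappa> k x \<otimes>\<^bsub>T\<^esub> w) = \<phi> x \<otimes>\<^bsub>T\<^esub> inv\<^bsub>T\<^esub> \<kappa> k x"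
        using pk(2,4) w by (simp add: inv_mult_group m_assoc inv_solve_left) (simp add: m_assoc[symmetric])
      moreover have "c (s x, \<phi> x \<otimes>\<^bsub>T\<^esub> inv\<^bsub>T\<^esub> \<kappa> k x) \<in> carrier T"
      proof -
        have "s x \<in> {0..1}" by (simp add: s_def)
        then show ?thesis
          using pk(2,4) by (intro continuous_map_carrier[OF c]) (simp add: topspace_gtop)
      qed
      ultimately show ?thesis
        using False x y uu ss pk w by (simp add: \<psi>_def h_def m_assoc)
    qed
  qed
  then have "partial_solution (?K, \<psi>)"
    using cont KI by (simp add: partial_solution_def \<psi>_def)
  moreover have "extended_by (J, \<phi>) (?K, \<psi>)"
  proof -
    have "\<psi> x = \<phi> x" if x: "x \<in> positive_set J" "\<rho> k x = 0" for x
    proof -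
      have "x \<in> topspace X" using x by (simp add: positive_set_def)
      then have "0 < ?\<sigma> x" using x \<sigma>pos by blast
      then have "u x = -1" using x by (simp add: u_def)
      moreover have "x \<in> positive_set ?K" using x positive_set_mono[of J ?K] by blast
      ultimately show ?thesis by (simp add: \<psi>_def)
    qed
    then show ?thesis using k by (auto simp: extended_by_def)
  qed
  ultimately show ?thesis by blast
qed

theorem global_solution:
  "\<exists>\<phi>. continuous_map X (gtop T) \<phi> \<and> (\<forall>x y w. (x, y, w) \<in> R \<longrightarrow> \<phi> y = \<phi> x \<otimes>\<^bsub>T\<^esub> w)"
proof -
  obtain p where p: "partial_solution p" "\<And>q. partial_solution q \<Longrightarrow> extended_by p q \<Longrightarrow> q = p"
    using predicate_Zorn[OF partial_order chain_bound] by blast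
  obtain J \<phi> where eq: "p = (J, \<phi>)" by (metis surj_pair)
  have "J = I"
  proof (rule ccontr)
    assume "J \<noteq> I"
    then obtain k where k: "k \<in> I" "k \<notin> J" using p(1) by (auto simp: eq partial_solution_def)
    then obtain \<psi> where "partial_solution (insert k J, \<psi>)" "extended_by p (insert k J, \<psi>)"
      using extension_step p(1) unfolding eq by blast
    then have "(insert k J, \<psi>) = p" by (rule p(2))
    then show False using k by (auto simp: eq)
  qed
  moreover have "positive_set I = topspace X" using rho_cover by (auto simp: positive_set_def)
  ultimately have "continuous_map X (gtop T) \<phi> \<and> (\<forall>x y w. (x, y, w) \<in> R \<longrightarrow> \<phi> y = \<phi> x \<otimes>\<^bsub>T\<^esub> w)"
    using p(1) R_closed unfolding eq partial_solution_def by auto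
  then show ?thesis by blast
qed

end

section \<open>Principal bundles\<close>

lemma continuous_map_case_prod:
  assumes "continuous_map (prod_topology X Y) Z (\<lambda>(x, y). f x y)"
    and "continuous_map W X a" "continuous_map W Y b"
  shows "continuous_map W Z (\<lambda>w. f (a w) (b w))"
  using continuous_map_compose[OF continuous_map_pairedI[OF assms(2,3)] assms(1)]
  by (simp add: o_def)

lemma homeomorphic_map_inverse:
  assumes f: "homeomorphic_map X Y f"
  shows "\<exists>k. homeomorphic_map Y X k \<and>
    (\<forall>x\<in>topspace X. f x \<in> topspace Y \<and> k (f x) = x) \<and>
    (\<forall>y\<in>topspace Y. k y \<in> topspace X \<and> f (k y) = y)"
proof -
  obtain k where k: "homeomorphic_maps X Y f k"
    using f homeomorphic_map_maps by blast
  then have c: "continuous_map X Y f" "continuous_map Y X k"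
    by (auto simp: homeomorphic_maps_def)
  have "homeomorphic_map Y X k" using k by (metis homeomorphic_maps_map)
  with k show ?thesis
    using continuous_map_image_subset_topspace[OF c(1)] continuous_map_image_subset_topspace[OF c(2)]
    unfolding homeomorphic_maps_def by blast
qed

text \<open>A chart \<open>\<phi> (u, g)\<close> is split into the section
  \<open>s u = \<phi> (u, 1)\<close> and the fibre coordinate \<gamma>, the second component of the
  inverse of \<phi>. Sections and coordinates are what later constructions supply and use
  separately; \<open>trivialization_exists\<close> and \<open>principal_bundleI\<close> translate
  between the two forms.\<close>

definition trivialization ::
  "'g topgroup \<Rightarrow> 'm topology \<Rightarrow> ('p, 'm, 'g, 'x) pbundle_scheme \<Rightarrow>
     'm set \<Rightarrow> ('m \<Rightarrow> 'p) \<Rightarrow> ('p \<Rightarrow> 'g) \<Rightarrow> bool" where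
  "trivialization G M P U s \<gamma> \<longleftrightarrow> openin M U \<and>
     continuous_map (subtopology M U) (total P) s \<and> (\<forall>u\<in>U. proj P (s u) = u) \<and>
     continuous_map (subtopology (total P) {p \<in> topspace (total P). proj P p \<in> U}) (gtop G) \<gamma> \<and>
     (\<forall>p\<in>topspace (total P). proj P p \<in> U \<longrightarrow> ract P (s (proj P p)) (\<gamma> p) = p) \<and>
     (\<forall>u\<in>U. \<forall>g\<in>carrier G. \<gamma> (ract P (s u) g) = g)"

locale principal = G: topological_group G for G :: "'g topgroup" +
  fixes M :: "'m topology" and P :: "('p, 'm, 'g, 'x) pbundle_scheme"
  assumes principal: "principal_bundle G M P"
begin

lemma proj_continuous: "continuous_map (total P) M (proj P)"
  and ract_continuous:
    "continuous_map (prod_topology (total P) (gtop G)) (total P) (\<lambda>(p, g). ract P p g)"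
  and ract_one: "p \<in> topspace (total P) \<Longrightarrow> ract P p \<one>\<^bsub>G\<^esub> = p"
  and ract_mult: "p \<in> topspace (total P) \<Longrightarrow> g \<in> carrier G \<Longrightarrow> g' \<in> carrier G \<Longrightarrow>
    ract P (ract P p g) g' = ract P p (g \<otimes>\<^bsub>G\<^esub> g')"
  and proj_ract: "p \<in> topspace (total P) \<Longrightarrow> g \<in> carrier G \<Longrightarrow> proj P (ract P p g) = proj P p"
  using principal by (auto simp: principal_bundle_def)

lemma proj_closed: "p \<in> topspace (total P) \<Longrightarrow> proj P p \<in> topspace M"
  using continuous_map_image_subset_topspace[OF proj_continuous] by auto

lemma ract_closed: "p \<in> topspace (total P) \<Longrightarrow> g \<in> carrier G \<Longrightarrow> ract P p g \<in> topspace (total P)"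
  using continuous_map_image_subset_topspace[OF ract_continuous]
  by (force simp: G.topspace_gtop)

lemma continuous_map_ractI:
  assumes "continuous_map W (total P) a" "continuous_map W (gtop G) b"
  shows "continuous_map W (total P) (\<lambda>w. ract P (a w) (b w))"
  by (rule continuous_map_case_prod[OF ract_continuous assms])

lemma trivialization_exists:
  assumes m: "m \<in> topspace M"
  shows "\<exists>U s \<gamma>. m \<in> U \<and> trivialization G M P U s \<gamma>"
proof -
  have "\<exists>U \<phi>. openin M U \<and> m \<in> U \<and>
        homeomorphic_map (prod_topology (subtopology M U) (gtop G))
          (subtopology (total P) {p \<in> topspace (total P). proj P p \<in> U}) \<phi> \<and>
        (\<forall>u\<in>U. \<forall>g\<in>carrier G. proj P (\<phi> (u, g)) = u) \<and>
        (\<forall>u\<in>U. \<forall>g\<in>carrier G. \<forall>g'\<in>carrier G.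
           \<phi> (u, g \<otimes>\<^bsub>G\<^esub> g') = ract P (\<phi> (u, g)) g')"
    using principal m unfolding principal_bundle_def by blast
  then obtain U \<phi> where U: "openin M U" "m \<in> U"
    and \<phi>: "homeomorphic_map (prod_topology (subtopology M U) (gtop G))
          (subtopology (total P) {p \<in> topspace (total P). proj P p \<in> U}) \<phi>"
    and \<phi>p: "\<And>u g. u \<in> U \<Longrightarrow> g \<in> carrier G \<Longrightarrow> proj P (\<phi> (u, g)) = u"
    and \<phi>m: "\<And>u g g'. u \<in> U \<Longrightarrow> g \<in> carrier G \<Longrightarrow> g' \<in> carrier G \<Longrightarrow>
           \<phi> (u, g \<otimes>\<^bsub>G\<^esub> g') = ract P (\<phi> (u, g)) g'"
    by blast
  let ?W = "{p \<in> topspace (total P). proj P p \<in> U}"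
  have top: "topspace (prod_topology (subtopology M U) (gtop G)) = U \<times> carrier G"
    using openin_subset[OF U(1)] by (auto simp: G.topspace_gtop)
  have topW: "topspace (subtopology (total P) ?W) = ?W" by auto
  obtain k where kh: "homeomorphic_map (subtopology (total P) ?W) (prod_topology (subtopology M U) (gtop G)) k"
    and k1: "\<forall>x\<in>U \<times> carrier G. \<phi> x \<in> ?W \<and> k (\<phi> x) = x"
    and k2: "\<forall>p\<in>?W. k p \<in> U \<times> carrier G \<and> \<phi> (k p) = p"
    using homeomorphic_map_inverse[OF \<phi>] unfolding top topW by blast
  have k: "continuous_map (subtopology (total P) ?W) (prod_topology (subtopology M U) (gtop G)) k"
    "\<And>x. x \<in> U \<times> carrier G \<Longrightarrow> k (\<phi> x) = x"
    "\<And>p. p \<in> ?W \<Longrightarrow> \<phi> (k p) = p" "\<And>p. p \<in> ?W \<Longrightarrow> k p \<in> U \<times> carrier G"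
    using homeomorphic_imp_continuous_map[OF kh] k1 k2 by blast+
  define s where "s u = \<phi> (u, \<one>\<^bsub>G\<^esub>)" for u
  define \<gamma> where "\<gamma> p = snd (k p)" for p
  have "continuous_map (subtopology M U) (subtopology (total P) ?W) s"
    unfolding s_def
    by (rule continuous_map_compose[unfolded o_def, OF _ homeomorphic_imp_continuous_map[OF \<phi>]])
      (intro continuous_map_pairedI, auto simp: G.topspace_gtop)
  then have "continuous_map (subtopology M U) (total P) s"
    by (simp add: continuous_map_in_subtopology)
  moreover have "continuous_map (subtopology (total P) ?W) (gtop G) \<gamma>"
    unfolding \<gamma>_def using continuous_map_compose[OF k(1) continuous_map_snd] by (simp add: o_def)
  moreover have "ract P (s (proj P p)) (\<gamma> p) = p" if "p \<in> ?W" for p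
  proof -
    from k(4)[OF that] obtain u g where ug: "k p = (u, g)" "u \<in> U" "g \<in> carrier G" by auto
    then have "p = \<phi> (u, g)" using k(3)[OF that] by simp
    then show ?thesis
      using ug \<phi>p[OF ug(2,3)] \<phi>m[OF ug(2) G.one_closed ug(3)] by (simp add: s_def \<gamma>_def)
  qed
  moreover have "\<gamma> (ract P (s u) g) = g" if "u \<in> U" "g \<in> carrier G" for u g
    using \<phi>m[OF that(1) G.one_closed that(2)] k(2)[of "(u, g)"] that by (simp add: s_def \<gamma>_def)
  ultimately have "trivialization G M P U s \<gamma>"
    using U \<phi>p unfolding trivialization_def by (auto simp: s_def)
  then show ?thesis using U by blast
qed

context
  fixes U s \<gamma> assumes t: "trivialization G M P U s \<gamma>"
begin

lemma triv_open: "openin M U" "U \<subseteq> topspace M"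
  and triv_section: "continuous_map (subtopology M U) (total P) s"
  and triv_proj: "u \<in> U \<Longrightarrow> proj P (s u) = u"
  and triv_coord: "continuous_map (subtopology (total P) {p \<in> topspace (total P). proj P p \<in> U}) (gtop G) \<gamma>"
  and triv_eq: "p \<in> topspace (total P) \<Longrightarrow> proj P p \<in> U \<Longrightarrow> ract P (s (proj P p)) (\<gamma> p) = p"
  and triv_coord_ract: "u \<in> U \<Longrightarrow> g \<in> carrier G \<Longrightarrow> \<gamma> (ract P (s u) g) = g"
  using t openin_subset[of M U] by (auto simp: trivialization_def)

lemma triv_section_closed: "u \<in> U \<Longrightarrow> s u \<in> topspace (total P)"
  using continuous_map_image_subset_topspace[OF triv_section] triv_open(2) by auto

lemma triv_coord_closed: "p \<in> topspace (total P) \<Longrightarrow> proj P p \<in> U \<Longrightarrow> \<gamma> p \<in> carrier G"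
  by (rule G.continuous_map_carrier[OF triv_coord]) simp

lemma triv_equivariant:
  assumes "p \<in> topspace (total P)" "proj P p \<in> U" "g \<in> carrier G"
  shows "\<gamma> (ract P p g) = \<gamma> p \<otimes>\<^bsub>G\<^esub> g"
proof -
  have "ract P p g = ract P (s (proj P p)) (\<gamma> p \<otimes>\<^bsub>G\<^esub> g)"
    using ract_mult[of "s (proj P p)" "\<gamma> p" g] triv_eq[OF assms(1,2)] assms
      triv_section_closed triv_coord_closed by simp
  then show ?thesis
    using triv_coord_ract[OF assms(2), of "\<gamma> p \<otimes>\<^bsub>G\<^esub> g"] assms triv_coord_closed by simp
qed

end

lemma transitive:
  assumes "p \<in> topspace (total P)" "q \<in> topspace (total P)" "proj P p = proj P q"
  obtains g where "g \<in> carrier G" "q = ract P p g"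
proof -
  obtain U s \<gamma> where U: "proj P p \<in> U" "trivialization G M P U s \<gamma>"
    using trivialization_exists[OF proj_closed[OF assms(1)]] by blast
  note C = triv_coord_closed[OF U(2)]
  let ?g = "inv\<^bsub>G\<^esub> \<gamma> p \<otimes>\<^bsub>G\<^esub> \<gamma> q"
  have g: "?g \<in> carrier G" using C U assms by simp
  have "ract P p ?g = ract P (s (proj P p)) (\<gamma> p \<otimes>\<^bsub>G\<^esub> ?g)"
    using triv_eq[OF U(2) assms(1) U(1)] ract_mult[of "s (proj P p)" "\<gamma> p" ?g] C U assms g
      triv_section_closed[OF U(2)] by simp
  also have "\<gamma> p \<otimes>\<^bsub>G\<^esub> ?g = \<gamma> q" using C U assms by (simp add: G.m_assoc[symmetric])
  also have "ract P (s (proj P p)) (\<gamma> q) = q" using triv_eq[OF U(2) assms(2)] U assms by simp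
  finally show ?thesis using that g by metis
qed

lemma free:
  assumes "p \<in> topspace (total P)" "g \<in> carrier G" "g' \<in> carrier G" "ract P p g = ract P p g'"
  shows "g = g'"
proof -
  obtain U s \<gamma> where U: "proj P p \<in> U" "trivialization G M P U s \<gamma>"
    using trivialization_exists[OF proj_closed[OF assms(1)]] by blast
  have "\<gamma> p \<otimes>\<^bsub>G\<^esub> g = \<gamma> p \<otimes>\<^bsub>G\<^esub> g'"
    using triv_equivariant[OF U(2) assms(1) U(1)] assms by metis
  then show ?thesis using triv_coord_closed[OF U(2) assms(1) U(1)] assms by simp
qed

end

lemma principal_bundleI:
  assumes G: "topological_group G"
    and proj: "continuous_map (total P) M (proj P)"
    and ract: "continuous_map (prod_topology (total P) (gtop G)) (total P) (\<lambda>(p, g). ract P p g)"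
    and one: "\<And>p. p \<in> topspace (total P) \<Longrightarrow> ract P p \<one>\<^bsub>G\<^esub> = p"
    and mult: "\<And>p g g'. p \<in> topspace (total P) \<Longrightarrow> g \<in> carrier G \<Longrightarrow> g' \<in> carrier G \<Longrightarrow>
        ract P (ract P p g) g' = ract P p (g \<otimes>\<^bsub>G\<^esub> g')"
    and pr: "\<And>p g. p \<in> topspace (total P) \<Longrightarrow> g \<in> carrier G \<Longrightarrow> proj P (ract P p g) = proj P p"
    and loc: "\<And>m. m \<in> topspace M \<Longrightarrow> \<exists>U s \<gamma>. m \<in> U \<and> trivialization G M P U s \<gamma>"
  shows "principal_bundle G M P"
proof -
  interpret G: topological_group G by fact
  let ?X = "topspace (total P)"
  have ractX: "ract P p g \<in> ?X" if "p \<in> ?X" "g \<in> carrier G" for p g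
    using continuous_map_image_subset_topspace[OF ract] that by (force simp: G.topspace_gtop)
  have "\<exists>U \<phi>. openin M U \<and> m \<in> U \<and>
        homeomorphic_map (prod_topology (subtopology M U) (gtop G))
          (subtopology (total P) {p \<in> ?X. proj P p \<in> U}) \<phi> \<and>
        (\<forall>u\<in>U. \<forall>g\<in>carrier G. proj P (\<phi> (u, g)) = u) \<and>
        (\<forall>u\<in>U. \<forall>g\<in>carrier G. \<forall>g'\<in>carrier G.
           \<phi> (u, g \<otimes>\<^bsub>G\<^esub> g') = ract P (\<phi> (u, g)) g')" if m: "m \<in> topspace M" for m
  proof -
    obtain U s \<gamma> where mU: "m \<in> U" and t: "trivialization G M P U s \<gamma>" using loc[OF m] by blast
    note td = t[unfolded trivialization_def]
    have U: "openin M U" "U \<subseteq> topspace M" using td openin_subset by blast+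
    have s: "continuous_map (subtopology M U) (total P) s" "\<And>u. u \<in> U \<Longrightarrow> proj P (s u) = u"
      and \<gamma>: "continuous_map (subtopology (total P) {p \<in> ?X. proj P p \<in> U}) (gtop G) \<gamma>"
      and eq: "\<And>p. p \<in> ?X \<Longrightarrow> proj P p \<in> U \<Longrightarrow> ract P (s (proj P p)) (\<gamma> p) = p"
      and cr: "\<And>u g. u \<in> U \<Longrightarrow> g \<in> carrier G \<Longrightarrow> \<gamma> (ract P (s u) g) = g"
      using td by auto
    have sX: "s u \<in> ?X" if "u \<in> U" for u
      using continuous_map_image_subset_topspace[OF s(1)] U that by auto
    let ?W = "subtopology (total P) {p \<in> ?X. proj P p \<in> U}"
    let ?Z = "prod_topology (subtopology M U) (gtop G)"
    define \<phi> where "\<phi> = (\<lambda>(u, g). ract P (s u) g)"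
    have top: "topspace ?Z = U \<times> carrier G" using U by (auto simp: G.topspace_gtop)
    have \<gamma>C: "\<gamma> p \<in> carrier G" if "p \<in> ?X" "proj P p \<in> U" for p
      by (rule G.continuous_map_carrier[OF \<gamma>]) (use that in simp)
    have "continuous_map ?Z (total P) (\<lambda>z. ract P (s (fst z)) (snd z))"
      by (rule continuous_map_case_prod[OF ract])
        (use continuous_map_compose[OF continuous_map_fst s(1)] in \<open>auto simp: o_def continuous_map_snd\<close>)
    then have "continuous_map ?Z ?W \<phi>"
      using pr[OF sX] s(2) ractX[OF sX] unfolding \<phi>_def case_prod_beta continuous_map_in_subtopology top
      by auto
    moreover have "continuous_map ?W ?Z (\<lambda>p. (proj P p, \<gamma> p))"
      using \<gamma> continuous_map_from_subtopology[OF proj]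
      by (intro continuous_map_pairedI) (auto simp: continuous_map_in_subtopology)
    moreover have "(proj P (\<phi> z), \<gamma> (\<phi> z)) = z" if "z \<in> topspace ?Z" for z
      using that unfolding top by (auto simp: \<phi>_def pr sX s(2) cr)
    moreover have "\<phi> (proj P p, \<gamma> p) = p" if "p \<in> topspace ?W" for p
      using that eq by (auto simp: \<phi>_def)
    ultimately have "homeomorphic_maps ?Z ?W \<phi> (\<lambda>p. (proj P p, \<gamma> p))"
      unfolding homeomorphic_maps_def by blast
    then have "homeomorphic_map ?Z ?W \<phi>" using homeomorphic_map_maps by blast
    moreover have "\<forall>u\<in>U. \<forall>g\<in>carrier G. proj P (\<phi> (u, g)) = u"
      using pr[OF sX] s(2) by (simp add: \<phi>_def)
    moreover have "\<forall>u\<in>U. \<forall>g\<in>carrier G. \<forall>g'\<in>carrier G. \<phi> (u, g \<otimes>\<^bsub>G\<^esub> g') = ract P (\<phi> (u, g)) g'"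
      using mult[OF sX] by (simp add: \<phi>_def)
    ultimately show ?thesis using U mU by blast
  qed
  then show ?thesis
    unfolding principal_bundle_def using proj ract one mult pr by auto
qed

text \<open>A bundle map over the identity is invertible for fibrewise reasons: freeness makes it
  injective, transitivity makes it surjective, and in local coordinates the inverse is an expression
  in continuous group operations. Isomorphisms of bibundles therefore only require a continuous
  equivariant map.\<close>

lemma equivariant_homeomorphism:
  assumes P: "principal G M P" and Q: "principal G M Q"
    and f: "continuous_map (total P) (total Q) f"
    and pr: "\<And>p. p \<in> topspace (total P) \<Longrightarrow> proj Q (f p) = proj P p"
    and eqv: "\<And>p g. p \<in> topspace (total P) \<Longrightarrow> g \<in> carrier G \<Longrightarrow> f (ract P p g) = ract Q (f p) g"
  shows "homeomorphic_map (total P) (total Q) f"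
proof -
  interpret P: principal G M P by fact
  interpret Q: principal G M Q by fact
  let ?X = "topspace (total P)" and ?Y = "topspace (total Q)"
  have fY: "f p \<in> ?Y" if "p \<in> ?X" for p
    using continuous_map_image_subset_topspace[OF f] that by blast
  have inj: "inj_on f ?X"
  proof (rule inj_onI)
    fix p q assume p: "p \<in> ?X" and q: "q \<in> ?X" and "f p = f q"
    then have "proj P p = proj P q" using pr by metis
    then obtain g where g: "g \<in> carrier G" "q = ract P p g" using P.transitive[OF p q] by blast
    have "ract Q (f p) g = ract Q (f p) \<one>\<^bsub>G\<^esub>"
      using eqv[OF p g(1)] g(2) \<open>f p = f q\<close> Q.ract_one[OF fY[OF p]] by simp
    then have "g = \<one>\<^bsub>G\<^esub>" using Q.free[OF fY[OF p] g(1) P.G.one_closed] by blast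
    then show "p = q" using g P.ract_one[OF p] by simp
  qed
  define k where "k = inv_into ?X f"
  have kf: "k (f p) = p" if "p \<in> ?X" for p using inj that by (simp add: k_def)
  have local: "\<exists>U g. openin (total Q) U \<and> y \<in> U \<and> continuous_map (subtopology (total Q) U) (total P) g \<and>
      (\<forall>z\<in>U. k z = g z \<and> f (g z) = z)" if y: "y \<in> ?Y" for y
  proof -
    obtain U s \<gamma> where U: "proj Q y \<in> U" "trivialization G M P U s \<gamma>"
      using P.trivialization_exists[OF Q.proj_closed[OF y]] by blast
    obtain V \<sigma> \<delta> where V: "proj Q y \<in> V" "trivialization G M Q V \<sigma> \<delta>"
      using Q.trivialization_exists[OF Q.proj_closed[OF y]] by blast
    let ?W = "{z \<in> ?Y. proj Q z \<in> U \<inter> V}"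
    \<comment> \<open>If \<open>f (s u)\<close> has coordinate \<open>\<delta> (f (s u))\<close>,
      then moving \<open>s u\<close> by the quotient of the coordinates gives the point of the fibre
      that \<open>f\<close> sends to \<open>z\<close>.\<close>
    define g where "g z = ract P (s (proj Q z)) (inv\<^bsub>G\<^esub> \<delta> (f (s (proj Q z))) \<otimes>\<^bsub>G\<^esub> \<delta> z)" for z
    have "openin (total Q) ?W"
      using U V P.triv_open Q.triv_open by (intro openin_continuous_map_preimage[OF Q.proj_continuous]) blast
    moreover have "continuous_map (subtopology (total Q) ?W) (total P) g"
      unfolding g_def
    proof (intro P.continuous_map_ractI P.G.continuous_map_multI P.G.continuous_map_invI)
      have pc: "continuous_map (subtopology (total Q) ?W) (subtopology M (U \<inter> V)) (proj Q)"
        using continuous_map_from_subtopology[OF Q.proj_continuous]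
        by (auto simp: continuous_map_in_subtopology)
      have "continuous_map (subtopology M (U \<inter> V)) (total P) s"
        by (rule continuous_map_from_subtopology_mono[OF P.triv_section[OF U(2)]]) blast
      from continuous_map_compose[OF pc this]
      show s: "continuous_map (subtopology (total Q) ?W) (total P) (\<lambda>z. s (proj Q z))"
        by (simp add: o_def)
      have "continuous_map (subtopology (total Q) ?W) (total Q) (\<lambda>z. f (s (proj Q z)))"
        using continuous_map_compose[OF s f] by (simp add: o_def)
      then have "continuous_map (subtopology (total Q) ?W)
          (subtopology (total Q) {q \<in> ?Y. proj Q q \<in> V}) (\<lambda>z. f (s (proj Q z)))"
        unfolding continuous_map_in_subtopology
        by (auto simp: pr P.triv_section_closed[OF U(2)] P.triv_proj[OF U(2)] fY)
      from continuous_map_compose[OF this Q.triv_coord[OF V(2)]]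
      show "continuous_map (subtopology (total Q) ?W) (gtop G) (\<lambda>z. \<delta> (f (s (proj Q z))))"
        by (simp add: o_def)
      show "continuous_map (subtopology (total Q) ?W) (gtop G) \<delta>"
        by (rule continuous_map_from_subtopology_mono[OF Q.triv_coord[OF V(2)]]) blast
    qed
    moreover have "f (g z) = z \<and> g z \<in> ?X" if z: "z \<in> ?W" for z
    proof -
      have zs: "z \<in> ?Y" "proj Q z \<in> U" "proj Q z \<in> V" using z by auto
      have sX: "s (proj Q z) \<in> ?X" using P.triv_section_closed[OF U(2)] zs by blast
      have pfs: "proj Q (f (s (proj Q z))) = proj Q z"
        using pr[OF sX] P.triv_proj[OF U(2) zs(2)] by simp
      have C: "\<delta> (f (s (proj Q z))) \<in> carrier G" "\<delta> z \<in> carrier G"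
        using Q.triv_coord_closed[OF V(2)] fY[OF sX] pfs zs by auto
      let ?w = "f (s (proj Q z))"
      let ?g = "inv\<^bsub>G\<^esub> \<delta> ?w \<otimes>\<^bsub>G\<^esub> \<delta> z"
      have gX: "g z \<in> ?X" unfolding g_def using C sX by (intro P.ract_closed) auto
      have "f (g z) = ract Q ?w ?g"
        unfolding g_def using C by (intro eqv sX) auto
      also have "\<dots> = ract Q (ract Q (\<sigma> (proj Q z)) (\<delta> ?w)) ?g"
        using Q.triv_eq[OF V(2) fY[OF sX]] pfs zs by simp
      also have "\<dots> = ract Q (\<sigma> (proj Q z)) (\<delta> ?w \<otimes>\<^bsub>G\<^esub> ?g)"
        using C Q.triv_section_closed[OF V(2)] zs by (intro Q.ract_mult) auto
      also have "\<delta> ?w \<otimes>\<^bsub>G\<^esub> ?g = \<delta> z" using C by (simp add: P.G.m_assoc[symmetric])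
      also have "ract Q (\<sigma> (proj Q z)) (\<delta> z) = z" using Q.triv_eq[OF V(2)] zs by blast
      finally show ?thesis using gX by blast
    qed
    moreover have "y \<in> ?W" using y U V by blast
    ultimately show ?thesis using kf by (intro exI[of _ ?W] exI[of _ g]) metis
  qed
  have "continuous_map (total Q) (total P) k"
  proof (rule continuous_map_locally)
    fix y assume "y \<in> ?Y"
    from local[OF this] show "\<exists>U g. openin (total Q) U \<and> y \<in> U \<and>
        continuous_map (subtopology (total Q) U) (total P) g \<and> (\<forall>z\<in>U. k z = g z)"
      by (elim exE conjE) (intro exI conjI, assumption+, blast)
  qed
  moreover have "f (k y) = y" if "y \<in> ?Y" for y using local[OF that] by metis
  ultimately have "homeomorphic_maps (total P) (total Q) f k"
    using f kf unfolding homeomorphic_maps_def by blast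
  then show ?thesis using homeomorphic_map_maps by blast
qed

section \<open>Bibundles, their isomorphism classes and their pullbacks\<close>

locale bibundle = principal G M P for G :: "'g topgroup" and M :: "'m topology"
    and P :: "('p, 'm, 'g, 'h) bibundle" +
  fixes H :: "'h topgroup" and t :: "'g \<Rightarrow> 'h"
  assumes bibundle: "is_bibundle H G t M P"
begin

lemma str_continuous: "continuous_map (total P) (gtop H) (str P)"
  and str_ract: "p \<in> topspace (total P) \<Longrightarrow> g \<in> carrier G \<Longrightarrow> str P (ract P p g) = str P p \<otimes>\<^bsub>H\<^esub> t g"
  using bibundle by (auto simp: is_bibundle_def)

end

lemma bibundle_locale:
  assumes "topological_group G" "is_bibundle H G t M P"
  shows "bibundle G M P H t"
  using assms unfolding bibundle_def bibundle_axioms_def principal_def principal_axioms_def is_bibundle_def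
  by simp

lemma bibundle_isoI:
  assumes G: "topological_group G" and "is_bibundle H G t M P" "is_bibundle H G t M Q"
    and "continuous_map (total P) (total Q) f"
    and "\<And>p. p \<in> topspace (total P) \<Longrightarrow> proj Q (f p) = proj P p"
    and "\<And>p. p \<in> topspace (total P) \<Longrightarrow> str Q (f p) = str P p"
    and "\<And>p g. p \<in> topspace (total P) \<Longrightarrow> g \<in> carrier G \<Longrightarrow> f (ract P p g) = ract Q (f p) g"
  shows "bibundle_iso G P Q"
proof -
  interpret P: bibundle G M P H t by (rule bibundle_locale[OF G assms(2)])
  interpret Q: bibundle G M Q H t by (rule bibundle_locale[OF G assms(3)])
  have "homeomorphic_map (total P) (total Q) f"
    by (rule equivariant_homeomorphism[OF P.principal_axioms Q.principal_axioms]) (use assms in auto)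
  then show ?thesis using assms unfolding bibundle_iso_def by auto
qed

lemma bibundle_iso_trans:
  assumes "bibundle_iso G P Q" "bibundle_iso G Q R"
  shows "bibundle_iso G P R"
proof -
  obtain f where f: "homeomorphic_map (total P) (total Q) f"
    "\<And>p. p \<in> topspace (total P) \<Longrightarrow> proj Q (f p) = proj P p \<and> str Q (f p) = str P p \<and>
        (\<forall>g\<in>carrier G. f (ract P p g) = ract Q (f p) g)"
    using assms(1) unfolding bibundle_iso_def by blast
  obtain k where k: "homeomorphic_map (total Q) (total R) k"
    "\<And>p. p \<in> topspace (total Q) \<Longrightarrow> proj R (k p) = proj Q p \<and> str R (k p) = str Q p \<and>
        (\<forall>g\<in>carrier G. k (ract Q p g) = ract R (k p) g)"
    using assms(2) unfolding bibundle_iso_def by blast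
  have "f p \<in> topspace (total Q)" if "p \<in> topspace (total P)" for p
    using homeomorphic_imp_surjective_map[OF f(1)] that by blast
  then show ?thesis
    unfolding bibundle_iso_def
    using homeomorphic_map_compose[OF f(1) k(1)] f(2) k(2) by (intro exI[of _ "k \<circ> f"]) simp
qed

lemma bibundle_iso_sym:
  assumes iso: "bibundle_iso G P Q"
    and closed: "\<And>p g. p \<in> topspace (total P) \<Longrightarrow> g \<in> carrier G \<Longrightarrow> ract P p g \<in> topspace (total P)"
  shows "bibundle_iso G Q P"
proof -
  obtain f where f: "homeomorphic_map (total P) (total Q) f"
    "\<And>p. p \<in> topspace (total P) \<Longrightarrow> proj Q (f p) = proj P p \<and> str Q (f p) = str P p \<and>
        (\<forall>g\<in>carrier G. f (ract P p g) = ract Q (f p) g)"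
    using iso unfolding bibundle_iso_def by blast
  obtain k where kh: "homeomorphic_map (total Q) (total P) k"
    and k1: "\<forall>x\<in>topspace (total P). f x \<in> topspace (total Q) \<and> k (f x) = x"
    and k2: "\<forall>y\<in>topspace (total Q). k y \<in> topspace (total P) \<and> f (k y) = y"
    using homeomorphic_map_inverse[OF f(1)] by blast
  have k: "\<And>x. x \<in> topspace (total P) \<Longrightarrow> k (f x) = x"
    "\<And>y. y \<in> topspace (total Q) \<Longrightarrow> f (k y) = y"
    "\<And>y. y \<in> topspace (total Q) \<Longrightarrow> k y \<in> topspace (total P)"
    "homeomorphic_map (total Q) (total P) k"
    using kh k1 k2 by blast+
  have "proj P (k q) = proj Q q \<and> str P (k q) = str Q q \<and>
      (\<forall>g\<in>carrier G. k (ract Q q g) = ract P (k q) g)" if q: "q \<in> topspace (total Q)" for q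
  proof (intro conjI ballI)
    show "proj P (k q) = proj Q q" "str P (k q) = str Q q"
      using f(2)[OF k(3)[OF q]] k(2)[OF q] by auto
    fix g assume g: "g \<in> carrier G"
    have "ract Q q g = f (ract P (k q) g)" using f(2)[OF k(3)[OF q]] k(2)[OF q] g by simp
    then show "k (ract Q q g) = ract P (k q) g" using k(1) closed[OF k(3)[OF q] g] by simp
  qed
  then show ?thesis unfolding bibundle_iso_def using k(4) by blast
qed

text \<open>\<open>P\<close>, \<open>Q\<close> and the members of the classes may be carried by
  three different types. This is how pullbacks of \<open>E\<close>, whose points are not of type
  \<open>'p\<close>, are compared by their classes in \<open>'p\<close>.\<close>

lemma bibundle_class_eq:
  assumes iso: "bibundle_iso G P Q"
    and closed: "\<And>p g. p \<in> topspace (total P) \<Longrightarrow> g \<in> carrier G \<Longrightarrow> ract P p g \<in> topspace (total P)"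
  shows "bibundle_class H G t M P = bibundle_class H G t M Q"
  using bibundle_iso_trans[OF iso] bibundle_iso_trans[OF bibundle_iso_sym[OF iso closed]]
  unfolding bibundle_class_def by blast

lemma pullback_bibundle:
  assumes G: "topological_group G" and P: "is_bibundle H G t N P" and F: "continuous_map M N F"
  shows "is_bibundle H G t M (pullback_bibundle M F P)"
proof -
  interpret P: bibundle G N P H t by (rule bibundle_locale[OF G P])
  let ?Q = "pullback_bibundle M F P"
  have Q: "total ?Q = subtopology (prod_topology M (total P)) {(m, p). F m = proj P p}"
    "proj ?Q = fst" "ract ?Q = (\<lambda>(m, p) g. (m, ract P p g))" "str ?Q = (\<lambda>(m, p). str P p)"
    by (simp_all add: pullback_bibundle_def)
  have top: "topspace (total ?Q) = {(m, p). m \<in> topspace M \<and> p \<in> topspace (total P) \<and> F m = proj P p}"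
    unfolding Q by auto
  have fst: "continuous_map (total ?Q) M fst" and snd: "continuous_map (total ?Q) (total P) snd"
    unfolding Q by (auto intro: continuous_map_from_subtopology continuous_map_fst continuous_map_snd)
  have "principal_bundle G M ?Q"
  proof (rule principal_bundleI[OF G])
    show "continuous_map (total ?Q) M (proj ?Q)" using fst by (simp add: Q)
    let ?Z = "prod_topology (total ?Q) (gtop G)"
    have "continuous_map ?Z (prod_topology M (total P)) (\<lambda>z. (fst (fst z), ract P (snd (fst z)) (snd z)))"
      using continuous_map_compose[OF continuous_map_fst fst, of "gtop G"]
        continuous_map_compose[OF continuous_map_fst snd, of "gtop G"]
      by (intro continuous_map_pairedI P.continuous_map_ractI) (auto simp: o_def continuous_map_snd)
    then have "continuous_map ?Z (total ?Q) (\<lambda>z. (fst (fst z), ract P (snd (fst z)) (snd z)))"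
      unfolding Q(1) continuous_map_in_subtopology
      by (auto simp: P.G.topspace_gtop P.proj_ract)
    moreover have "(\<lambda>z. (fst (fst z), ract P (snd (fst z)) (snd z))) = (\<lambda>(p, g). ract ?Q p g)"
      by (auto simp: Q)
    ultimately show "continuous_map ?Z (total ?Q) (\<lambda>(p, g). ract ?Q p g)" by metis
    show "\<exists>U s \<gamma>. m \<in> U \<and> trivialization G M ?Q U s \<gamma>" if m: "m \<in> topspace M" for m
    proof -
      have Fm: "F m \<in> topspace N" using F m continuous_map_image_subset_topspace by blast
      then obtain U s \<gamma> where U: "F m \<in> U" "trivialization G N P U s \<gamma>"
        using P.trivialization_exists by blast
      let ?U = "{m \<in> topspace M. F m \<in> U}"
      have FU: "continuous_map (subtopology M ?U) (subtopology N U) F"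
        using continuous_map_from_subtopology[OF F] by (auto simp: continuous_map_in_subtopology)
      have "trivialization G M ?Q ?U (\<lambda>m. (m, s (F m))) (\<lambda>z. \<gamma> (snd z))"
        unfolding trivialization_def
      proof (intro conjI ballI impI)
        show "openin M ?U" by (rule openin_continuous_map_preimage[OF F P.triv_open(1)[OF U(2)]])
        have "continuous_map (subtopology M ?U) (prod_topology M (total P)) (\<lambda>m. (m, s (F m)))"
          using continuous_map_compose[OF FU P.triv_section[OF U(2)]]
          by (intro continuous_map_pairedI) (auto simp: o_def continuous_map_from_subtopology[OF continuous_map_id[unfolded id_def]])
        then show "continuous_map (subtopology M ?U) (total ?Q) (\<lambda>m. (m, s (F m)))"
          unfolding Q(1) continuous_map_in_subtopology by (auto simp: P.triv_proj[OF U(2)])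
        let ?V = "{p \<in> topspace (total ?Q). proj ?Q p \<in> ?U}"
        have "continuous_map (subtopology (total ?Q) ?V)
            (subtopology (total P) {p \<in> topspace (total P). proj P p \<in> U}) snd"
          unfolding continuous_map_in_subtopology
          using continuous_map_from_subtopology[OF snd, of ?V] by (auto simp: Q)
        from continuous_map_compose[OF this P.triv_coord[OF U(2)]]
        show "continuous_map (subtopology (total ?Q) ?V) (gtop G) (\<lambda>z. \<gamma> (snd z))" by (simp add: o_def)
      next
        fix p assume "p \<in> topspace (total ?Q)" "proj ?Q p \<in> ?U"
        then show "ract ?Q ((\<lambda>m. (m, s (F m))) (proj ?Q p)) (\<gamma> (snd p)) = p"
          using P.triv_eq[OF U(2)] unfolding top by (auto simp: Q)
      qed (use P.triv_coord_ract[OF U(2)] in \<open>auto simp: Q\<close>)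
      moreover have "m \<in> ?U" using m U(1) by simp
      ultimately show ?thesis by (intro exI conjI)
    qed
  qed (auto simp: Q P.ract_one P.ract_mult)
  moreover have "continuous_map (total ?Q) (gtop H) (str ?Q)"
    using continuous_map_compose[OF snd P.str_continuous] by (simp add: Q(4) o_def case_prod_unfold)
  moreover have "str ?Q (ract ?Q p g) = str ?Q p \<otimes>\<^bsub>H\<^esub> t g" if "p \<in> topspace (total ?Q)" "g \<in> carrier G" for p g
    using that P.str_ract by (auto simp: Q)
  ultimately show ?thesis unfolding is_bibundle_def by blast
qed

lemma unit_bibundle:
  assumes G: "topological_group G" and H: "topological_group H"
    and t: "t \<in> hom G H" "continuous_map (gtop G) (gtop H) t"
  shows "is_bibundle H G t M (unit_bibundle G t M)"
proof -
  interpret G: topological_group G by fact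
  let ?Q = "unit_bibundle G t M"
  have Q: "total ?Q = prod_topology M (gtop G)" "proj ?Q = fst"
    "ract ?Q = (\<lambda>(m, x) g. (m, x \<otimes>\<^bsub>G\<^esub> g))" "str ?Q = (\<lambda>(m, x). t x)"
    by (simp_all add: unit_bibundle_def)
  have top: "topspace (total ?Q) = topspace M \<times> carrier G" by (simp add: Q G.topspace_gtop)
  have "principal_bundle G M ?Q"
  proof (rule principal_bundleI[OF G])
    show "continuous_map (total ?Q) M (proj ?Q)" by (simp add: Q continuous_map_fst)
    have "continuous_map (prod_topology (total ?Q) (gtop G)) (total ?Q)
        (\<lambda>z. (fst (fst z), snd (fst z) \<otimes>\<^bsub>G\<^esub> snd z))"
      unfolding Q
      by (intro continuous_map_pairedI G.continuous_map_multI continuous_map_snd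
          continuous_map_compose[OF continuous_map_fst, unfolded o_def] continuous_map_fst)
    moreover have "(\<lambda>z. (fst (fst z), snd (fst z) \<otimes>\<^bsub>G\<^esub> snd z)) = (\<lambda>(p, g). ract ?Q p g)"
      by (auto simp: Q)
    ultimately show "continuous_map (prod_topology (total ?Q) (gtop G)) (total ?Q) (\<lambda>(p, g). ract ?Q p g)"
      by metis
    show "\<exists>U s \<gamma>. m \<in> U \<and> trivialization G M ?Q U s \<gamma>" if m: "m \<in> topspace M" for m
    proof -
      have "trivialization G M ?Q (topspace M) (\<lambda>m. (m, \<one>\<^bsub>G\<^esub>)) snd"
        unfolding trivialization_def
      proof (intro conjI ballI impI)
        show "continuous_map (subtopology M (topspace M)) (total ?Q) (\<lambda>m. (m, \<one>\<^bsub>G\<^esub>))"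
          unfolding Q by (intro continuous_map_pairedI) (auto simp: G.topspace_gtop)
        show "continuous_map (subtopology (total ?Q) {p \<in> topspace (total ?Q). proj ?Q p \<in> topspace M}) (gtop G) snd"
          unfolding Q by (intro continuous_map_from_subtopology continuous_map_snd)
      qed (auto simp: Q G.topspace_gtop)
      then show ?thesis using m by blast
    qed
  qed (auto simp: Q G.topspace_gtop G.m_assoc)
  moreover have "continuous_map (total ?Q) (gtop H) (str ?Q)"
    using continuous_map_compose[OF continuous_map_snd t(2), of M] by (simp add: Q o_def case_prod_unfold)
  moreover have "str ?Q (ract ?Q p g) = str ?Q p \<otimes>\<^bsub>H\<^esub> t g" if "p \<in> topspace (total ?Q)" "g \<in> carrier G" for p g
    using that t(1) by (auto simp: Q G.topspace_gtop hom_mult)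
  ultimately show ?thesis unfolding is_bibundle_def by blast
qed

section \<open>Quotients and actions of topological groups\<close>

text \<open>A product of quotient maps need not be a quotient map, but a product of open maps is
  open. This makes multiplication on a quotient group continuous, because the projection is
  open.\<close>

lemma open_map_prod:
  assumes f: "open_map X X' f" and g: "open_map Y Y' g"
  shows "open_map (prod_topology X Y) (prod_topology X' Y') (\<lambda>(x, y). (f x, g y))"
  unfolding open_map_def
proof (intro allI impI)
  fix S assume S: "openin (prod_topology X Y) S"
  show "openin (prod_topology X' Y') ((\<lambda>(x, y). (f x, g y)) ` S)"
    unfolding openin_prod_topology_alt
  proof (intro allI impI)
    fix a b assume "(a, b) \<in> (\<lambda>(x, y). (f x, g y)) ` S"
    then obtain x y where xy: "(x, y) \<in> S" "a = f x" "b = g y" by auto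
    then obtain U V where UV: "openin X U" "openin Y V" "x \<in> U" "y \<in> V" "U \<times> V \<subseteq> S"
      using S unfolding openin_prod_topology_alt by meson
    have "f ` U \<times> g ` V \<subseteq> (\<lambda>(x, y). (f x, g y)) ` S" using UV(5) by force
    moreover have "openin X' (f ` U)" "openin Y' (g ` V)"
      using f g UV by (auto simp: open_map_def)
    ultimately show "\<exists>U V. openin X' U \<and> openin Y' V \<and> a \<in> U \<and> b \<in> V \<and>
        U \<times> V \<subseteq> (\<lambda>(x, y). (f x, g y)) ` S"
      using xy UV(3,4) by (intro exI[of _ "f ` U"] exI[of _ "g ` V"]) auto
  qed
qed

locale topological_normal = topological_group T + normal N T
  for N :: "'a set" and T :: "'a topgroup"
begin

abbreviation \<pi> :: "'a \<Rightarrow> 'a set" where "\<pi> x \<equiv> N #>\<^bsub>T\<^esub> x"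

lemma carrier_topquot: "carrier (topquot T N) = \<pi> ` carrier T"
  by (simp add: carrier_FactGroup)

lemma topspace_topquot: "topspace (gtop (topquot T N)) = carrier (topquot T N)"
  unfolding carrier_topquot by (simp add: topspace_gtop)

lemma mult_topquot: "x \<in> carrier T \<Longrightarrow> y \<in> carrier T \<Longrightarrow> \<pi> x \<otimes>\<^bsub>topquot T N\<^esub> \<pi> y = \<pi> (x \<otimes>\<^bsub>T\<^esub> y)"
  by (simp add: rcos_sum)

lemma \<pi>_eq_iff: "x \<in> carrier T \<Longrightarrow> y \<in> carrier T \<Longrightarrow> \<pi> x = \<pi> y \<longleftrightarrow> (\<exists>n\<in>N. y = n \<otimes>\<^bsub>T\<^esub> x)"
  using repr_independence[OF _ _ is_subgroup, of y x] repr_independenceD[OF is_subgroup, of y x]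
  by (auto simp: r_coset_def)

lemma group_topquot: "group (topquot T N)"
proof -
  interpret Q: group "T Mod N" by (rule factorgroup_is_group)
  show ?thesis
  proof (rule groupI)
    fix x y z assume "x \<in> carrier (topquot T N)" "y \<in> carrier (topquot T N)" "z \<in> carrier (topquot T N)"
    then show "x \<otimes>\<^bsub>topquot T N\<^esub> y \<otimes>\<^bsub>topquot T N\<^esub> z = x \<otimes>\<^bsub>topquot T N\<^esub> (y \<otimes>\<^bsub>topquot T N\<^esub> z)"
      using Q.m_assoc[of x y z] by simp
  next
    fix x y assume "x \<in> carrier (topquot T N)" "y \<in> carrier (topquot T N)"
    then show "x \<otimes>\<^bsub>topquot T N\<^esub> y \<in> carrier (topquot T N)" using Q.m_closed[of x y] by simp
  next
    show "\<one>\<^bsub>topquot T N\<^esub> \<in> carrier (topquot T N)" using Q.one_closed by simp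
  next
    fix x assume "x \<in> carrier (topquot T N)"
    then show "\<one>\<^bsub>topquot T N\<^esub> \<otimes>\<^bsub>topquot T N\<^esub> x = x"
      "\<exists>y\<in>carrier (topquot T N). y \<otimes>\<^bsub>topquot T N\<^esub> x = \<one>\<^bsub>topquot T N\<^esub>"
      using Q.l_one[of x] Q.l_inv_ex[of x] by auto
  qed
qed

lemma one_topquot: "\<one>\<^bsub>topquot T N\<^esub> = \<pi> \<one>\<^bsub>T\<^esub>"
  using coset_mult_one[OF subset] by simp

lemma inv_topquot:
  assumes x: "x \<in> carrier T" shows "inv\<^bsub>topquot T N\<^esub> \<pi> x = \<pi> (inv\<^bsub>T\<^esub> x)"
proof -
  interpret Q: group "topquot T N" by (rule group_topquot)
  show ?thesis
    by (rule Q.inv_equality) (use x mult_topquot[of "inv\<^bsub>T\<^esub> x" x] in \<open>auto simp: carrier_topquot one_topquot simp del: topquot_simps\<close>)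
qed

lemma quotient_map_\<pi>: "quotient_map (gtop T) (gtop (topquot T N)) \<pi>"
  by (simp add: quotient_map_quotient_topology)

lemma continuous_map_\<pi>: "continuous_map (gtop T) (gtop (topquot T N)) \<pi>"
  using quotient_imp_continuous_map[OF quotient_map_\<pi>] .

text \<open>The preimage of the image of \<open>U\<close> is a union of translates of
  \<open>U\<close> by elements of \<open>N\<close>.\<close>

lemma open_map_\<pi>: "open_map (gtop T) (gtop (topquot T N)) \<pi>"
  unfolding open_map_def
proof (intro allI impI)
  fix U assume U: "openin (gtop T) U"
  then have UT: "U \<subseteq> carrier T" using openin_subset topspace_gtop by metis
  have "{x \<in> carrier T. \<pi> x \<in> \<pi> ` U} = (\<Union>n\<in>N. {x \<in> topspace (gtop T). n \<otimes>\<^bsub>T\<^esub> x \<in> U})"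
  proof (intro equalityI subsetI)
    fix x assume x: "x \<in> {x \<in> carrier T. \<pi> x \<in> \<pi> ` U}"
    then obtain u where u: "u \<in> U" "\<pi> x = \<pi> u" by blast
    then obtain n where "n \<in> N" "u = n \<otimes>\<^bsub>T\<^esub> x" using \<pi>_eq_iff[of x u] x UT by blast
    then show "x \<in> (\<Union>n\<in>N. {x \<in> topspace (gtop T). n \<otimes>\<^bsub>T\<^esub> x \<in> U})"
      using x u by (auto simp: topspace_gtop)
  next
    fix x assume "x \<in> (\<Union>n\<in>N. {x \<in> topspace (gtop T). n \<otimes>\<^bsub>T\<^esub> x \<in> U})"
    then obtain n where n: "n \<in> N" "x \<in> carrier T" "n \<otimes>\<^bsub>T\<^esub> x \<in> U" by (auto simp: topspace_gtop)
    then have "\<pi> x = \<pi> (n \<otimes>\<^bsub>T\<^esub> x)" using \<pi>_eq_iff[of x "n \<otimes>\<^bsub>T\<^esub> x"] UT by blast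
    then show "x \<in> {x \<in> carrier T. \<pi> x \<in> \<pi> ` U}" using n by blast
  qed
  moreover have "openin (gtop T) {x \<in> topspace (gtop T). n \<otimes>\<^bsub>T\<^esub> x \<in> U}" if "n \<in> N" for n
  proof (rule openin_continuous_map_preimage[OF _ U])
    show "continuous_map (gtop T) (gtop T) (\<lambda>x. n \<otimes>\<^bsub>T\<^esub> x)"
      using that subset by (intro continuous_map_multI) (auto simp: topspace_gtop)
  qed
  ultimately have "openin (gtop T) {x \<in> carrier T. \<pi> x \<in> \<pi> ` U}" by (simp only:) auto
  then show "openin (gtop (topquot T N)) (\<pi> ` U)"
    unfolding topquot_simps openin_quotient_topology using UT by (auto simp: topspace_gtop)
qed

lemma topological_group_topquot: "topological_group (topquot T N)"
proof -
  interpret Q: group "topquot T N" by (rule group_topquot)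
  let ?B = "gtop (topquot T N)"
  show ?thesis
  proof
    show "topspace ?B = carrier (topquot T N)" by (rule topspace_topquot)
    have q: "quotient_map (prod_topology (gtop T) (gtop T)) (prod_topology ?B ?B) (\<lambda>(x, y). (\<pi> x, \<pi> y))"
    proof (rule continuous_open_imp_quotient_map)
      show "open_map (prod_topology (gtop T) (gtop T)) (prod_topology ?B ?B) (\<lambda>(x, y). (\<pi> x, \<pi> y))"
        by (rule open_map_prod[OF open_map_\<pi> open_map_\<pi>])
      show "continuous_map (prod_topology (gtop T) (gtop T)) (prod_topology ?B ?B) (\<lambda>(x, y). (\<pi> x, \<pi> y))"
        unfolding case_prod_unfold
        by (intro continuous_map_pairedI continuous_map_compose[OF _ continuous_map_\<pi>, unfolded o_def]
          continuous_map_fst continuous_map_snd)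
      show "(\<lambda>(x, y). (\<pi> x, \<pi> y)) ` topspace (prod_topology (gtop T) (gtop T)) = topspace (prod_topology ?B ?B)"
        unfolding topspace_prod_topology topspace_topquot carrier_topquot topspace_gtop by force
    qed
    have "continuous_map (prod_topology (gtop T) (gtop T)) ?B
        ((\<lambda>(x, y). x \<otimes>\<^bsub>topquot T N\<^esub> y) \<circ> (\<lambda>(x, y). (\<pi> x, \<pi> y)))"
    proof (rule continuous_map_eq)
      show "continuous_map (prod_topology (gtop T) (gtop T)) ?B (\<pi> \<circ> (\<lambda>(x, y). x \<otimes>\<^bsub>T\<^esub> y))"
        by (rule continuous_map_compose[OF continuous_mult continuous_map_\<pi>])
      fix z assume "z \<in> topspace (prod_topology (gtop T) (gtop T))"
      then obtain x y where "z = (x, y)" "x \<in> carrier T" "y \<in> carrier T" by (auto simp: topspace_gtop)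
      then show "(\<pi> \<circ> (\<lambda>(x, y). x \<otimes>\<^bsub>T\<^esub> y)) z =
          ((\<lambda>(x, y). x \<otimes>\<^bsub>topquot T N\<^esub> y) \<circ> (\<lambda>(x, y). (\<pi> x, \<pi> y))) z"
        using mult_topquot by (simp del: topquot_simps)
    qed
    then show "continuous_map (prod_topology ?B ?B) ?B (\<lambda>(x, y). x \<otimes>\<^bsub>topquot T N\<^esub> y)"
      by (rule continuous_compose_quotient_map[OF q])
    have "continuous_map (gtop T) ?B ((\<lambda>x. inv\<^bsub>topquot T N\<^esub> x) \<circ> \<pi>)"
    proof (rule continuous_map_eq)
      show "continuous_map (gtop T) ?B (\<pi> \<circ> (\<lambda>x. inv\<^bsub>T\<^esub> x))"
        by (rule continuous_map_compose[OF continuous_inv continuous_map_\<pi>])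
    qed (simp add: inv_topquot topspace_gtop del: topquot_simps)
    then show "continuous_map ?B ?B (\<lambda>x. inv\<^bsub>topquot T N\<^esub> x)"
      by (rule continuous_compose_quotient_map[OF quotient_map_\<pi>])
  qed
qed

end

lemma (in group) AutoGroup_action:
  assumes K: "group K" and a: "a \<in> hom K (AutoGroup G)"
  shows "h \<in> carrier K \<Longrightarrow> x \<in> carrier G \<Longrightarrow> a h x \<in> carrier G"
    and "h \<in> carrier K \<Longrightarrow> x \<in> carrier G \<Longrightarrow> y \<in> carrier G \<Longrightarrow> a h (x \<otimes> y) = a h x \<otimes> a h y"
    and "h \<in> carrier K \<Longrightarrow> k \<in> carrier K \<Longrightarrow> x \<in> carrier G \<Longrightarrow> a (h \<otimes>\<^bsub>K\<^esub> k) x = a h (a k x)"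
    and "x \<in> carrier G \<Longrightarrow> a \<one>\<^bsub>K\<^esub> x = x"
    and "h \<in> carrier K \<Longrightarrow> x \<in> carrier G \<Longrightarrow> a h (inv x) = inv (a h x)"
proof -
  interpret K: group K by fact
  have auto: "a h \<in> auto G" if "h \<in> carrier K" for h
    using hom_in_carrier[OF a that] by (simp add: AutoGroup_def)
  then have h: "a h \<in> hom G G" "a h \<in> Bij (carrier G)" if "h \<in> carrier K" for h
    using that by (auto simp: auto_def)
  show c: "a h x \<in> carrier G" if "h \<in> carrier K" "x \<in> carrier G" for h x
    using hom_in_carrier[OF h(1)] that by blast
  show m: "a h (x \<otimes> y) = a h x \<otimes> a h y" if "h \<in> carrier K" "x \<in> carrier G" "y \<in> carrier G" for h x y
    using hom_mult[OF h(1)] that by blast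
  show "a (h \<otimes>\<^bsub>K\<^esub> k) x = a h (a k x)" if "h \<in> carrier K" "k \<in> carrier K" "x \<in> carrier G" for h k x
  proof -
    have "a (h \<otimes>\<^bsub>K\<^esub> k) = a h \<otimes>\<^bsub>AutoGroup G\<^esub> a k" using hom_mult[OF a] that by blast
    also have "\<dots> = compose (carrier G) (a h) (a k)"
      using h(2) that by (simp add: AutoGroup_def BijGroup_def)
    finally show ?thesis using that by (simp add: compose_def)
  qed
  show "a \<one>\<^bsub>K\<^esub> x = x" if "x \<in> carrier G" for x
  proof -
    have "a \<one>\<^bsub>K\<^esub> = \<one>\<^bsub>AutoGroup G\<^esub>" by (rule hom_one[OF a K AutoGroup])
    then show ?thesis using that by (simp add: AutoGroup_def BijGroup_def)
  qed
  show "a h (inv x) = inv (a h x)" if "h \<in> carrier K" "x \<in> carrier G" for h x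
  proof -
    have "a h (inv x) \<otimes> a h x = a h \<one>" using m[of h "inv x" x] that by simp
    also have "a h \<one> = \<one>" by (rule hom_one[OF h(1)[OF that(1)] group_axioms group_axioms])
    finally show ?thesis using c that by (metis inv_equality inv_closed)
  qed
qed

text \<open>The point \<open>p c(p)\<^sup>-\<^sup>1\<close> is the same for all \<open>p\<close> of
  a fibre, by the equivariance of \<open>c\<close>. So it descends through the quotient map to a
  section, and an equivariant coordinate is all that is required for a chart.\<close>

lemma trivialization_from_coordinate:
  assumes G: "topological_group G"
    and ract: "continuous_map (prod_topology (total P) (gtop G)) (total P) (\<lambda>(p, g). ract P p g)"
    and one: "\<And>p. p \<in> topspace (total P) \<Longrightarrow> ract P p \<one>\<^bsub>G\<^esub> = p"
    and mult: "\<And>p g g'. p \<in> topspace (total P) \<Longrightarrow> g \<in> carrier G \<Longrightarrow> g' \<in> carrier G \<Longrightarrow>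
        ract P (ract P p g) g' = ract P p (g \<otimes>\<^bsub>G\<^esub> g')"
    and pr: "\<And>p g. p \<in> topspace (total P) \<Longrightarrow> g \<in> carrier G \<Longrightarrow> proj P (ract P p g) = proj P p"
    and trans: "\<And>p q. p \<in> topspace (total P) \<Longrightarrow> q \<in> topspace (total P) \<Longrightarrow> proj P p = proj P q \<Longrightarrow>
        \<exists>g\<in>carrier G. q = ract P p g"
    and quot: "quotient_map (total P) M (proj P)" and U: "openin M U"
    and c: "continuous_map (subtopology (total P) {p \<in> topspace (total P). proj P p \<in> U}) (gtop G) c"
    and eqv: "\<And>p g. p \<in> topspace (total P) \<Longrightarrow> proj P p \<in> U \<Longrightarrow> g \<in> carrier G \<Longrightarrow>
        c (ract P p g) = c p \<otimes>\<^bsub>G\<^esub> g"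
  shows "\<exists>s. trivialization G M P U s c"
proof -
  interpret G: topological_group G by fact
  let ?X = "topspace (total P)" and ?W = "{p \<in> topspace (total P). proj P p \<in> U}"
  let ?Y = "subtopology (total P) ?W"
  have W: "topspace ?Y = ?W" by auto
  have q: "quotient_map ?Y (subtopology M U) (proj P)"
    by (rule quotient_map_restriction[OF quot refl]) (use U in simp)
  have C: "c p \<in> carrier G" if "p \<in> ?W" for p
    by (rule G.continuous_map_carrier[OF c]) (use that in simp)
  define f where "f p = ract P p (inv\<^bsub>G\<^esub> c p)" for p
  have ractX: "ract P p g \<in> ?X" if "p \<in> ?X" "g \<in> carrier G" for p g
    using continuous_map_image_subset_topspace[OF ract] that by (force simp: G.topspace_gtop)
  have fc: "continuous_map ?Y (total P) f"
    unfolding f_def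
    by (rule continuous_map_case_prod[OF ract])
      (intro G.continuous_map_invI c continuous_map_from_subtopology continuous_map_id[unfolded id_def])+
  have const: "f p = f q" if p: "p \<in> topspace ?Y" and q: "q \<in> topspace ?Y" and pq: "proj P p = proj P q" for p q
  proof -
    have p: "p \<in> ?X" "proj P p \<in> U" and q: "q \<in> ?X" using p q by auto
    obtain g where g: "g \<in> carrier G" "q = ract P p g" using trans[OF p(1) q pq] by blast
    have "c p \<in> carrier G" using C p by simp
    then have "f q = ract P p (g \<otimes>\<^bsub>G\<^esub> inv\<^bsub>G\<^esub> (c p \<otimes>\<^bsub>G\<^esub> g))"
      using g p by (simp add: f_def eqv mult)
    also have "g \<otimes>\<^bsub>G\<^esub> inv\<^bsub>G\<^esub> (c p \<otimes>\<^bsub>G\<^esub> g) = inv\<^bsub>G\<^esub> c p"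
      using \<open>c p \<in> carrier G\<close> g by (simp add: G.inv_mult_group G.m_assoc[symmetric])
    finally show ?thesis by (simp add: f_def)
  qed
  have "\<exists>s. continuous_map (subtopology M U) (total P) s \<and> (\<forall>p\<in>topspace ?Y. s (proj P p) = f p)"
    by (rule quotient_map_lift_exists[OF q fc const]) (assumption+, intro exI conjI ballI, assumption, simp)
  then obtain s where "continuous_map (subtopology M U) (total P) s \<and> (\<forall>p\<in>topspace ?Y. s (proj P p) = f p)"
    by (rule exE)
  then have s: "continuous_map (subtopology M U) (total P) s" "\<And>p. p \<in> ?W \<Longrightarrow> s (proj P p) = f p"
    by simp_all
  have lift: "\<exists>p\<in>?W. u = proj P p" if "u \<in> U" for u
    using quotient_imp_surjective_map[OF q] that openin_subset[OF U] unfolding W by fastforce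
  have "trivialization G M P U s c"
    unfolding trivialization_def
  proof (intro conjI ballI impI)
    fix u assume "u \<in> U"
    then obtain p where p: "p \<in> ?W" "u = proj P p" using lift by blast
    then show "proj P (s u) = u" using s(2)[OF p(1)] pr C by (simp add: f_def)
    fix g assume g: "g \<in> carrier G"
    have "c (ract P (s u) g) = c p \<otimes>\<^bsub>G\<^esub> (inv\<^bsub>G\<^esub> c p \<otimes>\<^bsub>G\<^esub> g)"
      using s(2)[OF p(1)] p g C[OF p(1)] by (simp add: f_def mult eqv)
    then show "c (ract P (s u) g) = g"
      using C[OF p(1)] g by (simp add: G.m_assoc[symmetric])
  next
    fix p assume p: "p \<in> ?X" "proj P p \<in> U"
    then have "p \<in> ?W" by simp
    then show "ract P (s (proj P p)) (c p) = p"
      using s(2)[of p] p C[of p] by (simp add: f_def mult one)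
  qed (use U s(1) c in auto)
  then show ?thesis by blast
qed

section \<open>The bibundle of topological groups\<close>

locale bibundle_model = standard_crossed_module H G t \<alpha> + EG_model H G t \<alpha> EG i \<epsilon>
  for H :: "'h topgroup" and G :: "'g topgroup" and t \<alpha> and EG :: "'e topgroup" and i \<epsilon>
begin

lemmas action_closed [simp] = G.AutoGroup_action(1)[OF H.group_axioms action_hom]
  and action_mult = G.AutoGroup_action(2)[OF H.group_axioms action_hom]
  and action_comp = G.AutoGroup_action(3)[OF H.group_axioms action_hom]
  and action_one [simp] = G.AutoGroup_action(4)[OF H.group_axioms action_hom]
  and action_inv = G.AutoGroup_action(5)[OF H.group_axioms action_hom]

lemmas ext_action_closed [simp] = EG.AutoGroup_action(1)[OF H.group_axioms ext_action_hom]
  and ext_action_mult = EG.AutoGroup_action(2)[OF H.group_axioms ext_action_hom]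
  and ext_action_comp = EG.AutoGroup_action(3)[OF H.group_axioms ext_action_hom]
  and ext_action_one [simp] = EG.AutoGroup_action(4)[OF H.group_axioms ext_action_hom]
  and ext_action_inv = EG.AutoGroup_action(5)[OF H.group_axioms ext_action_hom]

lemma t_closed [simp]: "g \<in> carrier G \<Longrightarrow> t g \<in> carrier H"
  and t_mult: "g \<in> carrier G \<Longrightarrow> g' \<in> carrier G \<Longrightarrow> t (g \<otimes>\<^bsub>G\<^esub> g') = t g \<otimes>\<^bsub>H\<^esub> t g'"
  and i_closed_carrier [simp]: "g \<in> carrier G \<Longrightarrow> i g \<in> carrier EG"
  and i_mult: "g \<in> carrier G \<Longrightarrow> g' \<in> carrier G \<Longrightarrow> i (g \<otimes>\<^bsub>G\<^esub> g') = i g \<otimes>\<^bsub>EG\<^esub> i g'"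
  using t_hom i_hom by (auto simp: hom_def)

lemma t_one [simp]: "t \<one>\<^bsub>G\<^esub> = \<one>\<^bsub>H\<^esub>"
  by (rule hom_one[OF t_hom G.group_axioms H.group_axioms])

lemma i_one [simp]: "i \<one>\<^bsub>G\<^esub> = \<one>\<^bsub>EG\<^esub>"
  by (rule hom_one[OF i_hom G.group_axioms EG.group_axioms])

lemma t_inv: "g \<in> carrier G \<Longrightarrow> t (inv\<^bsub>G\<^esub> g) = inv\<^bsub>H\<^esub> t g"
  by (metis H.inv_equality G.l_inv G.inv_closed t_closed t_mult t_one)

lemma i_inv: "g \<in> carrier G \<Longrightarrow> i (inv\<^bsub>G\<^esub> g) = inv\<^bsub>EG\<^esub> i g"
  by (metis EG.inv_equality G.l_inv G.inv_closed i_closed_carrier i_mult i_one)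

lemma i_continuous: "continuous_map (gtop G) (gtop EG) i"
  using homeomorphic_imp_continuous_map[OF i_embedding[unfolded embedding_map_def]]
  by (simp add: continuous_map_in_subtopology)

abbreviation E where "E \<equiv> E_group H EG \<epsilon>"
abbreviation \<nu> where "\<nu> \<equiv> E_embed G t i"
abbreviation N where "N \<equiv> \<nu> ` carrier G"
abbreviation EB where "EB \<equiv> E_bibundle H G t EG i \<epsilon>"
abbreviation B where "B \<equiv> B_group H G t EG i \<epsilon>"
abbreviation \<Phi> where "\<Phi> \<equiv> type_map H G t"

lemma E_carrier [simp]: "carrier E = carrier EG \<times> carrier H"
  and E_mult [simp]: "(e, h) \<otimes>\<^bsub>E\<^esub> (e', h') = (e \<otimes>\<^bsub>EG\<^esub> \<epsilon> h e', h \<otimes>\<^bsub>H\<^esub> h')"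
  and E_one [simp]: "\<one>\<^bsub>E\<^esub> = (\<one>\<^bsub>EG\<^esub>, \<one>\<^bsub>H\<^esub>)"
  and E_gtop [simp]: "gtop E = prod_topology (gtop EG) (gtop H)"
  by (simp_all add: E_group_def)

lemma \<nu>_eq: "\<nu> g = (i (inv\<^bsub>G\<^esub> g), t g)"
  by (simp add: E_embed_def)

lemma E_group: "group E"
proof (rule groupI)
  fix x assume "x \<in> carrier E"
  then obtain e h where x: "x = (e, h)" "e \<in> carrier EG" "h \<in> carrier H" by auto
  have "\<epsilon> (inv\<^bsub>H\<^esub> h) (inv\<^bsub>EG\<^esub> e) \<otimes>\<^bsub>EG\<^esub> \<epsilon> (inv\<^bsub>H\<^esub> h) e = \<one>\<^bsub>EG\<^esub>"
    using x by (simp add: ext_action_inv)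
  then show "\<exists>y\<in>carrier E. y \<otimes>\<^bsub>E\<^esub> x = \<one>\<^bsub>E\<^esub>"
    using x by (intro bexI[of _ "(\<epsilon> (inv\<^bsub>H\<^esub> h) (inv\<^bsub>EG\<^esub> e), inv\<^bsub>H\<^esub> h)"]) auto
qed (auto simp: ext_action_mult ext_action_comp EG.m_assoc H.m_assoc)

lemmas E_closed = monoid.m_closed[OF group.is_monoid[OF E_group]]

lemma E_inv:
  assumes "e \<in> carrier EG" "h \<in> carrier H"
  shows "inv\<^bsub>E\<^esub> (e, h) = (\<epsilon> (inv\<^bsub>H\<^esub> h) (inv\<^bsub>EG\<^esub> e), inv\<^bsub>H\<^esub> h)"
  by (rule group.inv_equality[OF E_group]) (use assms in \<open>auto simp: ext_action_inv\<close>)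

lemma topological_group_E: "topological_group E"
proof -
  interpret E: group E by (rule E_group)
  have f: "continuous_map (prod_topology (gtop E) (gtop E)) (gtop EG) (\<lambda>z. fst (fst z))"
    "continuous_map (prod_topology (gtop E) (gtop E)) (gtop EG) (\<lambda>z. fst (snd z))"
    "continuous_map (prod_topology (gtop E) (gtop E)) (gtop H) (\<lambda>z. snd (fst z))"
    "continuous_map (prod_topology (gtop E) (gtop E)) (gtop H) (\<lambda>z. snd (snd z))"
    unfolding E_gtop
    using continuous_map_compose[OF continuous_map_fst continuous_map_fst]
      continuous_map_compose[OF continuous_map_snd continuous_map_fst]
      continuous_map_compose[OF continuous_map_fst continuous_map_snd]
      continuous_map_compose[OF continuous_map_snd continuous_map_snd]
    by (force simp: o_def)+
  show ?thesis
  proof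
    show "topspace (gtop E) = carrier E" by (simp add: EG.topspace_gtop H.topspace_gtop)
    have "continuous_map (prod_topology (gtop E) (gtop E)) (gtop E)
      (\<lambda>z. (fst (fst z) \<otimes>\<^bsub>EG\<^esub> \<epsilon> (snd (fst z)) (fst (snd z)), snd (fst z) \<otimes>\<^bsub>H\<^esub> snd (snd z)))"
      unfolding E_gtop
      by (intro continuous_map_pairedI EG.continuous_map_multI H.continuous_map_multI
          continuous_map_case_prod[OF ext_action_continuous] f[unfolded E_gtop])
    moreover have "(\<lambda>z. (fst (fst z) \<otimes>\<^bsub>EG\<^esub> \<epsilon> (snd (fst z)) (fst (snd z)), snd (fst z) \<otimes>\<^bsub>H\<^esub> snd (snd z)))
        = (\<lambda>(x, y). x \<otimes>\<^bsub>E\<^esub> y)"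
      by auto
    ultimately show "continuous_map (prod_topology (gtop E) (gtop E)) (gtop E) (\<lambda>(x, y). x \<otimes>\<^bsub>E\<^esub> y)"
      by metis
    show "continuous_map (gtop E) (gtop E) (\<lambda>x. inv\<^bsub>E\<^esub> x)"
    proof (rule continuous_map_eq)
      show "continuous_map (gtop E) (gtop E) (\<lambda>x. (\<epsilon> (inv\<^bsub>H\<^esub> snd x) (inv\<^bsub>EG\<^esub> fst x), inv\<^bsub>H\<^esub> snd x))"
        unfolding E_gtop
        by (intro continuous_map_pairedI continuous_map_case_prod[OF ext_action_continuous]
            EG.continuous_map_invI H.continuous_map_invI continuous_map_fst continuous_map_snd)
    qed (auto simp: E_inv EG.topspace_gtop H.topspace_gtop)
  qed
qed

lemma \<nu>_closed [simp]: "g \<in> carrier G \<Longrightarrow> \<nu> g \<in> carrier E"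
  by (simp add: \<nu>_eq)

text \<open>\<open>\<epsilon> (t g)\<close> is conjugation by \<open>i g\<close>, which turns
  \<open>i g\<^sup>-\<^sup>1 \<epsilon>(t g)(i g'\<^sup>-\<^sup>1)\<close> into
  \<open>i g'\<^sup>-\<^sup>1 i g\<^sup>-\<^sup>1\<close>. The reversal of the order explains the
  inverse in the definition of \<nu>.\<close>

lemma \<nu>_mult: "g \<in> carrier G \<Longrightarrow> g' \<in> carrier G \<Longrightarrow> \<nu> (g \<otimes>\<^bsub>G\<^esub> g') = \<nu> g \<otimes>\<^bsub>E\<^esub> \<nu> g'"
  by (simp add: \<nu>_eq t_mult ext_action_t i_mult i_inv G.inv_mult_group EG.m_assoc[symmetric])

lemma \<nu>_one [simp]: "\<nu> \<one>\<^bsub>G\<^esub> = \<one>\<^bsub>E\<^esub>"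
  by (simp add: \<nu>_eq)

lemma \<nu>_continuous: "continuous_map (gtop G) (gtop E) \<nu>"
  unfolding \<nu>_eq[abs_def] E_gtop
  using continuous_map_compose[OF G.continuous_inv i_continuous] t_continuous
  by (intro continuous_map_pairedI) (auto simp: o_def)

text \<open>Left multiplication by \<open>\<nu> g\<close> is the left action of \<open>G\<close> on
  the bibundle \<open>E\<close>. The relation makes \<open>N\<close> normal, identifies its right
  cosets with the orbits of the right action, and lets the tensor relation be read as an identity in
  the group \<open>E\<close>.\<close>

lemma \<nu>_conj:
  assumes x: "x \<in> carrier E" and g: "g \<in> carrier G"
  shows "\<nu> g \<otimes>\<^bsub>E\<^esub> x = x \<otimes>\<^bsub>E\<^esub> \<nu> (\<alpha> (inv\<^bsub>H\<^esub> snd x) g)"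
proof -
  obtain e h where x: "x = (e, h)" "e \<in> carrier EG" "h \<in> carrier H" using x by auto
  have "\<epsilon> h (i (inv\<^bsub>G\<^esub> \<alpha> (inv\<^bsub>H\<^esub> h) g)) = i (\<alpha> h (\<alpha> (inv\<^bsub>H\<^esub> h) (inv\<^bsub>G\<^esub> g)))"
    using x g by (simp add: ext_action_extends action_inv)
  also have "\<dots> = i (inv\<^bsub>G\<^esub> g)" using x g by (simp add: action_comp[symmetric])
  finally have 1: "\<epsilon> h (i (inv\<^bsub>G\<^esub> \<alpha> (inv\<^bsub>H\<^esub> h) g)) = inv\<^bsub>EG\<^esub> i g" using g by (simp add: i_inv)
  have 2: "h \<otimes>\<^bsub>H\<^esub> t (\<alpha> (inv\<^bsub>H\<^esub> h) g) = t g \<otimes>\<^bsub>H\<^esub> h"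
    using x g by (simp add: t_action H.m_assoc[symmetric])
  show ?thesis
    using x g 1 2 by (simp add: \<nu>_eq ext_action_t i_inv EG.m_assoc[symmetric])
qed

lemma N_normal: "N \<lhd> E"
proof -
  interpret E: group E by (rule E_group)
  have "group_hom G E \<nu>"
    unfolding group_hom_def group_hom_axioms_def
    using G.group_axioms E_group by (auto simp: hom_def \<nu>_mult simp del: E_carrier)
  then interpret nu: group_hom G E \<nu> .
  show ?thesis
  proof (rule E.normal_invI)
    show "subgroup N E" by (rule nu.img_is_subgroup)
    fix x n assume x: "x \<in> carrier E" and "n \<in> N"
    then obtain g where g: "g \<in> carrier G" "n = \<nu> g" by auto
    have h: "snd x \<in> carrier H" using x by auto
    have "\<nu> (\<alpha> (snd x) g) \<otimes>\<^bsub>E\<^esub> x = x \<otimes>\<^bsub>E\<^esub> n"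
      using \<nu>_conj[OF x action_closed[OF h g(1)]] h g by (simp add: action_comp[symmetric])
    then have "x \<otimes>\<^bsub>E\<^esub> n \<otimes>\<^bsub>E\<^esub> inv\<^bsub>E\<^esub> x = \<nu> (\<alpha> (snd x) g)"
      using x g h by (metis E.inv_solve_right' E.m_closed \<nu>_closed action_closed)
    then show "x \<otimes>\<^bsub>E\<^esub> n \<otimes>\<^bsub>E\<^esub> inv\<^bsub>E\<^esub> x \<in> N" using g h by simp
  qed
qed

sublocale E: topological_normal N E
  by (intro topological_normal.intro topological_group_E N_normal)

lemma B_eq: "B = topquot E N"
  by (simp add: B_group_def)

sublocale B: topological_group B
  unfolding B_eq by (rule E.topological_group_topquot)

lemma EB_simps: "total EB = gtop E" "proj EB = (\<lambda>x. N #>\<^bsub>E\<^esub> x)" "ract EB = (\<lambda>x g. x \<otimes>\<^bsub>E\<^esub> \<nu> g)" "str EB = snd"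
  by (simp_all add: E_bibundle_def)

lemma \<pi>_ract:
  assumes "x \<in> carrier E" "g \<in> carrier G"
  shows "E.\<pi> (x \<otimes>\<^bsub>E\<^esub> \<nu> g) = E.\<pi> x"
proof -
  have h: "snd x \<in> carrier H" using assms by auto
  have "x \<otimes>\<^bsub>E\<^esub> \<nu> g = \<nu> (\<alpha> (snd x) g) \<otimes>\<^bsub>E\<^esub> x"
    using \<nu>_conj[OF assms(1) action_closed[OF h assms(2)]] h assms by (simp add: action_comp[symmetric])
  moreover have "\<nu> (\<alpha> (snd x) g) \<in> N" using h assms by simp
  ultimately have "\<exists>n\<in>N. x \<otimes>\<^bsub>E\<^esub> \<nu> g = n \<otimes>\<^bsub>E\<^esub> x" by (rule bexI)
  then have "E.\<pi> x = E.\<pi> (x \<otimes>\<^bsub>E\<^esub> \<nu> g)"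
    by (subst E.\<pi>_eq_iff[OF assms(1) E_closed[OF assms(1) \<nu>_closed[OF assms(2)]]])
  then show ?thesis by simp
qed

lemma \<pi>_eq_ract:
  assumes "x \<in> carrier E" "y \<in> carrier E" "E.\<pi> x = E.\<pi> y"
  shows "\<exists>g\<in>carrier G. y = x \<otimes>\<^bsub>E\<^esub> \<nu> g"
proof -
  obtain g where g: "g \<in> carrier G" "y = \<nu> g \<otimes>\<^bsub>E\<^esub> x" using E.\<pi>_eq_iff[OF assms(1,2)] assms(3) by auto
  have h: "snd x \<in> carrier H" using assms by auto
  then show ?thesis using \<nu>_conj[OF assms(1) g(1)] g by (intro bexI[of _ "\<alpha> (inv\<^bsub>H\<^esub> snd x) g"]) auto
qed

text \<open>Charts of \<open>E \<rightarrow> B\<close> come from those of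
  \<open>EG \<rightarrow> EG/G\<close>: right multiplication of \<open>(e, h)\<close> by
  \<open>\<nu> g\<close> multiplies \<open>e\<close> on the right by
  \<open>i (\<alpha> h g\<^sup>-\<^sup>1)\<close>, an element of \<open>G\<close>, so it preserves
  the fibre of \<open>e\<close> and changes its coordinate in a controlled way.\<close>

lemma EB_bibundle: "is_bibundle H G t (gtop B) EB"
proof -
  have top: "topspace (total EB) = carrier E" by (simp only: EB_simps E.topspace_gtop)
  have quot: "quotient_map (total EB) (gtop B) (proj EB)"
    unfolding EB_simps B_eq by (rule E.quotient_map_\<pi>)
  have ract: "continuous_map (prod_topology (total EB) (gtop G)) (total EB) (\<lambda>(p, g). ract EB p g)"
    unfolding EB_simps case_prod_unfold
    by (intro E.continuous_map_multI continuous_map_fst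
        continuous_map_compose[OF continuous_map_snd \<nu>_continuous, unfolded o_def])
  have one: "ract EB p \<one>\<^bsub>G\<^esub> = p" if "p \<in> topspace (total EB)" for p
    using that unfolding top by (simp add: EB_simps del: E_one E_carrier)
  have mult: "ract EB (ract EB p g) g' = ract EB p (g \<otimes>\<^bsub>G\<^esub> g')"
    if "p \<in> topspace (total EB)" "g \<in> carrier G" "g' \<in> carrier G" for p g g'
    using that unfolding top by (simp add: EB_simps \<nu>_mult E.m_assoc del: E_carrier)
  have pr: "proj EB (ract EB p g) = proj EB p" if "p \<in> topspace (total EB)" "g \<in> carrier G" for p g
    using that unfolding top by (simp only: EB_simps \<pi>_ract)
  have trans: "\<exists>g\<in>carrier G. q = ract EB p g"
    if "p \<in> topspace (total EB)" "q \<in> topspace (total EB)" "proj EB p = proj EB q" for p q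
  proof -
    have "p \<in> carrier E" "q \<in> carrier E" using that(1,2) unfolding top .
    from \<pi>_eq_ract[OF this] that(3) show ?thesis unfolding EB_simps .
  qed
  have "principal_bundle G (gtop B) EB"
  proof (rule principal_bundleI[OF G.topological_group_axioms quotient_imp_continuous_map[OF quot] ract one mult pr])
    fix b assume "b \<in> topspace (gtop B)"
    then have "b \<in> E.\<pi> ` carrier E" unfolding B.topspace_gtop unfolding B_eq E.carrier_topquot .
    then obtain x where x: "x \<in> carrier E" "b = E.\<pi> x" by blast
    define A where "A = EG_bundle G EG i"
    have A: "total A = gtop EG" "proj A = (\<lambda>e. e <#\<^bsub>EG\<^esub> (i ` carrier G))" "ract A = (\<lambda>e g. e \<otimes>\<^bsub>EG\<^esub> i g)"
      by (simp_all add: A_def EG_bundle_def)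
    interpret A: principal G "quotient_topology (gtop EG) (\<lambda>e. e <#\<^bsub>EG\<^esub> (i ` carrier G))" A
      by (intro principal.intro principal_axioms.intro G.topological_group_axioms)
        (use EG_principal in \<open>simp only: A_def\<close>)
    have topA: "topspace (total A) = carrier EG" by (simp add: A EG.topspace_gtop)
    have "proj A (fst x) \<in> topspace (quotient_topology (gtop EG) (\<lambda>e. e <#\<^bsub>EG\<^esub> (i ` carrier G)))"
      using x by (intro A.proj_closed) (auto simp: topA)
    then obtain V s \<gamma> where V: "proj A (fst x) \<in> V"
        "trivialization G (quotient_topology (gtop EG) (\<lambda>e. e <#\<^bsub>EG\<^esub> (i ` carrier G))) A V s \<gamma>"
      using A.trivialization_exists by blast
    let ?V = "{e \<in> topspace (total A). proj A e \<in> V}"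
    \<comment> \<open>This set is saturated for the right action, so its image is open and has
      \<open>?W\<close> as full preimage.\<close>
    let ?W = "{y \<in> topspace (gtop E). fst y \<in> ?V}"
    have oV: "openin (gtop EG) ?V"
      using openin_continuous_map_preimage[OF A.proj_continuous A.triv_open(1)[OF V(2)]] by (simp add: A)
    have "openin (gtop E) ?W"
      by (rule openin_continuous_map_preimage[OF _ oV]) (simp add: continuous_map_fst)
    then have U: "openin (gtop B) (E.\<pi> ` ?W)"
      using E.open_map_\<pi> unfolding open_map_def B_eq by blast
    have sat: "fst (y \<otimes>\<^bsub>E\<^esub> \<nu> g) \<in> ?V \<and> \<gamma> (fst (y \<otimes>\<^bsub>E\<^esub> \<nu> g)) = \<gamma> (fst y) \<otimes>\<^bsub>G\<^esub> \<alpha> (snd y) (inv\<^bsub>G\<^esub> g)"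
      if y: "y \<in> carrier E" "fst y \<in> ?V" and g: "g \<in> carrier G" for y g
    proof -
      have h: "snd y \<in> carrier H" "fst y \<in> carrier EG" using y by auto
      have k: "\<alpha> (snd y) (inv\<^bsub>G\<^esub> g) \<in> carrier G" using h g by simp
      have "fst (y \<otimes>\<^bsub>E\<^esub> \<nu> g) = ract A (fst y) (\<alpha> (snd y) (inv\<^bsub>G\<^esub> g))"
        using h g by (cases y) (simp add: A \<nu>_eq ext_action_extends)
      then show ?thesis
        using A.triv_equivariant[OF V(2) _ _ k] A.proj_ract[OF _ k] A.ract_closed[OF _ k] y(2) by simp
    qed
    have pre: "{p \<in> topspace (total EB). proj EB p \<in> E.\<pi> ` ?W} = ?W"
    proof (intro equalityI subsetI)
      fix p assume p: "p \<in> {p \<in> topspace (total EB). proj EB p \<in> E.\<pi> ` ?W}"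
      then obtain y where y: "y \<in> ?W" "E.\<pi> y = E.\<pi> p" by (auto simp: EB_simps)
      then have "y \<in> carrier E" "p \<in> carrier E" using p top E.topspace_gtop by auto
      then obtain g where "g \<in> carrier G" "p = y \<otimes>\<^bsub>E\<^esub> \<nu> g" using \<pi>_eq_ract y(2) by blast
      then show "p \<in> ?W" using sat[OF \<open>y \<in> carrier E\<close>, of g] y(1) p top E.topspace_gtop by auto
    qed (auto simp: EB_simps)
    \<comment> \<open>The coordinate \<gamma> changes by
      \<open>\<alpha> h g\<^sup>-\<^sup>1\<close>. Applying
      \<open>\<alpha> h\<^sup>-\<^sup>1\<close> undoes the twist and the outer inverse undoes the
      inverse of \<open>g\<close>; the change of \<open>h\<close> to \<open>h t(g)\<close>
      contributes a conjugation by \<open>g\<^sup>-\<^sup>1\<close>, after which \<open>g\<close>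
      appears as a right factor, as required.\<close>
    define c where "c y = inv\<^bsub>G\<^esub> (\<alpha> (inv\<^bsub>H\<^esub> snd y) (\<gamma> (fst y)))" for y
    have "continuous_map (subtopology (gtop E) ?W) (gtop G) c"
      unfolding c_def
    proof (intro G.continuous_map_invI continuous_map_case_prod[OF action_continuous] H.continuous_map_invI)
      show "continuous_map (subtopology (gtop E) ?W) (gtop H) snd"
        unfolding E_gtop by (intro continuous_map_from_subtopology continuous_map_snd)
      have "continuous_map (subtopology (gtop E) ?W) (gtop EG) fst"
        unfolding E_gtop by (intro continuous_map_from_subtopology continuous_map_fst)
      then have "continuous_map (subtopology (gtop E) ?W) (subtopology (total A) ?V) fst"
        unfolding continuous_map_in_subtopology A(1) by auto
      from continuous_map_compose[OF this A.triv_coord[OF V(2)]]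
      show "continuous_map (subtopology (gtop E) ?W) (gtop G) (\<lambda>y. \<gamma> (fst y))" by (simp add: o_def)
    qed
    then have cc: "continuous_map (subtopology (total EB) {p \<in> topspace (total EB). proj EB p \<in> E.\<pi> ` ?W}) (gtop G) c"
      unfolding pre by (simp only: EB_simps)
    have "c (ract EB p g) = c p \<otimes>\<^bsub>G\<^esub> g"
      if "p \<in> topspace (total EB)" "proj EB p \<in> E.\<pi> ` ?W" and g: "g \<in> carrier G" for p g
    proof -
      have p: "p \<in> carrier E" "fst p \<in> ?V" using that pre top by auto
      have h: "snd p \<in> carrier H" and k: "\<gamma> (fst p) \<in> carrier G"
        using p A.triv_coord_closed[OF V(2)] by auto
      have "snd (p \<otimes>\<^bsub>E\<^esub> \<nu> g) = snd p \<otimes>\<^bsub>H\<^esub> t g" using p(1) by (cases p) (simp add: \<nu>_eq)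
      then have "c (ract EB p g) = inv\<^bsub>G\<^esub> (\<alpha> (inv\<^bsub>H\<^esub> (snd p \<otimes>\<^bsub>H\<^esub> t g)) (\<gamma> (fst p) \<otimes>\<^bsub>G\<^esub> \<alpha> (snd p) (inv\<^bsub>G\<^esub> g)))"
        using sat[OF p g] by (simp add: c_def EB_simps)
      also have "inv\<^bsub>H\<^esub> (snd p \<otimes>\<^bsub>H\<^esub> t g) = t (inv\<^bsub>G\<^esub> g) \<otimes>\<^bsub>H\<^esub> inv\<^bsub>H\<^esub> snd p"
        using h g by (simp add: H.inv_mult_group t_inv)
      also have "\<alpha> (t (inv\<^bsub>G\<^esub> g) \<otimes>\<^bsub>H\<^esub> inv\<^bsub>H\<^esub> snd p) (\<gamma> (fst p) \<otimes>\<^bsub>G\<^esub> \<alpha> (snd p) (inv\<^bsub>G\<^esub> g)) =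
          \<alpha> (t (inv\<^bsub>G\<^esub> g)) (\<alpha> (inv\<^bsub>H\<^esub> snd p) (\<gamma> (fst p)) \<otimes>\<^bsub>G\<^esub> inv\<^bsub>G\<^esub> g)"
        using h g k by (simp add: action_comp action_mult action_comp[symmetric, of "inv\<^bsub>H\<^esub> snd p" "snd p"])
      also have "\<dots> = inv\<^bsub>G\<^esub> g \<otimes>\<^bsub>G\<^esub> \<alpha> (inv\<^bsub>H\<^esub> snd p) (\<gamma> (fst p))"
        using h g k by (simp add: action_t G.m_assoc)
      also have "inv\<^bsub>G\<^esub> \<dots> = c p \<otimes>\<^bsub>G\<^esub> g"
        using h g k by (simp add: c_def G.inv_mult_group)
      finally show ?thesis .
    qed
    from trivialization_from_coordinate[OF G.topological_group_axioms ract one mult pr trans quot U cc this]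
    obtain s where s: "trivialization G (gtop B) EB (E.\<pi> ` ?W) s c" by blast
    have "b \<in> E.\<pi> ` ?W" using x V(1) E.topspace_gtop by (auto simp: topA)
    then show "\<exists>U s \<gamma>. b \<in> U \<and> trivialization G (gtop B) EB U s \<gamma>" using s by (intro exI conjI)
  qed
  moreover have "continuous_map (total EB) (gtop H) (str EB)"
    by (simp add: EB_simps continuous_map_snd)
  moreover have "str EB (ract EB p g) = str EB p \<otimes>\<^bsub>H\<^esub> t g" if "p \<in> topspace (total EB)" "g \<in> carrier G" for p g
    using that unfolding top by (cases p) (auto simp: EB_simps \<nu>_eq)
  ultimately show ?thesis unfolding is_bibundle_def by blast
qed

end

section \<open>Classifying maps and tensor products\<close>

text \<open>Pulling an open preimage back along a local section gives the part of the set inside its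
  domain. The lemma serves \<open>tensor_pull\<close>, where the map to be recognized as a quotient
  map comes with explicit local sections.\<close>

lemma quotient_map_local_sections:
  assumes f: "continuous_map X Y f"
    and sec: "\<And>y. y \<in> topspace Y \<Longrightarrow> \<exists>W s. openin Y W \<and> y \<in> W \<and>
      continuous_map (subtopology Y W) X s \<and> (\<forall>z\<in>W. f (s z) = z)"
  shows "quotient_map X Y f"
  unfolding quotient_map_def
proof (intro conjI allI impI)
  show "f ` topspace X = topspace Y"
  proof (intro equalityI subsetI)
    fix y assume y: "y \<in> topspace Y"
    then obtain W s where W: "y \<in> W" "continuous_map (subtopology Y W) X s" "\<forall>z\<in>W. f (s z) = z"
      using sec by blast
    have "s y \<in> topspace X"
      using continuous_map_image_subset_topspace[OF W(2)] W(1) y by auto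
    then show "y \<in> f ` topspace X" using W(1,3) by force
  qed (use continuous_map_image_subset_topspace[OF f] in blast)
  fix U assume U: "U \<subseteq> topspace Y"
  show "openin X {x \<in> topspace X. f x \<in> U} = openin Y U"
  proof
    assume pre: "openin X {x \<in> topspace X. f x \<in> U}"
    show "openin Y U"
    proof (subst openin_subopen, intro ballI)
      fix y assume y: "y \<in> U"
      then obtain W s where W: "openin Y W" "y \<in> W" "continuous_map (subtopology Y W) X s"
          "\<forall>z\<in>W. f (s z) = z"
        using sec U by blast
      have top: "topspace (subtopology Y W) = W" using openin_subset[OF W(1)] by auto
      have "openin (subtopology Y W) {z \<in> topspace (subtopology Y W). s z \<in> {x \<in> topspace X. f x \<in> U}}"
        by (rule openin_continuous_map_preimage[OF W(3) pre])
      also have "{z \<in> topspace (subtopology Y W). s z \<in> {x \<in> topspace X. f x \<in> U}} = W \<inter> U"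
        using W(4) continuous_map_image_subset_topspace[OF W(3)] unfolding top by auto
      finally have "openin Y (W \<inter> U)" using W(1) openin_trans_full by blast
      then show "\<exists>T. openin Y T \<and> y \<in> T \<and> T \<subseteq> U" using y W(2) by (intro exI[of _ "W \<inter> U"]) auto
    qed
  next
    assume "openin Y U"
    then show "openin X {x \<in> topspace X. f x \<in> U}" by (rule openin_continuous_map_preimage[OF f])
  qed
qed

lemma quotient_maps_homeomorphic:
  assumes f: "quotient_map X Y f" and g: "quotient_map X Z g"
    and eq: "\<And>x y. x \<in> topspace X \<Longrightarrow> y \<in> topspace X \<Longrightarrow> f x = f y \<longleftrightarrow> g x = g y"
  shows "\<exists>h. homeomorphic_map Y Z h \<and> (\<forall>x\<in>topspace X. h (f x) = g x)"
proof -
  have 1: "\<exists>h. continuous_map Y Z h \<and> (\<forall>x\<in>topspace X. h (f x) = g x)"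
    by (rule quotient_map_lift_exists[OF f quotient_imp_continuous_map[OF g]])
      (use eq in blast, intro exI conjI ballI, assumption, simp)
  have 2: "\<exists>h. continuous_map Z Y h \<and> (\<forall>x\<in>topspace X. h (g x) = f x)"
    by (rule quotient_map_lift_exists[OF g quotient_imp_continuous_map[OF f]])
      (use eq in blast, intro exI conjI ballI, assumption, simp)
  obtain h k where hk: "continuous_map Y Z h" "\<forall>x\<in>topspace X. h (f x) = g x"
      "continuous_map Z Y k" "\<forall>x\<in>topspace X. k (g x) = f x"
    using 1 2 by blast
  have "k (h y) = y" if "y \<in> topspace Y" for y
    using that hk(2,4) quotient_imp_surjective_map[OF f] by force
  moreover have "h (k z) = z" if "z \<in> topspace Z" for z
    using that hk(2,4) quotient_imp_surjective_map[OF g] by force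
  ultimately have "homeomorphic_maps Y Z h k"
    using hk by (simp add: homeomorphic_maps_def)
  then show ?thesis using hk(2) homeomorphic_map_maps by blast
qed

lemma the_elem_image_const:
  "x \<in> A \<Longrightarrow> (\<And>y. y \<in> A \<Longrightarrow> f y = c) \<Longrightarrow> the_elem (f ` A) = c"
  by (metis (mono_tags, lifting) image_cong image_constant the_elem_eq)

context bibundle_model
begin

abbreviation pull where "pull M F \<equiv> pullback_bibundle M F EB"

lemma pull_simps:
  "total (pull M F) = subtopology (prod_topology M (gtop E)) {(m, x). F m = E.\<pi> x}"
  "proj (pull M F) = fst" "ract (pull M F) = (\<lambda>(m, x) g. (m, x \<otimes>\<^bsub>E\<^esub> \<nu> g))"
  "str (pull M F) = (\<lambda>(m, x). snd x)"
  by (simp_all add: pullback_bibundle_def EB_simps)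

lemma topspace_pull:
  "topspace (total (pull M F)) = {(m, x). m \<in> topspace M \<and> x \<in> carrier E \<and> F m = E.\<pi> x}"
  unfolding pull_simps by (auto simp: E.topspace_gtop simp del: E_carrier E_gtop)

lemma pull_bibundle: "continuous_map M (gtop B) F \<Longrightarrow> is_bibundle H G t M (pull M F)"
  by (rule pullback_bibundle[OF G.topological_group_axioms EB_bibundle])

lemma \<pi>_closed: "x \<in> carrier E \<Longrightarrow> E.\<pi> x \<in> carrier B"
  unfolding B_eq E.carrier_topquot by blast

lemma \<pi>_mult: "x \<in> carrier E \<Longrightarrow> y \<in> carrier E \<Longrightarrow> E.\<pi> x \<otimes>\<^bsub>B\<^esub> E.\<pi> y = E.\<pi> (x \<otimes>\<^bsub>E\<^esub> y)"
  unfolding B_eq by (rule E.mult_topquot)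

lemma \<pi>_inv: "x \<in> carrier E \<Longrightarrow> inv\<^bsub>B\<^esub> E.\<pi> x = E.\<pi> (inv\<^bsub>E\<^esub> x)"
  unfolding B_eq by (rule E.inv_topquot)

lemma \<pi>_one: "E.\<pi> \<one>\<^bsub>E\<^esub> = \<one>\<^bsub>B\<^esub>"
  unfolding B_eq by (rule E.one_topquot[symmetric])

lemma \<pi>_surj: "b \<in> carrier B \<Longrightarrow> \<exists>x\<in>carrier E. b = E.\<pi> x"
  unfolding B_eq E.carrier_topquot by blast

lemma \<pi>_continuous: "continuous_map (gtop E) (gtop B) E.\<pi>"
  unfolding B_eq by (rule E.continuous_map_\<pi>)

definition classifies where
  "classifies M P F a \<longleftrightarrow> continuous_map (total P) (gtop E) a \<and>
     (\<forall>p\<in>topspace (total P). E.\<pi> (a p) = F (proj P p) \<and> snd (a p) = str P p \<and>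
       (\<forall>g\<in>carrier G. a (ract P p g) = a p \<otimes>\<^bsub>E\<^esub> \<nu> g))"

text \<open>A map \<open>a\<close> into \<open>E\<close> over \<open>F\<close> together with the
  projection is a bundle map into the pullback, hence an isomorphism. Isomorphisms of
  \<open>P\<close> with pullbacks are handled through such maps \<open>a\<close>, because these can
  be multiplied in \<open>E\<close>.\<close>

lemma iso_pullI:
  assumes P: "is_bibundle H G t M P" and F: "continuous_map M (gtop B) F" and a: "classifies M P F a"
  shows "bibundle_iso G P (pull M F)"
proof -
  interpret P: bibundle G M P H t by (rule bibundle_locale[OF G.topological_group_axioms P])
  show ?thesis
  proof (rule bibundle_isoI[OF G.topological_group_axioms P pull_bibundle[OF F]])
    show "continuous_map (total P) (total (pull M F)) (\<lambda>p. (proj P p, a p))"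
      using a P.proj_continuous unfolding classifies_def pull_simps continuous_map_in_subtopology
      by (auto intro!: continuous_map_pairedI)
  qed (use a P.proj_ract in \<open>auto simp: classifies_def pull_simps\<close>)
qed

text \<open>The homeomorphism is kept in the conclusion, since \<open>tensor_pull\<close> has to
  recover a point continuously from its base point and its image in \<open>E\<close>.\<close>

lemma iso_pullE:
  assumes P: "is_bibundle H G t M P" and iso: "bibundle_iso G P (pull M F)"
  shows "\<exists>a. classifies M P F a \<and> homeomorphic_map (total P) (total (pull M F)) (\<lambda>p. (proj P p, a p))"
proof -
  interpret P: bibundle G M P H t by (rule bibundle_locale[OF G.topological_group_axioms P])
  obtain f where f: "homeomorphic_map (total P) (total (pull M F)) f"
    and f2: "\<forall>p\<in>topspace (total P). proj (pull M F) (f p) = proj P p \<and> str (pull M F) (f p) = str P p \<and>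
        (\<forall>g\<in>carrier G. f (ract P p g) = ract (pull M F) (f p) g)"
    using iso unfolding bibundle_iso_def by blast
  define a where "a p = snd (f p)" for p
  have fa: "f p = (proj P p, a p)" if "p \<in> topspace (total P)" for p
    using bspec[OF f2 that] by (cases "f p") (simp add: pull_simps a_def)
  have fin: "f p \<in> topspace (total (pull M F))" if "p \<in> topspace (total P)" for p
    using homeomorphic_imp_surjective_map[OF f] that by blast
  have "continuous_map (total (pull M F)) (gtop E) snd"
    unfolding pull_simps by (intro continuous_map_from_subtopology continuous_map_snd)
  from continuous_map_compose[OF homeomorphic_imp_continuous_map[OF f] this]
  have "continuous_map (total P) (gtop E) a" by (simp add: a_def[abs_def] o_def)
  moreover have "E.\<pi> (a p) = F (proj P p)" if "p \<in> topspace (total P)" for p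
    using fin[OF that] fa[OF that] unfolding topspace_pull by simp
  moreover have "snd (a p) = str P p" if "p \<in> topspace (total P)" for p
    using bspec[OF f2 that] fa[OF that] by (simp add: pull_simps)
  moreover have "a (ract P p g) = a p \<otimes>\<^bsub>E\<^esub> \<nu> g" if "p \<in> topspace (total P)" "g \<in> carrier G" for p g
    using bspec[OF f2 that(1)] fa[OF that(1)] that(2) fa[OF P.ract_closed[OF that]] by (simp add: pull_simps)
  ultimately have "classifies M P F a" unfolding classifies_def by blast
  moreover have "homeomorphic_map (total P) (total (pull M F)) (\<lambda>p. (proj P p, a p))"
    by (rule homeomorphic_map_eq[OF f]) (rule fa)
  ultimately show ?thesis by blast
qed

section \<open>Existence of classifying maps\<close>

text \<open>The equation is the first component of \<open>a(p g) = a(p) \<nu>(g)\<close> for a map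
  \<open>a = (\<phi>, str P)\<close>. In terms of the left action it reads
  \<open>\<phi>(g p) = \<phi>(p) i(g)\<^sup>-\<^sup>1\<close>. A chart with coordinate \<gamma>
  solves it locally by \<open>i (\<alpha> (str P p) (\<gamma> p))\<^sup>-\<^sup>1\<close>, and these
  solutions are glued.\<close>

lemma equivariant_map_exists:
  fixes M :: "'m topology"
  assumes M: "paracompact_space M" and P: "is_bibundle H G t M P"
  shows "\<exists>\<phi>. continuous_map (total P) (gtop EG) \<phi> \<and> (\<forall>p\<in>topspace (total P). \<forall>g\<in>carrier G.
    \<phi> (ract P p g) = \<phi> p \<otimes>\<^bsub>EG\<^esub> inv\<^bsub>EG\<^esub> i (\<alpha> (str P p) g))"
proof -
  interpret P: bibundle G M P H t by (rule bibundle_locale[OF G.topological_group_axioms P])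
  let ?X = "topspace (total P)"
  let ?\<U> = "{U. \<exists>s \<gamma>. trivialization G M P U s \<gamma>}"
  have 1: "\<forall>U\<in>?\<U>. openin M U" using P.triv_open by blast
  have 2: "\<Union>?\<U> = topspace M"
  proof
    show "\<Union>?\<U> \<subseteq> topspace M" using 1 openin_subset by blast
    show "topspace M \<subseteq> \<Union>?\<U>" using P.trivialization_exists by blast
  qed
  obtain \<V> and \<rho> :: "'m set \<Rightarrow> 'm \<Rightarrow> real" where
    V: "locally_finite_in M \<V>" "\<And>V. V \<in> \<V> \<Longrightarrow> openin M V" "\<And>V. V \<in> \<V> \<Longrightarrow> \<exists>U\<in>?\<U>. V \<subseteq> U"
    and rho: "\<And>V. V \<in> \<V> \<Longrightarrow> continuous_map M euclideanreal (\<rho> V)"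
    "\<And>V x. V \<in> \<V> \<Longrightarrow> x \<in> topspace M \<Longrightarrow> 0 \<le> \<rho> V x"
    "\<And>V x. V \<in> \<V> \<Longrightarrow> x \<in> topspace M \<Longrightarrow> \<rho> V x \<noteq> 0 \<Longrightarrow> x \<in> V"
    "\<And>x. x \<in> topspace M \<Longrightarrow> \<exists>V\<in>\<V>. 0 < \<rho> V x"
    using paracompact_subordinate_functions[OF M 1 2] by blast
  have "\<forall>V\<in>\<V>. \<exists>U s \<gamma>. V \<subseteq> U \<and> trivialization G M P U s \<gamma>" using V(3) by blast
  then obtain U s \<gamma> where tr: "\<And>V. V \<in> \<V> \<Longrightarrow> V \<subseteq> U V" "\<And>V. V \<in> \<V> \<Longrightarrow> trivialization G M P (U V) (s V) (\<gamma> V)"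
    by metis
  define \<sigma> where "\<sigma> V p = \<rho> V (proj P p)" for V p
  define \<kappa> where "\<kappa> V p = inv\<^bsub>EG\<^esub> i (\<alpha> (str P p) (\<gamma> V p))" for V p
  \<comment> \<open>The factor depends on \<open>p\<close> through \<open>str P p\<close> and not on
    \<open>g\<close> alone. A relation of triples accommodates this without turning the left action
    into a group action first.\<close>
  define R where "R = {(p, ract P p g, inv\<^bsub>EG\<^esub> i (\<alpha> (str P p) g)) |p g. p \<in> ?X \<and> g \<in> carrier G}"
  have strC: "str P p \<in> carrier H" if "p \<in> ?X" for p
    by (rule H.continuous_map_carrier[OF P.str_continuous that])
  have inU: "proj P p \<in> U V" if "V \<in> \<V>" "p \<in> ?X" "0 < \<sigma> V p" for V p
    using that rho(3)[OF that(1) P.proj_closed[OF that(2)]] tr(1)[OF that(1)] by (auto simp: \<sigma>_def)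
  interpret gluing EG "total P" \<V> \<sigma> \<kappa> R
  proof unfold_locales
    show "contractible_space (gtop EG)" by (rule EG_contractible)
    show "locally_finite_support (total P) \<V> \<sigma>"
      unfolding locally_finite_support_def
    proof
      fix p assume p: "p \<in> ?X"
      then obtain N where N: "openin M N" "proj P p \<in> N" "finite {V \<in> \<V>. \<exists>y\<in>N. \<rho> V y \<noteq> 0}"
        using locally_finite_support_of_sets[OF V(1) rho(3)] P.proj_closed
        unfolding locally_finite_support_def by blast
      let ?N = "{q \<in> ?X. proj P q \<in> N}"
      have "finite {V \<in> \<V>. \<exists>q\<in>?N. \<sigma> V q \<noteq> 0}"
        by (rule finite_subset[OF _ N(3)]) (auto simp: \<sigma>_def)
      then show "\<exists>N. openin (total P) N \<and> p \<in> N \<and> finite {V \<in> \<V>. \<exists>q\<in>N. \<sigma> V q \<noteq> 0}"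
        using openin_continuous_map_preimage[OF P.proj_continuous N(1)] p N(2) by (intro exI[of _ ?N]) simp
    qed
    show "continuous_map (total P) euclideanreal (\<sigma> V)" if "V \<in> \<V>" for V
      using continuous_map_compose[OF P.proj_continuous rho(1)[OF that]] by (simp add: \<sigma>_def[abs_def] o_def)
    show "0 \<le> \<sigma> V p" if "V \<in> \<V>" "p \<in> ?X" for V p
      using that rho(2) P.proj_closed by (simp add: \<sigma>_def)
    show "\<exists>V\<in>\<V>. 0 < \<sigma> V p" if "p \<in> ?X" for p
      using rho(4)[OF P.proj_closed[OF that]] by (simp add: \<sigma>_def)
    show "continuous_map (subtopology (total P) {p \<in> ?X. 0 < \<sigma> V p}) (gtop EG) (\<kappa> V)" if "V \<in> \<V>" for V
    proof -
      let ?S = "{p \<in> ?X. 0 < \<sigma> V p}"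
      have "continuous_map (subtopology (total P) ?S) (gtop G) (\<gamma> V)"
        by (rule continuous_map_from_subtopology_mono[OF P.triv_coord[OF tr(2)[OF that]]])
          (use inU[OF that] in blast)
      then have "continuous_map (subtopology (total P) ?S) (gtop G) (\<lambda>p. \<alpha> (str P p) (\<gamma> V p))"
        by (rule continuous_map_case_prod[OF action_continuous
              continuous_map_from_subtopology[OF P.str_continuous]])
      from continuous_map_compose[OF this i_continuous]
      show ?thesis
        unfolding \<kappa>_def by (intro EG.continuous_map_invI) (simp add: o_def)
    qed
    fix p q w assume "(p, q, w) \<in> R"
    then obtain g where p: "p \<in> ?X" and g: "g \<in> carrier G" and q: "q = ract P p g"
      and w: "w = inv\<^bsub>EG\<^esub> i (\<alpha> (str P p) g)" unfolding R_def by blast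
    show "p \<in> ?X \<and> q \<in> ?X \<and> w \<in> carrier EG"
      using p g strC[OF p] by (simp add: q w P.ract_closed)
    show "\<sigma> V q = \<sigma> V p" for V using P.proj_ract[OF p g] by (simp add: \<sigma>_def q)
    show "\<kappa> V q = \<kappa> V p \<otimes>\<^bsub>EG\<^esub> w" if V: "V \<in> \<V>" and pos: "0 < \<sigma> V p" for V
    proof -
      note pU = inU[OF V p pos]
      have k: "\<gamma> V p \<in> carrier G" by (rule P.triv_coord_closed[OF tr(2)[OF V] p pU])
      have "\<gamma> V q = \<gamma> V p \<otimes>\<^bsub>G\<^esub> g" unfolding q by (rule P.triv_equivariant[OF tr(2)[OF V] p pU g])
      moreover have "str P q = str P p \<otimes>\<^bsub>H\<^esub> t g" unfolding q by (rule P.str_ract[OF p g])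
      ultimately have "\<alpha> (str P q) (\<gamma> V q) = \<alpha> (str P p) (\<alpha> (t g) (\<gamma> V p \<otimes>\<^bsub>G\<^esub> g))"
        using strC[OF p] g k by (simp add: action_comp)
      also have "\<alpha> (t g) (\<gamma> V p \<otimes>\<^bsub>G\<^esub> g) = g \<otimes>\<^bsub>G\<^esub> \<gamma> V p"
        using g k by (simp add: action_t G.m_assoc)
      also have "\<alpha> (str P p) (g \<otimes>\<^bsub>G\<^esub> \<gamma> V p) = \<alpha> (str P p) g \<otimes>\<^bsub>G\<^esub> \<alpha> (str P p) (\<gamma> V p)"
        using strC[OF p] g k by (simp add: action_mult)
      finally show ?thesis
        using strC[OF p] g k by (simp add: \<kappa>_def w i_mult EG.inv_mult_group)
    qed
  qed
  obtain \<phi> where "continuous_map (total P) (gtop EG) \<phi>"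
      "\<forall>x y w. (x, y, w) \<in> R \<longrightarrow> \<phi> y = \<phi> x \<otimes>\<^bsub>EG\<^esub> w"
    using global_solution by blast
  then show ?thesis by (intro exI[of _ \<phi>]) (auto simp: R_def)
qed

text \<open>The pair of the equivariant map and the structure map is equivariant into
  \<open>E\<close>. Right translation by \<open>\<nu> g\<close> does not change the coset, so the
  coset of the pair depends on the base point only; local sections of \<open>P\<close> show that the
  resulting map is continuous.\<close>

theorem classifying_map_exists:
  assumes M: "paracompact_space M" and P: "is_bibundle H G t M P"
  shows "\<exists>F. continuous_map M (gtop B) F \<and> bibundle_iso G P (pull M F)"
proof -
  interpret P: bibundle G M P H t by (rule bibundle_locale[OF G.topological_group_axioms P])
  let ?X = "topspace (total P)"
  obtain \<phi> where phi: "continuous_map (total P) (gtop EG) \<phi>"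
    "\<And>p g. p \<in> ?X \<Longrightarrow> g \<in> carrier G \<Longrightarrow> \<phi> (ract P p g) = \<phi> p \<otimes>\<^bsub>EG\<^esub> inv\<^bsub>EG\<^esub> i (\<alpha> (str P p) g)"
    using equivariant_map_exists[OF M P] by blast
  define a where "a p = (\<phi> p, str P p)" for p
  have strC: "str P p \<in> carrier H" if "p \<in> ?X" for p
    by (rule H.continuous_map_carrier[OF P.str_continuous that])
  have ac: "continuous_map (total P) (gtop E) a"
    unfolding a_def E_gtop by (intro continuous_map_pairedI phi P.str_continuous)
  have aC: "a p \<in> carrier E" if "p \<in> ?X" for p
    by (rule E.continuous_map_carrier[OF ac that])
  have ar: "a (ract P p g) = a p \<otimes>\<^bsub>E\<^esub> \<nu> g" if "p \<in> ?X" "g \<in> carrier G" for p g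
  proof -
    have "\<epsilon> (str P p) (i (inv\<^bsub>G\<^esub> g)) = i (\<alpha> (str P p) (inv\<^bsub>G\<^esub> g))"
      using that strC[OF that(1)] by (intro ext_action_extends) auto
    also have "\<dots> = inv\<^bsub>EG\<^esub> i (\<alpha> (str P p) g)"
      using that strC[OF that(1)] by (simp add: action_inv i_inv)
    finally show ?thesis using that by (simp add: a_def phi P.str_ract \<nu>_eq)
  qed
  define F where "F m = E.\<pi> (a (SOME p. p \<in> ?X \<and> proj P p = m))" for m
  have F: "F (proj P p) = E.\<pi> (a p)" if p: "p \<in> ?X" for p
  proof -
    define q where "q = (SOME q. q \<in> ?X \<and> proj P q = proj P p)"
    have q: "q \<in> ?X" "proj P q = proj P p"
      using someI[where P="\<lambda>q. q \<in> ?X \<and> proj P q = proj P p", of p] p by (auto simp: q_def)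
    then obtain g where g: "g \<in> carrier G" "p = ract P q g" using P.transitive[of q p] p by auto
    then have "E.\<pi> (a p) = E.\<pi> (a q)" using ar[OF q(1) g(1)] \<pi>_ract[OF aC[OF q(1)] g(1)] by simp
    then show ?thesis by (simp add: F_def q_def)
  qed
  have "continuous_map M (gtop B) F"
  proof (rule continuous_map_locally)
    fix m assume "m \<in> topspace M"
    then obtain U s \<gamma> where U: "m \<in> U" "trivialization G M P U s \<gamma>"
      using P.trivialization_exists by blast
    have "continuous_map (subtopology M U) (gtop B) (\<lambda>m. E.\<pi> (a (s m)))"
      using continuous_map_compose[OF continuous_map_compose[OF P.triv_section[OF U(2)] ac] \<pi>_continuous]
      by (simp add: o_def)
    moreover have "F u = E.\<pi> (a (s u))" if "u \<in> U" for u
      using F[OF P.triv_section_closed[OF U(2) that]] P.triv_proj[OF U(2) that] by simp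
    ultimately show "\<exists>U g. openin M U \<and> m \<in> U \<and> continuous_map (subtopology M U) (gtop B) g \<and>
        (\<forall>y\<in>U. F y = g y)"
      using P.triv_open(1)[OF U(2)] U(1) by (intro exI[of _ U] exI[of _ "\<lambda>m. E.\<pi> (a (s m))"]) simp
  qed
  moreover have "classifies M P F a"
    unfolding classifies_def using ac F ar by (auto simp: a_def)
  ultimately show ?thesis using iso_pullI[OF P] by blast
qed

section \<open>Tensor products and products of classifying maps\<close>

text \<open>The tensor product is a quotient of the fibre product by definition, and the product map
  exhibits the pullback as another quotient of the same space. Both quotient maps have the same
  fibres, hence the same target up to homeomorphism, and structure maps and actions can be compared
  on representatives.\<close>

theorem tensor_pull:
  assumes P: "is_bibundle H G t M P" and Q: "is_bibundle H G t M Q"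
    and F: "continuous_map M (gtop B) F" and F': "continuous_map M (gtop B) F'"
    and PF: "bibundle_iso G P (pull M F)" and QF: "bibundle_iso G Q (pull M F')"
  shows "bibundle_iso G (pull M (\<lambda>m. F m \<otimes>\<^bsub>B\<^esub> F' m)) (tensor H G \<alpha> P Q)"
proof -
  interpret P: bibundle G M P H t by (rule bibundle_locale[OF G.topological_group_axioms P])
  interpret Q: bibundle G M Q H t by (rule bibundle_locale[OF G.topological_group_axioms Q])
  obtain a where a: "classifies M P F a" using iso_pullE[OF P PF] by blast
  obtain b where b: "classifies M Q F' b"
    and bh: "homeomorphic_map (total Q) (total (pull M F')) (\<lambda>q. (proj Q q, b q))"
    using iso_pullE[OF Q QF] by blast
  have ac: "continuous_map (total P) (gtop E) a" and bc: "continuous_map (total Q) (gtop E) b"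
    using a b by (auto simp: classifies_def)
  have ap: "E.\<pi> (a p) = F (proj P p)" "snd (a p) = str P p"
    "\<And>g. g \<in> carrier G \<Longrightarrow> a (ract P p g) = a p \<otimes>\<^bsub>E\<^esub> \<nu> g" "a p \<in> carrier E"
    if "p \<in> topspace (total P)" for p
    using a that E.continuous_map_carrier[OF ac that] by (auto simp: classifies_def)
  have bq: "E.\<pi> (b q) = F' (proj Q q)" "snd (b q) = str Q q"
    "\<And>g. g \<in> carrier G \<Longrightarrow> b (ract Q q g) = b q \<otimes>\<^bsub>E\<^esub> \<nu> g" "b q \<in> carrier E"
    if "q \<in> topspace (total Q)" for q
    using b that E.continuous_map_carrier[OF bc that] by (auto simp: classifies_def)
  have strQ: "str Q q \<in> carrier H" if "q \<in> topspace (total Q)" for q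
    by (rule H.continuous_map_carrier[OF Q.str_continuous that])
  define FF where "FF = (\<lambda>m. F m \<otimes>\<^bsub>B\<^esub> F' m)"
  let ?X = "fibre_product P Q" and ?Z = "total (pull M FF)" and ?T = "tensor H G \<alpha> P Q"
  let ?tc = "tensor_class H G \<alpha> P Q"
  have X: "(p, q) \<in> topspace ?X \<longleftrightarrow> p \<in> topspace (total P) \<and> q \<in> topspace (total Q) \<and> proj P p = proj Q q"
    for p q by (auto simp: fibre_product_def)
  \<comment> \<open>The base point is recorded as well, since the pullback consists of pairs of a
    base point and a point of \<open>E\<close>.\<close>
  define \<Theta> where "\<Theta> = (\<lambda>(p, q). (proj P p, a p \<otimes>\<^bsub>E\<^esub> b q))"
  have \<Theta>Z: "\<Theta> z \<in> topspace ?Z" if "z \<in> topspace ?X" for z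
  proof -
    obtain p q where z: "z = (p, q)" by (cases z)
    then have pq: "p \<in> topspace (total P)" "q \<in> topspace (total Q)" "proj P p = proj Q q"
      using that X by auto
    have "E.\<pi> (a p \<otimes>\<^bsub>E\<^esub> b q) = FF (proj P p)"
      using \<pi>_mult[OF ap(4)[OF pq(1)] bq(4)[OF pq(2)]] ap(1)[OF pq(1)] bq(1)[OF pq(2)] pq(3)
      by (simp add: FF_def)
    then show ?thesis
      using E_closed[OF ap(4)[OF pq(1)] bq(4)[OF pq(2)]] P.proj_closed[OF pq(1)]
      unfolding topspace_pull z \<Theta>_def by simp
  qed
  have fstX: "continuous_map ?X (total P) fst" and sndX: "continuous_map ?X (total Q) snd"
    unfolding fibre_product_def
    by (intro continuous_map_from_subtopology continuous_map_fst continuous_map_snd)+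
  have "continuous_map ?X (prod_topology M (gtop E)) \<Theta>"
    unfolding \<Theta>_def case_prod_unfold
    by (intro continuous_map_pairedI E.continuous_map_multI
        continuous_map_compose[OF fstX P.proj_continuous, unfolded o_def]
        continuous_map_compose[OF fstX ac, unfolded o_def] continuous_map_compose[OF sndX bc, unfolded o_def])
  then have \<Theta>c: "continuous_map ?X ?Z \<Theta>"
    using \<Theta>Z unfolding pull_simps continuous_map_in_subtopology by auto
  have left: "b (left_act H \<alpha> Q g q) = \<nu> g \<otimes>\<^bsub>E\<^esub> b q" "left_act H \<alpha> Q g q \<in> topspace (total Q)"
    "proj Q (left_act H \<alpha> Q g q) = proj Q q"
    if q: "q \<in> topspace (total Q)" and g: "g \<in> carrier G" for q g
  proof -
    have k: "\<alpha> (inv\<^bsub>H\<^esub> str Q q) g \<in> carrier G" using strQ[OF q] g by simp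
    show "b (left_act H \<alpha> Q g q) = \<nu> g \<otimes>\<^bsub>E\<^esub> b q"
      unfolding left_act_def using bq(3)[OF q k] \<nu>_conj[OF bq(4)[OF q] g] bq(2)[OF q] by simp
    show "left_act H \<alpha> Q g q \<in> topspace (total Q)" "proj Q (left_act H \<alpha> Q g q) = proj Q q"
      unfolding left_act_def by (rule Q.ract_closed[OF q k] Q.proj_ract[OF q k])+
  qed
  have tc: "?tc z = {y \<in> topspace ?X. \<Theta> y = \<Theta> z}" if "z \<in> topspace ?X" for z
  proof -
    obtain p q where z: "z = (p, q)" by (cases z)
    then have p: "p \<in> topspace (total P)" and q: "q \<in> topspace (total Q)" and pq: "proj P p = proj Q q"
      using that X by auto
    note Cs = ap(4)[OF p] bq(4)[OF q]
    show ?thesis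
    proof (intro equalityI subsetI)
      fix y assume "y \<in> ?tc z"
      then obtain g where g: "g \<in> carrier G" and y: "y = (ract P p g, left_act H \<alpha> Q (inv\<^bsub>G\<^esub> g) q)"
        unfolding z tensor_class_def by auto
      have "inv\<^bsub>G\<^esub> g \<in> carrier G" using g by simp
      note l = left[OF q this]
      have "a p \<otimes>\<^bsub>E\<^esub> \<nu> g \<otimes>\<^bsub>E\<^esub> (\<nu> (inv\<^bsub>G\<^esub> g) \<otimes>\<^bsub>E\<^esub> b q) = a p \<otimes>\<^bsub>E\<^esub> (\<nu> g \<otimes>\<^bsub>E\<^esub> \<nu> (inv\<^bsub>G\<^esub> g)) \<otimes>\<^bsub>E\<^esub> b q"
        using Cs g by (simp add: E.m_assoc E_closed del: E_carrier E_mult)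
      also have "\<dots> = a p \<otimes>\<^bsub>E\<^esub> b q"
        using Cs g by (simp add: \<nu>_mult[symmetric] del: E_carrier E_one E_mult)
      finally show "y \<in> {y \<in> topspace ?X. \<Theta> y = \<Theta> z}"
        unfolding y using X P.ract_closed[OF p g] P.proj_ract[OF p g] l ap(3)[OF p g] pq
        by (simp add: z \<Theta>_def)
    next
      fix y assume "y \<in> {y \<in> topspace ?X. \<Theta> y = \<Theta> z}"
      then obtain p' q' where y: "y = (p', q')" and p': "p' \<in> topspace (total P)"
        and q': "q' \<in> topspace (total Q)" and pq': "proj P p' = proj Q q'"
        and pp: "proj P p' = proj P p" and ab: "a p' \<otimes>\<^bsub>E\<^esub> b q' = a p \<otimes>\<^bsub>E\<^esub> b q"
        by (cases y) (auto simp: X z \<Theta>_def)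
      obtain g where g: "g \<in> carrier G" "p' = ract P p g" using P.transitive[OF p p'] pp by auto
      have gi: "inv\<^bsub>G\<^esub> g \<in> carrier G" using g by simp
      \<comment> \<open>Cancelling \<open>a p\<close> in the group \<open>E\<close> turns equality
        of the products into a relation between \<open>b q'\<close> and \<open>b q\<close>. Together
        with the base point, \<open>b\<close> determines a point of \<open>Q\<close>, so
        \<open>q'\<close> is the expected translate of \<open>q\<close>.\<close>
      have "\<nu> g \<otimes>\<^bsub>E\<^esub> b q' = b q"
      proof -
        have "a p \<otimes>\<^bsub>E\<^esub> (\<nu> g \<otimes>\<^bsub>E\<^esub> b q') = a p \<otimes>\<^bsub>E\<^esub> b q"
          using ab ap(3)[OF p g(1)] g Cs bq(4)[OF q'] by (simp add: E.m_assoc del: E_carrier E_mult)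
        then show ?thesis
          using Cs bq(4)[OF q'] g by (simp add: E_closed del: E_carrier E_mult)
      qed
      moreover have "\<nu> (inv\<^bsub>G\<^esub> g) \<otimes>\<^bsub>E\<^esub> (\<nu> g \<otimes>\<^bsub>E\<^esub> b q') = b q'"
        using g bq(4)[OF q'] by (simp add: E.m_assoc[symmetric] \<nu>_mult[symmetric] del: E_carrier E_one E_mult)
      ultimately have "b q' = b (left_act H \<alpha> Q (inv\<^bsub>G\<^esub> g) q)" using left(1)[OF q gi] by simp
      moreover have "proj Q q' = proj Q (left_act H \<alpha> Q (inv\<^bsub>G\<^esub> g) q)"
        using left(3)[OF q gi] pp pq pq' by simp
      ultimately have "q' = left_act H \<alpha> Q (inv\<^bsub>G\<^esub> g) q"
        using inj_onD[OF homeomorphic_imp_injective_map[OF bh], of q' "left_act H \<alpha> Q (inv\<^bsub>G\<^esub> g) q"] q' left(2)[OF q gi]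
        by simp
      then show "y \<in> ?tc z" using g unfolding z y tensor_class_def by auto
    qed
  qed
  obtain k where kc: "continuous_map (total (pull M F')) (total Q) k"
    and k: "\<And>m x. (m, x) \<in> topspace (total (pull M F')) \<Longrightarrow>
      k (m, x) \<in> topspace (total Q) \<and> proj Q (k (m, x)) = m \<and> b (k (m, x)) = x"
  proof -
    obtain k where kh: "homeomorphic_map (total (pull M F')) (total Q) k"
      and k2: "\<forall>y\<in>topspace (total (pull M F')). k y \<in> topspace (total Q) \<and> (proj Q (k y), b (k y)) = y"
      using homeomorphic_map_inverse[OF bh] by blast
    show ?thesis using that[OF homeomorphic_imp_continuous_map[OF kh]] k2 by auto
  qed
  have qZ: "quotient_map ?X ?Z \<Theta>"
  proof (rule quotient_map_local_sections[OF \<Theta>c])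
    fix z0 assume z0: "z0 \<in> topspace ?Z"
    then have "fst z0 \<in> topspace M" by (auto simp: topspace_pull)
    then obtain U s \<gamma> where U: "fst z0 \<in> U" "trivialization G M P U s \<gamma>"
      using P.trivialization_exists by blast
    let ?W = "{z \<in> topspace ?Z. fst z \<in> U}"
    let ?Y = "subtopology ?Z ?W"
    have fstZ: "continuous_map ?Z M fst" and sndZ: "continuous_map ?Z (gtop E) snd"
      unfolding pull_simps
      by (intro continuous_map_from_subtopology continuous_map_fst continuous_map_snd)+
    have W: "openin ?Z ?W" by (rule openin_continuous_map_preimage[OF fstZ P.triv_open(1)[OF U(2)]])
    \<comment> \<open>To find a pair with product \<open>x\<close> over \<open>m\<close>, take
      \<open>s m\<close> in \<open>P\<close>; then \<open>b\<close> must have the value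
      \<open>a (s m)\<^sup>-\<^sup>1 x\<close> at the second point. This value lies over
      \<open>F' m\<close>, and \<open>k\<close> turns it into a point of \<open>Q\<close>.\<close>
    define w where "w z = (fst z, inv\<^bsub>E\<^esub> a (s (fst z)) \<otimes>\<^bsub>E\<^esub> snd z)" for z
    define \<sigma> where "\<sigma> z = (s (fst z), k (w z))" for z
    have facts: "w z \<in> topspace (total (pull M F'))" "\<sigma> z \<in> topspace ?X" "\<Theta> (\<sigma> z) = z" if z: "z \<in> ?W" for z
    proof -
      obtain m x where zz: "z = (m, x)" by (cases z)
      have m: "m \<in> topspace M" "m \<in> U" and x: "x \<in> carrier E" "FF m = E.\<pi> x"
        using z unfolding zz topspace_pull by auto
      have s: "s m \<in> topspace (total P)" "proj P (s m) = m"
        using P.triv_section_closed[OF U(2) m(2)] P.triv_proj[OF U(2) m(2)] by auto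
      note as = ap[OF s(1), unfolded s(2)]
      have ai: "inv\<^bsub>E\<^esub> a (s m) \<in> carrier E" using as(4) by (rule E.inv_closed)
      have FC: "F m \<in> carrier B" "F' m \<in> carrier B"
        using B.continuous_map_carrier[OF F m(1)] B.continuous_map_carrier[OF F' m(1)] by auto
      have "E.\<pi> (inv\<^bsub>E\<^esub> a (s m) \<otimes>\<^bsub>E\<^esub> x) = inv\<^bsub>B\<^esub> E.\<pi> (a (s m)) \<otimes>\<^bsub>B\<^esub> E.\<pi> x"
        using as(4) x ai by (simp add: \<pi>_inv \<pi>_mult del: E_carrier)
      also have "\<dots> = inv\<^bsub>B\<^esub> F m \<otimes>\<^bsub>B\<^esub> (F m \<otimes>\<^bsub>B\<^esub> F' m)"
        using as(1) x(2) by (simp add: FF_def)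
      also have "\<dots> = F' m" using FC by (simp add: B.m_assoc[symmetric])
      finally show wz: "w z \<in> topspace (total (pull M F'))"
        unfolding w_def zz topspace_pull using m(1) E_closed[OF ai x(1)] by simp
      have kk: "k (w z) \<in> topspace (total Q)" "proj Q (k (w z)) = m" "b (k (w z)) = inv\<^bsub>E\<^esub> a (s m) \<otimes>\<^bsub>E\<^esub> x"
        using k[OF wz[unfolded w_def zz]] by (simp_all add: w_def zz)
      show "\<sigma> z \<in> topspace ?X" using kk s by (simp add: \<sigma>_def X zz)
      have "a (s m) \<otimes>\<^bsub>E\<^esub> (inv\<^bsub>E\<^esub> a (s m) \<otimes>\<^bsub>E\<^esub> x) = x"
        using as(4) x(1) ai by (simp add: E.m_assoc[symmetric] del: E_carrier E_one)
      then show "\<Theta> (\<sigma> z) = z" using kk s by (simp add: \<sigma>_def \<Theta>_def zz)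
    qed
    have sc: "continuous_map ?Y (total P) (\<lambda>z. s (fst z))"
    proof -
      have "continuous_map ?Y (subtopology M U) fst"
        using continuous_map_from_subtopology[OF fstZ] by (auto simp: continuous_map_in_subtopology)
      from continuous_map_compose[OF this P.triv_section[OF U(2)]] show ?thesis by (simp add: o_def)
    qed
    have "continuous_map ?Y (prod_topology M (gtop E)) w"
      unfolding w_def
      by (intro continuous_map_pairedI E.continuous_map_multI E.continuous_map_invI
          continuous_map_from_subtopology[OF fstZ] continuous_map_from_subtopology[OF sndZ]
          continuous_map_compose[OF sc ac, unfolded o_def])
    then have "continuous_map ?Y (total (pull M F')) w"
      unfolding pull_simps continuous_map_in_subtopology
      using facts(1) by (auto simp: topspace_pull pull_simps)
    from continuous_map_compose[OF this kc] have "continuous_map ?Y (total Q) (\<lambda>z. k (w z))" by (simp add: o_def)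
    then have "continuous_map ?Y (prod_topology (total P) (total Q)) \<sigma>"
      unfolding \<sigma>_def using sc by (intro continuous_map_pairedI)
    then have "continuous_map ?Y ?X \<sigma>"
      unfolding fibre_product_def continuous_map_in_subtopology
      using facts(2) by (auto simp: fibre_product_def)
    then show "\<exists>W s. openin ?Z W \<and> z0 \<in> W \<and> continuous_map (subtopology ?Z W) ?X s \<and> (\<forall>z\<in>W. \<Theta> (s z) = z)"
      using W facts(3) z0 U(1) by (intro exI[of _ ?W] exI[of _ \<sigma>]) simp
  qed
  have totT: "total ?T = quotient_topology ?X ?tc"
    "proj ?T = (\<lambda>X. the_elem ((\<lambda>(p, q). proj P p) ` X))"
    "ract ?T = (\<lambda>X g. the_elem ((\<lambda>(p, q). ?tc (p, ract Q q g)) ` X))"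
    "str ?T = (\<lambda>X. the_elem ((\<lambda>(p, q). str P p \<otimes>\<^bsub>H\<^esub> str Q q) ` X))"
    by (simp_all add: tensor_def)
  have qT: "quotient_map ?X (total ?T) ?tc"
    unfolding totT by (rule quotient_map_quotient_topology)
  have tceq: "\<Theta> x = \<Theta> y \<longleftrightarrow> ?tc x = ?tc y" if "x \<in> topspace ?X" "y \<in> topspace ?X" for x y
    using that by (auto simp: tc)
  obtain h where h: "homeomorphic_map ?Z (total ?T) h" "\<forall>x\<in>topspace ?X. h (\<Theta> x) = ?tc x"
    using quotient_maps_homeomorphic[OF qZ qT tceq] by blast
  have "proj ?T (h z) = proj (pull M FF) z \<and> str ?T (h z) = str (pull M FF) z \<and>
      (\<forall>g\<in>carrier G. h (ract (pull M FF) z g) = ract ?T (h z) g)" if z: "z \<in> topspace ?Z" for z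
  proof -
    have "z \<in> \<Theta> ` topspace ?X" using quotient_imp_surjective_map[OF qZ] z by blast
    then obtain p q where pqX: "(p, q) \<in> topspace ?X" and zz: "z = \<Theta> (p, q)" by auto
    have p: "p \<in> topspace (total P)" and q: "q \<in> topspace (total Q)" and pq: "proj P p = proj Q q"
      using pqX X by auto
    have hz: "h z = ?tc (p, q)" using h(2) pqX zz by blast
    have mem: "(p, q) \<in> ?tc (p, q)" using tc[OF pqX] pqX by blast
    have el: "p' \<in> topspace (total P) \<and> q' \<in> topspace (total Q) \<and> proj P p' = proj Q q' \<and>
        proj P p' = proj P p \<and> a p' \<otimes>\<^bsub>E\<^esub> b q' = a p \<otimes>\<^bsub>E\<^esub> b q" if "(p', q') \<in> ?tc (p, q)" for p' q'
      using that tc[OF pqX] X by (auto simp: \<Theta>_def)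
    have 1: "proj ?T (h z) = proj P p"
      unfolding totT hz by (rule the_elem_image_const[OF mem]) (use el in auto)
    have sndE: "snd (a p' \<otimes>\<^bsub>E\<^esub> b q') = str P p' \<otimes>\<^bsub>H\<^esub> str Q q'"
      if "p' \<in> topspace (total P)" "q' \<in> topspace (total Q)" for p' q'
      using ap(2)[OF that(1)] bq(2)[OF that(2)] by (cases "a p'"; cases "b q'") simp
    have 2: "str ?T (h z) = snd (a p \<otimes>\<^bsub>E\<^esub> b q)"
      unfolding totT hz
    proof (rule the_elem_image_const[OF mem])
      fix y assume "y \<in> ?tc (p, q)"
      then show "(\<lambda>(p, q). str P p \<otimes>\<^bsub>H\<^esub> str Q q) y = snd (a p \<otimes>\<^bsub>E\<^esub> b q)"
        using el[of "fst y" "snd y"] sndE[of "fst y" "snd y"] by (cases y) simp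
    qed
    have 3: "h (ract (pull M FF) z g) = ract ?T (h z) g" if g: "g \<in> carrier G" for g
    proof -
      have mv: "(p', ract Q q' g) \<in> topspace ?X" "\<Theta> (p', ract Q q' g) = (proj P p, a p \<otimes>\<^bsub>E\<^esub> b q \<otimes>\<^bsub>E\<^esub> \<nu> g)"
        if "(p', q') \<in> ?tc (p, q)" for p' q'
      proof -
        note e = el[OF that]
        show "(p', ract Q q' g) \<in> topspace ?X" using e g by (simp add: X Q.ract_closed Q.proj_ract)
        have "a p' \<otimes>\<^bsub>E\<^esub> (b q' \<otimes>\<^bsub>E\<^esub> \<nu> g) = a p' \<otimes>\<^bsub>E\<^esub> b q' \<otimes>\<^bsub>E\<^esub> \<nu> g"
          using g ap(4)[OF e[THEN conjunct1]] bq(4)[OF e[THEN conjunct2, THEN conjunct1]]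
          by (simp add: E.m_assoc del: E_carrier E_mult)
        then show "\<Theta> (p', ract Q q' g) = (proj P p, a p \<otimes>\<^bsub>E\<^esub> b q \<otimes>\<^bsub>E\<^esub> \<nu> g)"
          using e g bq(3)[of q' g] by (auto simp: \<Theta>_def)
      qed
      have "ract (pull M FF) z g = \<Theta> (p, ract Q q g)"
        using mv(2)[OF mem] by (simp add: zz pull_simps \<Theta>_def)
      then have "h (ract (pull M FF) z g) = ?tc (p, ract Q q g)" using h(2) mv(1)[OF mem] by simp
      moreover have "ract ?T (h z) g = ?tc (p, ract Q q g)"
        unfolding totT hz
      proof (rule the_elem_image_const[OF mem])
        fix y assume y: "y \<in> ?tc (p, q)"
        obtain p' q' where y': "y = (p', q')" by (cases y)
        note y = y[unfolded y']
        have "?tc (p', ract Q q' g) = ?tc (p, ract Q q g)"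
          unfolding tc[OF mv(1)[OF y]] tc[OF mv(1)[OF mem]] mv(2)[OF y] mv(2)[OF mem] ..
        then show "(\<lambda>(p, q). ?tc (p, ract Q q g)) y = ?tc (p, ract Q q g)" by (simp add: y')
      qed
      ultimately show ?thesis by simp
    qed
    show ?thesis using 1 2 3 by (simp add: zz \<Theta>_def pull_simps)
  qed
  then show ?thesis unfolding bibundle_iso_def FF_def[symmetric] using h(1) by blast
qed

end

section \<open>Homotopies over the type map\<close>

context bibundle_model
begin

abbreviation tG where "tG \<equiv> t ` carrier G"

lemma tG_normal: "tG \<lhd> H"
proof (rule H.normal_invI)
  have "group_hom G H t"
    unfolding group_hom_def group_hom_axioms_def using G.group_axioms H.group_axioms t_hom by blast
  then interpret t: group_hom G H t .
  show "subgroup tG H" by (rule t.img_is_subgroup)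
  fix x h assume "x \<in> carrier H" "h \<in> tG"
  then obtain g where "g \<in> carrier G" "h = t g" "x \<in> carrier H" by blast
  then show "x \<otimes>\<^bsub>H\<^esub> h \<otimes>\<^bsub>H\<^esub> inv\<^bsub>H\<^esub> x \<in> tG"
    by (metis action_closed imageI t_action)
qed

sublocale TG: topological_normal tG H
  by (intro topological_normal.intro H.topological_group_axioms tG_normal)

lemma \<Phi>_\<pi>:
  assumes x: "x \<in> carrier E" shows "\<Phi> (E.\<pi> x) = TG.\<pi> (snd x)"
  unfolding type_map_def
proof (rule the_elem_image_const)
  show "x \<in> E.\<pi> x" using E.rcos_self[OF x] E.is_subgroup by blast
  fix y assume "y \<in> E.\<pi> x"
  then obtain g where g: "g \<in> carrier G" and y: "y = \<nu> g \<otimes>\<^bsub>E\<^esub> x" by (auto simp: r_coset_def)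
  have h: "snd x \<in> carrier H" using x by auto
  have "snd y = t g \<otimes>\<^bsub>H\<^esub> snd x" by (cases x) (simp add: y \<nu>_eq)
  moreover have "TG.\<pi> (snd x) = TG.\<pi> (t g \<otimes>\<^bsub>H\<^esub> snd x)"
    using TG.\<pi>_eq_iff[of "snd x" "t g \<otimes>\<^bsub>H\<^esub> snd x"] h g by auto
  ultimately show "(\<lambda>(e, h). tG #>\<^bsub>H\<^esub> h) y = TG.\<pi> (snd x)" by (simp add: case_prod_unfold)
qed

lemma \<Phi>_mult:
  assumes "b \<in> carrier B" "b' \<in> carrier B"
  shows "\<Phi> (b \<otimes>\<^bsub>B\<^esub> b') = \<Phi> b \<otimes>\<^bsub>topquot H tG\<^esub> \<Phi> b'"
proof -
  obtain x y where x: "x \<in> carrier E" "b = E.\<pi> x" and y: "y \<in> carrier E" "b' = E.\<pi> y"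
    using \<pi>_surj assms by blast
  have h: "snd x \<in> carrier H" "snd y \<in> carrier H" using x y by auto
  have "\<Phi> (b \<otimes>\<^bsub>B\<^esub> b') = TG.\<pi> (snd (x \<otimes>\<^bsub>E\<^esub> y))"
    using x y E_closed by (simp add: \<pi>_mult \<Phi>_\<pi> del: E_carrier E_mult)
  also have "snd (x \<otimes>\<^bsub>E\<^esub> y) = snd x \<otimes>\<^bsub>H\<^esub> snd y" by (cases x; cases y) simp
  also have "TG.\<pi> (snd x \<otimes>\<^bsub>H\<^esub> snd y) = TG.\<pi> (snd x) \<otimes>\<^bsub>topquot H tG\<^esub> TG.\<pi> (snd y)"
    using TG.mult_topquot[OF h] by simp
  finally show ?thesis using x y by (simp only: \<Phi>_\<pi>)
qed

lemma \<Phi>_inv_mult: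
  assumes "b \<in> carrier B" "b' \<in> carrier B" "\<Phi> b = \<Phi> b'"
  shows "\<Phi> (inv\<^bsub>B\<^esub> b \<otimes>\<^bsub>B\<^esub> b') = \<Phi> \<one>\<^bsub>B\<^esub>"
proof -
  have bi: "inv\<^bsub>B\<^esub> b \<in> carrier B" using assms(1) by (rule B.inv_closed)
  have "\<Phi> (inv\<^bsub>B\<^esub> b \<otimes>\<^bsub>B\<^esub> b') = \<Phi> (inv\<^bsub>B\<^esub> b \<otimes>\<^bsub>B\<^esub> b)"
    unfolding \<Phi>_mult[OF bi assms(1)] \<Phi>_mult[OF bi assms(2)] assms(3) ..
  also have "inv\<^bsub>B\<^esub> b \<otimes>\<^bsub>B\<^esub> b = \<one>\<^bsub>B\<^esub>" using assms(1) by (rule B.l_inv)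
  finally show ?thesis .
qed

lemma snd_in_tG:
  assumes x: "x \<in> carrier E" and "\<Phi> (E.\<pi> x) = \<Phi> \<one>\<^bsub>B\<^esub>"
  shows "snd x \<in> tG"
proof -
  have h: "snd x \<in> carrier H" using x by auto
  have "\<one>\<^bsub>E\<^esub> \<in> carrier E" by simp
  then have "TG.\<pi> \<one>\<^bsub>H\<^esub> = TG.\<pi> (snd x)"
    using assms(2) \<Phi>_\<pi>[OF x] \<Phi>_\<pi>[of "\<one>\<^bsub>E\<^esub>"] by (simp add: \<pi>_one[symmetric])
  then show ?thesis using TG.\<pi>_eq_iff[OF H.one_closed h] h by auto
qed

text \<open>The sections of \<open>E \<rightarrow> B\<close> have values in \<open>EG \<times> t(G)\<close> over the kernel of \<open>\<Phi>\<close>; a local section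
  of \<open>G \<rightarrow> G/G\<^sub>1 = t(G)\<close> moves them into \<open>EG \<times> {1}\<close>.\<close>

lemma kernel_section:
  "\<exists>W c. openin (gtop B) W \<and> \<one>\<^bsub>B\<^esub> \<in> W \<and> c \<one>\<^bsub>B\<^esub> = \<one>\<^bsub>E\<^esub> \<and>
     continuous_map (subtopology (gtop B) {b \<in> W. \<Phi> b = \<Phi> \<one>\<^bsub>B\<^esub>}) (gtop E) c \<and>
     (\<forall>b\<in>W. \<Phi> b = \<Phi> \<one>\<^bsub>B\<^esub> \<longrightarrow> c b \<in> carrier E \<and> snd (c b) = \<one>\<^bsub>H\<^esub> \<and> E.\<pi> (c b) = b)"
proof -
  interpret EB: bibundle G "gtop B" EB H t
    by (rule bibundle_locale[OF G.topological_group_axioms EB_bibundle])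
  have "\<one>\<^bsub>B\<^esub> \<in> topspace (gtop B)" by (simp add: B.topspace_gtop)
  then obtain U s \<gamma> where U1: "\<one>\<^bsub>B\<^esub> \<in> U" and tr: "trivialization G (gtop B) EB U s \<gamma>"
    using EB.trivialization_exists by blast
  have sc: "continuous_map (subtopology (gtop B) U) (gtop E) s"
    using EB.triv_section[OF tr] by (simp only: EB_simps)
  have sC: "s b \<in> carrier E" "E.\<pi> (s b) = b" if "b \<in> U" for b
    using EB.triv_section_closed[OF tr that] EB.triv_proj[OF tr that] E.topspace_gtop
    by (simp_all only: EB_simps)
  define K where "K = {b \<in> U. \<Phi> b = \<Phi> \<one>\<^bsub>B\<^esub>}"
  have K1: "\<one>\<^bsub>B\<^esub> \<in> K" using U1 by (simp add: K_def)
  have sK: "snd (s b) \<in> tG" if "b \<in> K" for b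
    using snd_in_tG[OF sC(1)] sC(2) that by (simp add: K_def)
  let ?k = "kernel G H t"
  let ?Q = "gtop (topquot G ?k)"
  define \<theta> where "\<theta> = (\<lambda>X. the_elem (t ` X))"
  have \<theta>: "homeomorphic_map ?Q (subtopology (gtop H) tG) \<theta>"
    unfolding \<theta>_def by (rule image_identification)
  \<comment> \<open>The inverse of the identification, a continuous map
    \<open>t(G) \<rightarrow> G/G\<^sub>1\<close>. Followed by the local section \<open>r\<close> it
    selects, continuously, an element of \<open>G\<close> with given image under
    \<open>t\<close>.\<close>
  obtain \<eta> where \<eta>h: "homeomorphic_map (subtopology (gtop H) tG) ?Q \<eta>"
    and \<eta>: "\<forall>h\<in>topspace (subtopology (gtop H) tG). \<eta> h \<in> topspace ?Q \<and> \<theta> (\<eta> h) = h"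
    using homeomorphic_map_inverse[OF \<theta>] by blast
  have topT: "topspace (subtopology (gtop H) tG) = tG" by (auto simp: H.topspace_gtop)
  have \<theta>k: "\<theta> (?k #>\<^bsub>G\<^esub> g) = t g" if g: "g \<in> carrier G" for g
    unfolding \<theta>_def
  proof (rule the_elem_image_const)
    show "g \<in> ?k #>\<^bsub>G\<^esub> g" using g by (auto simp: r_coset_def kernel_def intro!: bexI[of _ "\<one>\<^bsub>G\<^esub>"])
    show "t y = t g" if "y \<in> ?k #>\<^bsub>G\<^esub> g" for y
      using that g by (auto simp: r_coset_def kernel_def t_mult)
  qed
  have "\<eta> (snd (s \<one>\<^bsub>B\<^esub>)) \<in> topspace ?Q" using \<eta> sK[OF K1] topT by blast
  from bspec[OF G_local_sections[unfolded has_local_sections_def] this]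
  obtain V r where V: "openin ?Q V" "\<eta> (snd (s \<one>\<^bsub>B\<^esub>)) \<in> V"
    and rc: "continuous_map (subtopology ?Q V) (gtop G) r" and r: "\<forall>u\<in>V. ?k #>\<^bsub>G\<^esub> r u = u"
    by blast
  have VQ: "V \<subseteq> topspace ?Q" using V(1) by (rule openin_subset)
  have rC: "r u \<in> carrier G" if "u \<in> V" for u
    by (rule G.continuous_map_carrier[OF rc]) (use that VQ in auto)
  have "openin (subtopology (gtop H) tG) {h \<in> topspace (subtopology (gtop H) tG). \<eta> h \<in> V}"
    by (rule openin_continuous_map_preimage[OF homeomorphic_imp_continuous_map[OF \<eta>h] V(1)])
  \<comment> \<open>The set on which \<eta> is composable with \<open>r\<close> is open only in
    \<open>t(G)\<close>. It is extended to an open set of \<open>H\<close> in order to obtain an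
    open \<open>W\<close> in \<open>B\<close>; on the kernel of \<Phi> the two conditions
    coincide.\<close>
  then obtain S where S: "openin (gtop H) S" "{h \<in> tG. \<eta> h \<in> V} = S \<inter> tG"
    unfolding topT openin_subtopology by blast
  define W where "W = {b \<in> topspace (subtopology (gtop B) U). snd (s b) \<in> S}"
  have UB: "U \<subseteq> topspace (gtop B)" by (rule EB.triv_open(2)[OF tr])
  have W_eq: "W = {b \<in> U. snd (s b) \<in> S}" using UB by (auto simp: W_def)
  have sndE: "continuous_map (gtop E) (gtop H) snd" by (simp add: continuous_map_snd)
  have snds: "continuous_map (subtopology (gtop B) U) (gtop H) (\<lambda>b. snd (s b))"
    using continuous_map_compose[OF sc sndE] by (simp add: o_def)
  have W: "openin (gtop B) W"
    using openin_continuous_map_preimage[OF snds S(1)] EB.triv_open(1)[OF tr] openin_trans_full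
    unfolding W_def by blast
  let ?K = "{b \<in> W. \<Phi> b = \<Phi> \<one>\<^bsub>B\<^esub>}"
  have KW: "?K = {b \<in> K. \<eta> (snd (s b)) \<in> V}"
    using sK S(2) unfolding W_eq K_def by blast
  have one: "\<one>\<^bsub>B\<^esub> \<in> ?K" unfolding KW using K1 V(2) by simp
  define c0 where "c0 b = s b \<otimes>\<^bsub>E\<^esub> \<nu> (inv\<^bsub>G\<^esub> r (\<eta> (snd (s b))))" for b
  have c0: "c0 b \<in> carrier E" "snd (c0 b) = \<one>\<^bsub>H\<^esub>" "E.\<pi> (c0 b) = b" if b: "b \<in> ?K" for b
  proof -
    have bK: "b \<in> K" "\<eta> (snd (s b)) \<in> V" using b unfolding KW by auto
    then have bU: "b \<in> U" by (simp add: K_def)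
    let ?g = "r (\<eta> (snd (s b)))"
    have g: "?g \<in> carrier G" using rC bK by blast
    have tg: "t ?g = snd (s b)" using \<theta>k[OF g] r bK \<eta> sK topT by metis
    have gi: "inv\<^bsub>G\<^esub> ?g \<in> carrier G" using g by simp
    show "c0 b \<in> carrier E" unfolding c0_def by (rule E_closed[OF sC(1)[OF bU] \<nu>_closed[OF gi]])
    have "snd (s b) \<in> carrier H" using tg g by (metis t_closed)
    moreover have "snd (c0 b) = snd (s b) \<otimes>\<^bsub>H\<^esub> t (inv\<^bsub>G\<^esub> ?g)"
      unfolding c0_def by (cases "s b") (simp add: \<nu>_eq)
    ultimately show "snd (c0 b) = \<one>\<^bsub>H\<^esub>" using tg t_inv[OF g] by simp
    show "E.\<pi> (c0 b) = b" unfolding c0_def using \<pi>_ract[OF sC(1)[OF bU] gi] sC(2)[OF bU] by simp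
  qed
  have c0c: "continuous_map (subtopology (gtop B) ?K) (gtop E) c0"
    unfolding c0_def
  proof (intro E.continuous_map_multI)
    show "continuous_map (subtopology (gtop B) ?K) (gtop E) s"
      by (rule continuous_map_from_subtopology_mono[OF sc]) (auto simp: W_eq)
    have "continuous_map (subtopology (gtop B) ?K) (gtop H) (\<lambda>b. snd (s b))"
      by (rule continuous_map_from_subtopology_mono[OF snds]) (auto simp: W_eq)
    then have "continuous_map (subtopology (gtop B) ?K) (subtopology (gtop H) tG) (\<lambda>b. snd (s b))"
      unfolding continuous_map_in_subtopology using sK KW by auto
    from continuous_map_compose[OF this homeomorphic_imp_continuous_map[OF \<eta>h]]
    have "continuous_map (subtopology (gtop B) ?K) ?Q (\<lambda>b. \<eta> (snd (s b)))" by (simp add: o_def)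
    then have "continuous_map (subtopology (gtop B) ?K) (subtopology ?Q V) (\<lambda>b. \<eta> (snd (s b)))"
      unfolding continuous_map_in_subtopology using KW by auto
    from continuous_map_compose[OF this rc]
    have "continuous_map (subtopology (gtop B) ?K) (gtop G) (\<lambda>b. r (\<eta> (snd (s b))))" by (simp add: o_def)
    from continuous_map_compose[OF G.continuous_map_invI[OF this] \<nu>_continuous]
    show "continuous_map (subtopology (gtop B) ?K) (gtop E) (\<lambda>b. \<nu> (inv\<^bsub>G\<^esub> r (\<eta> (snd (s b)))))"
      by (simp add: o_def)
  qed
  let ?i = "inv\<^bsub>E\<^esub> c0 \<one>\<^bsub>B\<^esub>"
  have iC: "?i \<in> carrier E" using c0(1)[OF one] by (rule E.inv_closed)
  \<comment> \<open>Normalized to have the value \<open>1\<close> at \<open>1\<close>, so that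
    trivial increments lift to trivial factors. The constant factor lies over the unit of
    \<open>B\<close> and has \<open>H\<close>-component \<open>1\<close>, so the other two
    properties survive.\<close>
  define c where "c b = c0 b \<otimes>\<^bsub>E\<^esub> ?i" for b
  have sndi: "snd ?i = \<one>\<^bsub>H\<^esub>"
    using c0(1,2)[OF one] by (cases "c0 \<one>\<^bsub>B\<^esub>") (auto simp: E_inv)
  have "c b \<in> carrier E \<and> snd (c b) = \<one>\<^bsub>H\<^esub> \<and> E.\<pi> (c b) = b" if b: "b \<in> ?K" for b
  proof (intro conjI)
    note cb = c0[OF b]
    show "c b \<in> carrier E" unfolding c_def by (rule E_closed[OF cb(1) iC])
    have "snd (c b) = snd (c0 b) \<otimes>\<^bsub>H\<^esub> snd ?i" unfolding c_def by (cases "c0 b"; cases ?i) simp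
    then show "snd (c b) = \<one>\<^bsub>H\<^esub>" using cb(2) sndi by simp
    have "b \<in> carrier B" using cb(1,3) \<pi>_closed by metis
    have "E.\<pi> (c b) = b \<otimes>\<^bsub>B\<^esub> inv\<^bsub>B\<^esub> E.\<pi> (c0 \<one>\<^bsub>B\<^esub>)"
      unfolding c_def using \<pi>_mult[OF cb(1) iC] \<pi>_inv[OF c0(1)[OF one]] cb(3) by simp
    also have "\<dots> = b" using c0(3)[OF one] \<open>b \<in> carrier B\<close> by simp
    finally show "E.\<pi> (c b) = b" .
  qed
  moreover have "c \<one>\<^bsub>B\<^esub> = \<one>\<^bsub>E\<^esub>" unfolding c_def using c0(1)[OF one] by (rule E.r_inv)
  moreover have "continuous_map (subtopology (gtop B) ?K) (gtop E) c"
    unfolding c_def by (intro E.continuous_map_multI c0c) (use iC E.topspace_gtop in simp)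
  ultimately show ?thesis using W one by (intro exI[of _ W] exI[of _ c]) blast
qed

text \<open>A subdivision of the interval that is fine enough at all points of \<open>M\<close> need
  not exist, so its mesh \<delta> is a continuous positive function. The number of factors then
  jumps from point to point and may be unbounded; this is harmless because the section sends the
  unit to the unit, so all factors after time 1 are trivial.\<close>

lemma null_homotopic_lift:
  fixes M :: "'m topology"
  assumes M: "paracompact_space M"
    and hc: "continuous_map (prod_topology (top_of_set {0..1::real}) M) (gtop B) h"
    and h0: "\<And>m. m \<in> topspace M \<Longrightarrow> h (0, m) = \<one>\<^bsub>B\<^esub>"
    and h\<Phi>: "\<And>s m. s \<in> {0..1} \<Longrightarrow> m \<in> topspace M \<Longrightarrow> \<Phi> (h (s, m)) = \<Phi> \<one>\<^bsub>B\<^esub>"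
  shows "\<exists>x. continuous_map M (gtop E) x \<and>
    (\<forall>m\<in>topspace M. snd (x m) = \<one>\<^bsub>H\<^esub> \<and> E.\<pi> (x m) = h (1, m))"
proof -
  let ?I = "top_of_set {0..1::real}"
  obtain W c where W: "openin (gtop B) W" "\<one>\<^bsub>B\<^esub> \<in> W" and c1: "c \<one>\<^bsub>B\<^esub> = \<one>\<^bsub>E\<^esub>"
    and cc: "continuous_map (subtopology (gtop B) {b \<in> W. \<Phi> b = \<Phi> \<one>\<^bsub>B\<^esub>}) (gtop E) c"
    and c: "\<forall>b\<in>W. \<Phi> b = \<Phi> \<one>\<^bsub>B\<^esub> \<longrightarrow> c b \<in> carrier E \<and> snd (c b) = \<one>\<^bsub>H\<^esub> \<and> E.\<pi> (c b) = b"
    using kernel_section by blast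
  have hC: "h (s, m) \<in> carrier B" if "s \<in> {0..1}" "m \<in> topspace M" for s m
    by (rule B.continuous_map_carrier[OF hc]) (use that in simp)
  define D where "D s s' m = inv\<^bsub>B\<^esub> h (s, m) \<otimes>\<^bsub>B\<^esub> h (s', m)" for s s' m
  have D\<Phi>: "\<Phi> (D s s' m) = \<Phi> \<one>\<^bsub>B\<^esub>" if "s \<in> {0..1}" "s' \<in> {0..1}" "m \<in> topspace M" for s s' m
    unfolding D_def using hC h\<Phi> that by (intro \<Phi>_inv_mult) auto
  have D1: "D s s m = \<one>\<^bsub>B\<^esub>" if "s \<in> {0..1}" "m \<in> topspace M" for s m
    using hC[OF that] by (simp add: D_def)
  have Dc: "continuous_map X (gtop B) (\<lambda>x. D (a x) (a' x) (b x))"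
    if "continuous_map X ?I a" "continuous_map X ?I a'" "continuous_map X M b"
    for X :: "'z topology" and a a' b
    unfolding D_def
    using continuous_map_compose[OF continuous_map_pairedI[OF that(1,3)] hc]
      continuous_map_compose[OF continuous_map_pairedI[OF that(2,3)] hc]
    by (intro B.continuous_map_multI B.continuous_map_invI) (simp_all add: o_def)
  \<comment> \<open>A mesh \<open>d\<close> is admissible at \<open>m\<close> if any two times at
    distance at most \<open>d\<close> have an increment in \<open>W\<close>, the domain of the
    section. Asking it for all pairs of times makes the condition inherited by smaller
    meshes.\<close>
  define good where "good m d \<longleftrightarrow> (\<forall>s\<in>{0..1}. \<forall>s'\<in>{0..1}. \<bar>s - s'\<bar> \<le> d \<longrightarrow> D s s' m \<in> W)" for m and d :: real
  \<comment> \<open>On the diagonal the increments are the unit, which lies in \<open>W\<close>. So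
    each time has a neighbourhood that works for all points near \<open>m\<close>, and finitely many
    of these times suffice.\<close>
  have loc: "\<exists>U d. openin M U \<and> m \<in> U \<and> 0 < d \<and> (\<forall>y\<in>U. good y d)" if m: "m \<in> topspace M" for m
  proof -
    let ?Y = "prod_topology (prod_topology ?I ?I) M"
    have "continuous_map ?Y (gtop B) (\<lambda>z. D (fst (fst z)) (snd (fst z)) (snd z))"
      by (intro Dc continuous_map_snd continuous_map_compose[OF continuous_map_fst continuous_map_fst, unfolded o_def]
          continuous_map_compose[OF continuous_map_fst continuous_map_snd, unfolded o_def])
    from openin_continuous_map_preimage[OF this W(1)]
    have O: "openin ?Y {z \<in> topspace ?Y. D (fst (fst z)) (snd (fst z)) (snd z) \<in> W}" .
    have "\<exists>T U. open T \<and> s \<in> T \<and> openin M U \<and> m \<in> U \<and>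
        (\<forall>r\<in>T \<inter> {0..1}. \<forall>r'\<in>T \<inter> {0..1}. \<forall>y\<in>U. D r r' y \<in> W)" if s: "s \<in> {0..1}" for s
    proof -
      have "((s, s), m) \<in> {z \<in> topspace ?Y. D (fst (fst z)) (snd (fst z)) (snd z) \<in> W}"
        using s m D1 W(2) by simp
      then obtain A U where A: "openin (prod_topology ?I ?I) A" "openin M U" "(s, s) \<in> A" "m \<in> U"
        and AU: "A \<times> U \<subseteq> {z \<in> topspace ?Y. D (fst (fst z)) (snd (fst z)) (snd z) \<in> W}"
        using O unfolding openin_prod_topology_alt[of _ M] by meson
      then obtain A1 A2 where A12: "openin ?I A1" "openin ?I A2" "s \<in> A1" "s \<in> A2" "A1 \<times> A2 \<subseteq> A"
        unfolding openin_prod_topology_alt by meson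
      then have "openin ?I (A1 \<inter> A2)" by blast
      then obtain T where "open T" "A1 \<inter> A2 = {0..1} \<inter> T"
        unfolding openin_open by blast
      then have T: "open T" "A1 \<inter> A2 = T \<inter> {0..1}" by auto
      have "D r r' y \<in> W" if "r \<in> T \<inter> {0..1}" "r' \<in> T \<inter> {0..1}" "y \<in> U" for r r' y
      proof -
        have "((r, r'), y) \<in> A \<times> U" using that T(2) A12(5) by blast
        then show ?thesis using AU by auto
      qed
      then show ?thesis using T A A12 by blast
    qed
    then obtain T U where TU: "\<And>s. s \<in> {0..1} \<Longrightarrow> open (T s) \<and> s \<in> T s \<and> openin M (U s) \<and> m \<in> U s \<and>
        (\<forall>r\<in>T s \<inter> {0..1}. \<forall>r'\<in>T s \<inter> {0..1}. \<forall>y\<in>U s. D r r' y \<in> W)"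
      by metis
    obtain S where S: "S \<subseteq> {0..1}" "finite S" "{0..1::real} \<subseteq> (\<Union>s\<in>S. T s)"
      by (rule compactE_image[OF compact_Icc, of "{0..1}" T 0 1]) (use TU in blast)+
    \<comment> \<open>A Lebesgue number of the finite cover; half of it is an admissible mesh, as
      two times at distance at most \<open>e / 2\<close> lie in a common open ball of radius
      \<open>e\<close>.\<close>
    have "\<exists>e>0. \<forall>x\<in>{0..1::real}. \<exists>G\<in>T ` S. ball x e \<subseteq> G"
    proof (rule Heine_Borel_lemma[of "{0..1::real}" "T ` S"])
      show "compact {0..1::real}" by (rule compact_Icc)
      show "{0..1} \<subseteq> \<Union> (T ` S)" by (rule S(3))
      show "open G" if "G \<in> T ` S" for G using that TU S(1) by auto
    qed blast
    then obtain e where e: "0 < e" "\<forall>x\<in>{0..1::real}. \<exists>G\<in>T ` S. ball x e \<subseteq> G" by blast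
    let ?U = "(\<Inter>s\<in>S. U s) \<inter> topspace M"
    have "openin M ?U"
      using S TU by (intro openin_INT) auto
    moreover have "m \<in> ?U" using m S TU by auto
    moreover have "good y (e / 2)" if y: "y \<in> ?U" for y
      unfolding good_def
    proof (intro ballI impI)
      fix s s' :: real assume s: "s \<in> {0..1}" "s' \<in> {0..1}" "\<bar>s - s'\<bar> \<le> e / 2"
      obtain r where r: "r \<in> S" "ball s e \<subseteq> T r" using e(2) s(1) by blast
      have "s \<in> T r" "s' \<in> T r" using r(2) s e(1) by (auto simp: subset_iff dist_real_def)
      then show "D s s' y \<in> W" using TU[of r] r S s y by blast
    qed
    ultimately show ?thesis using e(1) by (intro exI[of _ ?U] exI[of _ "e / 2"]) auto
  qed
  have down: "good m d'" if "good m d" "0 < d'" "d' \<le> d" for m d d'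
    using that unfolding good_def by fastforce
  have "\<exists>\<delta>. continuous_map M euclideanreal \<delta> \<and> (\<forall>m\<in>topspace M. 0 < \<delta> m \<and> good m (\<delta> m))"
  proof (rule paracompact_continuous_choice[where good=good, OF M])
    show "\<exists>U d. openin M U \<and> m \<in> U \<and> 0 < d \<and> (\<forall>y\<in>U. good y d)" if "m \<in> topspace M" for m
      by (rule loc[OF that])
    show "good m d'" if "good m d" "0 < d'" "d' \<le> d" for m d d' by (rule down[OF that])
  qed blast
  then obtain \<delta> where \<delta>c: "continuous_map M euclideanreal \<delta>"
    and \<delta>': "\<forall>m\<in>topspace M. 0 < \<delta> m \<and> good m (\<delta> m)"
    by blast
  note \<delta> = bspec[OF \<delta>']
  \<comment> \<open>Subdivision points at multiples of the mesh, cut off at 1: continuous in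
    \<open>m\<close>, and for each \<open>m\<close> equal to 1 from some index on.\<close>
  define \<sigma> where "\<sigma> n m = min 1 (real n * \<delta> m)" for n m
  have \<sigma>I: "\<sigma> n m \<in> {0..1}" if "m \<in> topspace M" for n m
    using \<delta>[OF that] by (simp add: \<sigma>_def)
  have \<sigma>c: "continuous_map M ?I (\<sigma> n)" for n
    unfolding continuous_map_in_subtopology
  proof
    show "continuous_map M euclideanreal (\<sigma> n)"
      unfolding \<sigma>_def[abs_def] by (intro continuous_map_real_min continuous_map_real_mult_left \<delta>c) simp
  qed (use \<sigma>I in auto)
  define \<Delta> where "\<Delta> n m = D (\<sigma> n m) (\<sigma> (Suc n) m) m" for n m
  have \<Delta>W: "\<Delta> n m \<in> W" "\<Phi> (\<Delta> n m) = \<Phi> \<one>\<^bsub>B\<^esub>" if m: "m \<in> topspace M" for n m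
  proof -
    have "\<bar>\<sigma> n m - \<sigma> (Suc n) m\<bar> \<le> \<delta> m"
      using \<delta>[OF m] unfolding \<sigma>_def by (auto simp: algebra_simps min_def abs_if)
    then show "\<Delta> n m \<in> W" using \<delta>[OF m] \<sigma>I[OF m] unfolding good_def \<Delta>_def by blast
    show "\<Phi> (\<Delta> n m) = \<Phi> \<one>\<^bsub>B\<^esub>" unfolding \<Delta>_def by (rule D\<Phi>[OF \<sigma>I[OF m] \<sigma>I[OF m] m])
  qed
  have c\<Delta>: "c (\<Delta> n m) \<in> carrier E" "snd (c (\<Delta> n m)) = \<one>\<^bsub>H\<^esub>" "E.\<pi> (c (\<Delta> n m)) = \<Delta> n m"
    if m: "m \<in> topspace M" for n m
    using bspec[OF c \<Delta>W(1)[OF m, of n]] \<Delta>W(2)[OF m, of n] by blast+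
  have c\<Delta>c: "continuous_map M (gtop E) (\<lambda>m. c (\<Delta> n m))" for n
  proof -
    have "continuous_map M (gtop B) (\<Delta> n)"
      unfolding \<Delta>_def[abs_def] by (intro Dc \<sigma>c continuous_map_id[unfolded id_def])
    then have "continuous_map M (subtopology (gtop B) {b \<in> W. \<Phi> b = \<Phi> \<one>\<^bsub>B\<^esub>}) (\<Delta> n)"
      unfolding continuous_map_in_subtopology using \<Delta>W by auto
    from continuous_map_compose[OF this cc] show ?thesis by (simp add: o_def)
  qed
  define y where "y = rec_nat (\<lambda>m. \<one>\<^bsub>E\<^esub>) (\<lambda>n x m. x m \<otimes>\<^bsub>E\<^esub> c (\<Delta> n m))"
  have y0: "y 0 = (\<lambda>m. \<one>\<^bsub>E\<^esub>)" and ySuc: "y (Suc n) = (\<lambda>m. y n m \<otimes>\<^bsub>E\<^esub> c (\<Delta> n m))" for n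
    by (simp_all add: y_def)
  have yc: "continuous_map M (gtop E) (y n)" for n
  proof (induction n)
    case 0
    have "\<one>\<^bsub>E\<^esub> \<in> topspace (gtop E)" using E.topspace_gtop by simp
    then show ?case unfolding y0 by simp
  next
    case (Suc n)
    then show ?case unfolding ySuc by (intro E.continuous_map_multI c\<Delta>c)
  qed
  have y: "y n m \<in> carrier E \<and> snd (y n m) = \<one>\<^bsub>H\<^esub> \<and> E.\<pi> (y n m) = h (\<sigma> n m, m)"
    if m: "m \<in> topspace M" for n m
  proof (induction n)
    case 0
    show ?case using h0[OF m] \<pi>_one by (simp add: y0 \<sigma>_def)
  next
    case (Suc n)
    note cD = c\<Delta>[OF m, of n]
    have "snd (y (Suc n) m) = snd (y n m) \<otimes>\<^bsub>H\<^esub> snd (c (\<Delta> n m))"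
      unfolding ySuc by (cases "y n m"; cases "c (\<Delta> n m)") simp
    then have 1: "snd (y (Suc n) m) = \<one>\<^bsub>H\<^esub>" using Suc cD by simp
    have 2: "y (Suc n) m \<in> carrier E" unfolding ySuc using Suc cD by (intro E_closed) auto
    have "E.\<pi> (y (Suc n) m) = E.\<pi> (y n m) \<otimes>\<^bsub>B\<^esub> E.\<pi> (c (\<Delta> n m))"
      unfolding ySuc using Suc cD by (intro \<pi>_mult[symmetric]) auto
    also have "\<dots> = h (\<sigma> n m, m) \<otimes>\<^bsub>B\<^esub> \<Delta> n m" using Suc cD by simp
    also have "\<dots> = h (\<sigma> (Suc n) m, m)"
      unfolding \<Delta>_def D_def using hC[OF \<sigma>I[OF m] m] by (simp add: B.m_assoc[symmetric])
    finally show ?case using 1 2 by blast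
  qed
  have stable: "y k m = y n m" if m: "m \<in> topspace M" and n: "1 \<le> real n * \<delta> m" and nk: "n \<le> k" for k n m
    using nk
  proof (induction k rule: dec_induct)
    case (step k)
    have "real n * \<delta> m \<le> real k * \<delta> m" using step \<delta>[OF m] by (intro mult_right_mono) auto
    moreover have "real k * \<delta> m \<le> real (Suc k) * \<delta> m" using \<delta>[OF m] by (intro mult_right_mono) auto
    ultimately have "\<sigma> k m = 1" "\<sigma> (Suc k) m = 1" using n by (simp_all add: \<sigma>_def)
    then have "c (\<Delta> k m) = \<one>\<^bsub>E\<^esub>" unfolding \<Delta>_def using D1[of 1 m] m c1 by simp
    then show ?case using step y[OF m, of k] by (simp add: ySuc del: E_one E_carrier)
  qed simp
  \<comment> \<open>Enough steps to reach time 1. \<open>N\<close> is not continuous, but by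
    \<open>stable\<close> any larger number of steps gives the same product.\<close>
  define N where "N m = nat \<lceil>1 / \<delta> m\<rceil>" for m
  have N: "1 \<le> real (N m) * \<delta> m" if m: "m \<in> topspace M" for m
  proof -
    have "1 / \<delta> m \<le> real (N m)" unfolding N_def by (rule real_nat_ceiling_ge)
    then show ?thesis using \<delta>[OF m] by (simp add: divide_le_eq)
  qed
  define x where "x m = y (N m) m" for m
  have "continuous_map M (gtop E) x"
  proof (rule continuous_map_locally)
    fix m assume m: "m \<in> topspace M"
    \<comment> \<open>Where \<delta> exceeds half its value at \<open>m\<close>, this many steps
      reach time 1. So near \<open>m\<close> the lift coincides with a single finite product, which
      is continuous.\<close>
    let ?n = "nat \<lceil>2 / \<delta> m\<rceil>" and ?U = "{u \<in> topspace M. \<delta> u \<in> {\<delta> m / 2<..}}"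
    have "openin M ?U" by (rule openin_continuous_map_preimage[OF \<delta>c]) simp
    moreover have "m \<in> ?U" using m \<delta>[OF m] by simp
    moreover have "x u = y ?n u" if u: "u \<in> ?U" for u
    proof -
      have uM: "u \<in> topspace M" using u by simp
      have "1 \<le> 2 / \<delta> m * \<delta> u" using u \<delta>[OF m] by (simp add: field_simps)
      also have "\<dots> \<le> real ?n * \<delta> u"
        using \<delta>[OF uM] real_nat_ceiling_ge by (intro mult_right_mono) auto
      finally have n: "1 \<le> real ?n * \<delta> u" .
      have "y (max ?n (N u)) u = y ?n u" by (rule stable[OF uM n]) simp
      moreover have "y (max ?n (N u)) u = y (N u) u" by (rule stable[OF uM N[OF uM]]) simp
      ultimately show ?thesis by (simp add: x_def)
    qed
    ultimately show "\<exists>U g. openin M U \<and> m \<in> U \<and> continuous_map (subtopology M U) (gtop E) g \<and>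
        (\<forall>y\<in>U. x y = g y)"
      using continuous_map_from_subtopology[OF yc] by blast
  qed
  moreover have "snd (x m) = \<one>\<^bsub>H\<^esub> \<and> E.\<pi> (x m) = h (1, m)" if m: "m \<in> topspace M" for m
    using y[OF m, of "N m"] N[OF m] by (simp add: x_def \<sigma>_def)
  ultimately show ?thesis by blast
qed

section \<open>Trivial pullbacks and null homotopies\<close>

text \<open>An equivariant map on the trivial bundle \<open>M \<times> G\<close> is determined by
  its values at \<open>(m, 1)\<close>, and any lift \<open>x\<close> extends by
  \<open>x(m) \<nu>(g)\<close>. The structure map of the trivial bibundle is \<open>t\<close>, with
  \<open>t 1 = 1\<close>, so the \<open>H\<close>-component of the lift must be
  \<open>1\<close>.\<close>

lemma unit_iso_iff:
  assumes K: "continuous_map M (gtop B) K"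
  shows "bibundle_iso G (unit_bibundle G t M) (pull M K) \<longleftrightarrow>
    (\<exists>x. continuous_map M (gtop E) x \<and> (\<forall>m\<in>topspace M. snd (x m) = \<one>\<^bsub>H\<^esub> \<and> E.\<pi> (x m) = K m))"
proof
  let ?I = "unit_bibundle G t M"
  have I: "total ?I = prod_topology M (gtop G)" "proj ?I = fst"
    "ract ?I = (\<lambda>(m, x) g. (m, x \<otimes>\<^bsub>G\<^esub> g))" "str ?I = (\<lambda>(m, x). t x)"
    by (simp_all add: unit_bibundle_def)
  have bI: "is_bibundle H G t M ?I"
    by (rule unit_bibundle[OF G.topological_group_axioms H.topological_group_axioms t_hom t_continuous])
  {
    assume "bibundle_iso G ?I (pull M K)"
    then obtain a where a: "classifies M ?I K a" using iso_pullE[OF bI] by blast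
    have "continuous_map M (total ?I) (\<lambda>m. (m, \<one>\<^bsub>G\<^esub>))"
      unfolding I by (intro continuous_map_pairedI continuous_map_id[unfolded id_def]) (simp add: G.topspace_gtop)
    then have "continuous_map M (gtop E) (\<lambda>m. a (m, \<one>\<^bsub>G\<^esub>))"
      using a continuous_map_compose unfolding classifies_def by (fastforce simp: o_def)
    moreover have "snd (a (m, \<one>\<^bsub>G\<^esub>)) = \<one>\<^bsub>H\<^esub> \<and> E.\<pi> (a (m, \<one>\<^bsub>G\<^esub>)) = K m" if "m \<in> topspace M" for m
    proof -
      have "(m, \<one>\<^bsub>G\<^esub>) \<in> topspace (total ?I)" using that by (simp add: I G.topspace_gtop)
      then show ?thesis using a unfolding classifies_def by (simp add: I)
    qed
    ultimately show "\<exists>x. continuous_map M (gtop E) x \<and>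
        (\<forall>m\<in>topspace M. snd (x m) = \<one>\<^bsub>H\<^esub> \<and> E.\<pi> (x m) = K m)"
      by (intro exI[of _ "\<lambda>m. a (m, \<one>\<^bsub>G\<^esub>)"]) blast
  next
    assume "\<exists>x. continuous_map M (gtop E) x \<and>
        (\<forall>m\<in>topspace M. snd (x m) = \<one>\<^bsub>H\<^esub> \<and> E.\<pi> (x m) = K m)"
    then obtain x where xc: "continuous_map M (gtop E) x"
      and x: "\<And>m. m \<in> topspace M \<Longrightarrow> snd (x m) = \<one>\<^bsub>H\<^esub> \<and> E.\<pi> (x m) = K m" by blast
    have xC: "x m \<in> carrier E" if "m \<in> topspace M" for m by (rule E.continuous_map_carrier[OF xc that])
    have "classifies M ?I K (\<lambda>(m, g). x m \<otimes>\<^bsub>E\<^esub> \<nu> g)"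
      unfolding classifies_def
    proof (intro conjI ballI)
      show "continuous_map (total ?I) (gtop E) (\<lambda>(m, g). x m \<otimes>\<^bsub>E\<^esub> \<nu> g)"
        unfolding I case_prod_unfold
        by (intro E.continuous_map_multI continuous_map_compose[OF continuous_map_fst xc, unfolded o_def]
            continuous_map_compose[OF continuous_map_snd \<nu>_continuous, unfolded o_def])
      fix p assume "p \<in> topspace (total ?I)"
      then obtain m g where p: "p = (m, g)" "m \<in> topspace M" "g \<in> carrier G"
        by (cases p) (simp add: I G.topspace_gtop)
      show "E.\<pi> ((\<lambda>(m, g). x m \<otimes>\<^bsub>E\<^esub> \<nu> g) p) = K (proj ?I p)"
        using \<pi>_ract[OF xC[OF p(2)] p(3)] x[OF p(2)] by (simp add: p I)
      have "snd (x m \<otimes>\<^bsub>E\<^esub> \<nu> g) = snd (x m) \<otimes>\<^bsub>H\<^esub> t g" by (cases "x m") (simp add: \<nu>_eq)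
      then show "snd ((\<lambda>(m, g). x m \<otimes>\<^bsub>E\<^esub> \<nu> g) p) = str ?I p"
        using x[OF p(2)] p by (simp add: I)
      fix g' assume g': "g' \<in> carrier G"
      show "(\<lambda>(m, g). x m \<otimes>\<^bsub>E\<^esub> \<nu> g) (ract ?I p g') = (\<lambda>(m, g). x m \<otimes>\<^bsub>E\<^esub> \<nu> g) p \<otimes>\<^bsub>E\<^esub> \<nu> g'"
        using xC[OF p(2)] p(3) g' by (simp add: p I \<nu>_mult E.m_assoc del: E_carrier E_mult)
    qed
    then show "bibundle_iso G ?I (pull M K)" by (rule iso_pullI[OF bI K])
  }
qed

lemma \<Phi>_one_type: "e \<in> carrier EG \<Longrightarrow> \<Phi> (E.\<pi> (e, \<one>\<^bsub>H\<^esub>)) = \<Phi> \<one>\<^bsub>B\<^esub>"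
  using \<Phi>_\<pi>[of "(e, \<one>\<^bsub>H\<^esub>)"] \<Phi>_\<pi>[of "\<one>\<^bsub>E\<^esub>"] \<pi>_one by simp

text \<open>A contraction of \<open>EG\<close> ends at some point \<open>a\<close>, not necessarily
  at the unit. Therefore both the lift and the constant \<open>1\<close> are contracted to
  \<open>a\<close> and the two homotopies are joined. The second component stays \<open>1\<close>
  throughout, which keeps them in one fibre of \<Phi>.\<close>

lemma lift_imp_null_homotopic:
  assumes xc: "continuous_map M (gtop E) x"
    and x: "\<And>m. m \<in> topspace M \<Longrightarrow> snd (x m) = \<one>\<^bsub>H\<^esub> \<and> E.\<pi> (x m) = K m"
  shows "homotopic_with (\<lambda>F. \<forall>m\<in>topspace M. \<Phi> (F m) = \<Phi> \<one>\<^bsub>B\<^esub>) M (gtop B) K (\<lambda>m. \<one>\<^bsub>B\<^esub>)"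
proof -
  let ?P = "\<lambda>F. \<forall>m\<in>topspace M. \<Phi> (F m) = \<Phi> \<one>\<^bsub>B\<^esub>"
  let ?I = "top_of_set {0..1::real}"
  obtain c a where c: "continuous_map (prod_topology ?I (gtop EG)) (gtop EG) c"
    and a: "a \<in> carrier EG" and c0: "\<And>e. e \<in> carrier EG \<Longrightarrow> c (0, e) = e"
    and c1: "\<And>e. e \<in> carrier EG \<Longrightarrow> c (1, e) = a"
    using EG.contractible_contraction[OF EG_contractible] by blast
  have contract: "homotopic_with ?P M (gtop B) (\<lambda>m. E.\<pi> (e m, \<one>\<^bsub>H\<^esub>)) (\<lambda>m. E.\<pi> (a, \<one>\<^bsub>H\<^esub>))"
    if e: "continuous_map M (gtop EG) e" for e
  proof (subst homotopic_with)
    show "?P h = ?P k" if "\<And>x. x \<in> topspace M \<Longrightarrow> h x = k x" for h k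
      using that by simp
    let ?h = "\<lambda>z. E.\<pi> (c (fst z, e (snd z)), \<one>\<^bsub>H\<^esub>)"
    have eC: "e m \<in> carrier EG" if "m \<in> topspace M" for m by (rule EG.continuous_map_carrier[OF e that])
    have cc: "continuous_map (prod_topology ?I M) (gtop EG) (\<lambda>z. c (fst z, e (snd z)))"
      using continuous_map_compose[OF continuous_map_pairedI[OF continuous_map_fst
            continuous_map_compose[OF continuous_map_snd e, unfolded o_def]] c]
      by (simp add: o_def)
    then have "continuous_map (prod_topology ?I M) (gtop E) (\<lambda>z. (c (fst z, e (snd z)), \<one>\<^bsub>H\<^esub>))"
      unfolding E_gtop by (intro continuous_map_pairedI) (auto simp: H.topspace_gtop)
    from continuous_map_compose[OF this \<pi>_continuous]
    have "continuous_map (prod_topology ?I M) (gtop B) ?h" by (simp add: o_def)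
    moreover have "\<Phi> (?h (s, m)) = \<Phi> \<one>\<^bsub>B\<^esub>" if "s \<in> {0..1}" "m \<in> topspace M" for s m
    proof -
      have "c (s, e m) \<in> carrier EG"
        using EG.continuous_map_carrier[OF cc, of "(s, m)"] that by simp
      then show ?thesis by (simp add: \<Phi>_one_type)
    qed
    ultimately show "\<exists>h. continuous_map (prod_topology ?I M) (gtop B) h \<and>
        (\<forall>m\<in>topspace M. h (0, m) = E.\<pi> (e m, \<one>\<^bsub>H\<^esub>)) \<and>
        (\<forall>m\<in>topspace M. h (1, m) = E.\<pi> (a, \<one>\<^bsub>H\<^esub>)) \<and> (\<forall>s\<in>{0..1}. ?P (\<lambda>m. h (s, m)))"
      using eC c0 c1 by (intro exI[of _ ?h]) simp
  qed
  have "continuous_map M (gtop EG) (\<lambda>m. fst (x m))"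
    using continuous_map_compose[OF xc, of "gtop EG" fst] by (simp add: continuous_map_fst o_def)
  from contract[OF this]
  have 1: "homotopic_with ?P M (gtop B) (\<lambda>m. E.\<pi> (fst (x m), \<one>\<^bsub>H\<^esub>)) (\<lambda>m. E.\<pi> (a, \<one>\<^bsub>H\<^esub>))" .
  have Kx: "K m = E.\<pi> (fst (x m), \<one>\<^bsub>H\<^esub>)" if "m \<in> topspace M" for m
    using x[OF that] by (metis prod.collapse)
  have "continuous_map M (gtop EG) (\<lambda>m. \<one>\<^bsub>EG\<^esub>)" by (simp add: EG.topspace_gtop)
  from contract[OF this]
  have 2: "homotopic_with ?P M (gtop B) (\<lambda>m. \<one>\<^bsub>B\<^esub>) (\<lambda>m. E.\<pi> (a, \<one>\<^bsub>H\<^esub>))"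
    using \<pi>_one by simp
  \<comment> \<open>\<open>K\<close> and the projected lift agree only on the points of
    \<open>M\<close>, whereas \<open>homotopic_with\<close> fixes the end maps on the whole type; a
    constant homotopy bridges the difference.\<close>
  have 3: "homotopic_with ?P M (gtop B) (\<lambda>m. E.\<pi> (fst (x m), \<one>\<^bsub>H\<^esub>)) K"
    using homotopic_with_imp_continuous_maps[OF 1] homotopic_with_imp_property[OF 1] Kx
    by (intro homotopic_with_equal) auto
  show ?thesis
    using homotopic_with_trans[OF homotopic_with_trans[OF homotopic_with_symD[OF 3] 1] homotopic_with_symD[OF 2]] .
qed

end

section \<open>The classification theorem\<close>

text \<open>The form in which the group structures are established: \<open>C\<close> stands for the set of maps
  \<open>M \<rightarrow> B(H,G)\<close>, which with functions on a type is a group only up to the values outside \<open>M\<close>.\<close>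

lemma group_of_image:
  fixes A :: "('b, 'x) monoid_scheme" and f :: "'a \<Rightarrow> 'b"
  assumes carrier: "carrier A = f ` C"
    and mult: "\<And>a b. a \<in> C \<Longrightarrow> b \<in> C \<Longrightarrow> f a \<otimes>\<^bsub>A\<^esub> f b = f (m a b)"
    and one: "\<one>\<^bsub>A\<^esub> = f e"
    and closed: "\<And>a b. a \<in> C \<Longrightarrow> b \<in> C \<Longrightarrow> m a b \<in> C" "e \<in> C"
    and assoc: "\<And>a b c. a \<in> C \<Longrightarrow> b \<in> C \<Longrightarrow> c \<in> C \<Longrightarrow> f (m (m a b) c) = f (m a (m b c))"
    and unit: "\<And>a. a \<in> C \<Longrightarrow> f (m e a) = f a"
    and inv: "\<And>a. a \<in> C \<Longrightarrow> \<exists>b\<in>C. f (m b a) = f e"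
  shows "group A"
proof (rule groupI)
  fix x y z assume "x \<in> carrier A" "y \<in> carrier A" "z \<in> carrier A"
  then obtain a b c where "x = f a" "a \<in> C" "y = f b" "b \<in> C" "z = f c" "c \<in> C"
    unfolding carrier by blast
  then show "x \<otimes>\<^bsub>A\<^esub> y \<otimes>\<^bsub>A\<^esub> z = x \<otimes>\<^bsub>A\<^esub> (y \<otimes>\<^bsub>A\<^esub> z)" by (simp add: mult closed assoc)
next
  fix x y assume "x \<in> carrier A" "y \<in> carrier A"
  then show "x \<otimes>\<^bsub>A\<^esub> y \<in> carrier A" unfolding carrier using mult closed by auto
next
  fix x assume "x \<in> carrier A"
  then obtain a where a: "x = f a" "a \<in> C" unfolding carrier by blast
  then show "\<one>\<^bsub>A\<^esub> \<otimes>\<^bsub>A\<^esub> x = x" by (simp add: one mult closed unit)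
  obtain b where "b \<in> C" "f (m b a) = f e" using inv a by blast
  then show "\<exists>y\<in>carrier A. y \<otimes>\<^bsub>A\<^esub> x = \<one>\<^bsub>A\<^esub>"
    using a by (intro bexI[of _ "f b"]) (simp_all add: carrier mult one)
qed (use carrier one closed in auto)

text \<open>Both groups are images of \<open>C\<close> under maps that identify the same elements
  and respect the same product, so choosing a preimage gives the isomorphism. It goes from
  \<open>A'\<close> to \<open>A\<close>, because it is the inverse, from \<open>A\<close> to
  \<open>A'\<close>, that has to be described on \<open>C\<close>.\<close>

lemma iso_of_images:
  fixes A :: "('b, 'x) monoid_scheme" and A' :: "('c, 'y) monoid_scheme"
    and f :: "'a \<Rightarrow> 'b" and f' :: "'a \<Rightarrow> 'c"
  assumes A: "carrier A = f ` C" "\<And>a b. a \<in> C \<Longrightarrow> b \<in> C \<Longrightarrow> f a \<otimes>\<^bsub>A\<^esub> f b = f (m a b)"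
    and A': "carrier A' = f' ` C" "\<And>a b. a \<in> C \<Longrightarrow> b \<in> C \<Longrightarrow> f' a \<otimes>\<^bsub>A'\<^esub> f' b = f' (m a b)"
    and closed: "\<And>a b. a \<in> C \<Longrightarrow> b \<in> C \<Longrightarrow> m a b \<in> C"
    and eq: "\<And>a b. a \<in> C \<Longrightarrow> b \<in> C \<Longrightarrow> f a = f b \<longleftrightarrow> f' a = f' b"
  shows "\<exists>\<theta>\<in>iso A' A. \<forall>a\<in>C. inv_into (carrier A') \<theta> (f a) = f' a"
proof -
  define \<theta> where "\<theta> X = f (SOME a. a \<in> C \<and> f' a = X)" for X
  have \<theta>: "\<theta> (f' a) = f a" if "a \<in> C" for a
  proof -
    have "(SOME b. b \<in> C \<and> f' b = f' a) \<in> C \<and> f' (SOME b. b \<in> C \<and> f' b = f' a) = f' a"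
      using that by (intro someI[where P="\<lambda>b. b \<in> C \<and> f' b = f' a"]) simp
    then show ?thesis unfolding \<theta>_def using eq that by blast
  qed
  have inj: "inj_on \<theta> (carrier A')"
    unfolding A'(1) by (rule inj_onI) (use \<theta> eq in auto)
  have "\<theta> \<in> hom A' A"
    using \<theta> A A' closed by (auto simp: hom_def)
  moreover have "bij_betw \<theta> (carrier A') (carrier A)"
    using inj \<theta> unfolding bij_betw_def A(1) A'(1) by force
  ultimately have "\<theta> \<in> iso A' A" by (simp add: iso_def)
  moreover have "inv_into (carrier A') \<theta> (f a) = f' a" if "a \<in> C" for a
    using inv_into_f_f[OF inj, of "f' a"] that \<theta> A'(1) by simp
  ultimately show ?thesis by blast
qed

context bibundle_model
begin

context
  fixes M :: "'m topology" and j :: "'m \<times> 'g \<Rightarrow> 'p"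
  assumes M: "paracompact_space M" and j: "inj_on j (topspace M \<times> carrier G)"
begin

abbreviation maps where "maps \<equiv> {F. continuous_map M (gtop B) F}"
abbreviation mprod where "mprod F F' \<equiv> (\<lambda>m. F m \<otimes>\<^bsub>B\<^esub> F' m)"
abbreviation hc where "hc \<equiv> homotopy_class_over \<Phi> M (gtop B)"
abbreviation homo where "homo \<equiv> homotopic_over \<Phi> M (gtop B)"
definition \<Psi> :: "('m \<Rightarrow> ('e \<times> 'h) set) \<Rightarrow> ('p, 'm, 'g, 'h) bibundle set" where
  "\<Psi> F = bibundle_class H G t M (pull M F)"

lemma homo_eqI:
  assumes "F \<in> maps" "\<And>m. m \<in> topspace M \<Longrightarrow> F m = F' m"
  shows "homo F F'"
  unfolding homotopic_over_def
proof (rule homotopic_with_equal)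
  show "\<forall>m\<in>topspace M. \<Phi> (F' m) = \<Phi> (F m)" using assms(2) by simp
  show "continuous_map M (gtop B) F" using assms(1) by simp
  show "F m = F' m" if "m \<in> topspace M" for m by (rule assms(2)[OF that])
qed simp

lemma homo_imp:
  assumes "homo F F'"
  shows "F \<in> maps" "F' \<in> maps" "\<And>m. m \<in> topspace M \<Longrightarrow> \<Phi> (F' m) = \<Phi> (F m)"
  using homotopic_with_imp_continuous_maps[OF assms[unfolded homotopic_over_def]]
    homotopic_with_imp_property[OF assms[unfolded homotopic_over_def]] by simp_all

text \<open>The relation \<open>homotopic_over\<close> measures \<Phi> against its first map.
  Homotopic maps have the same composite with \<Phi>, so the predicate can be moved from one to the
  other; this makes symmetry and transitivity available.\<close>

lemma homo_pred_cong:
  assumes "homo F F'"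
  shows "(\<lambda>K. \<forall>m\<in>topspace M. \<Phi> (K m) = \<Phi> (F' m)) = (\<lambda>K. \<forall>m\<in>topspace M. \<Phi> (K m) = \<Phi> (F m))"
  using homo_imp(3)[OF assms] by (intro ext) simp

lemma homo_sym: assumes "homo F F'" shows "homo F' F"
  unfolding homotopic_over_def homo_pred_cong[OF assms]
  by (rule homotopic_with_symD[OF assms[unfolded homotopic_over_def]])

lemma homo_trans: assumes "homo F F'" "homo F' F''" shows "homo F F''"
  unfolding homotopic_over_def
  by (rule homotopic_with_trans[OF assms(1)[unfolded homotopic_over_def]
        assms(2)[unfolded homotopic_over_def homo_pred_cong[OF assms(1)]]])

lemma hc_eq_iff:
  assumes "F' \<in> maps" shows "hc F = hc F' \<longleftrightarrow> homo F F'"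
proof
  assume eq: "hc F = hc F'"
  have "F' \<in> hc F" unfolding eq using homo_eqI[OF assms refl] by (simp add: homotopy_class_over_def)
  then show "homo F F'" by (simp add: homotopy_class_over_def)
next
  assume h: "homo F F'"
  show "hc F = hc F'"
    unfolding homotopy_class_over_def using homo_trans[OF h] homo_trans[OF homo_sym[OF h]] by blast
qed

lemma mprod_closed: "F \<in> maps \<Longrightarrow> F' \<in> maps \<Longrightarrow> mprod F F' \<in> maps"
  by (simp add: B.continuous_map_multI)

lemma maps_carrier: "F \<in> maps \<Longrightarrow> m \<in> topspace M \<Longrightarrow> F m \<in> carrier B"
  by (rule B.continuous_map_carrier[of M]) simp_all

text \<open>\<Phi> is multiplicative, so the pointwise product of two homotopies over
  \<open>H/t(G)\<close> is again one.\<close>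

lemma homo_mprod:
  assumes "homo F F'" "homo K K'"
  shows "homo (mprod F K) (mprod F' K')"
proof -
  let ?I = "top_of_set {0..1::real}"
  from assms(1)[unfolded homotopic_over_def homotopic_with_def]
  obtain f where f: "continuous_map (prod_topology ?I M) (gtop B) f" "\<forall>x. f (0, x) = F x" "\<forall>x. f (1, x) = F' x"
      "\<forall>s\<in>{0..1}. \<forall>m\<in>topspace M. \<Phi> (f (s, m)) = \<Phi> (F m)"
    by (elim exE conjE)
  from assms(2)[unfolded homotopic_over_def homotopic_with_def]
  obtain k where k: "continuous_map (prod_topology ?I M) (gtop B) k" "\<forall>x. k (0, x) = K x" "\<forall>x. k (1, x) = K' x"
      "\<forall>s\<in>{0..1}. \<forall>m\<in>topspace M. \<Phi> (k (s, m)) = \<Phi> (K m)"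
    by (elim exE conjE)
  have "\<Phi> (f (s, m) \<otimes>\<^bsub>B\<^esub> k (s, m)) = \<Phi> (F m \<otimes>\<^bsub>B\<^esub> K m)" if "s \<in> {0..1}" "m \<in> topspace M" for s m
  proof -
    have C: "f (s, m) \<in> carrier B" "k (s, m) \<in> carrier B"
      using B.continuous_map_carrier[OF f(1), of "(s, m)"] B.continuous_map_carrier[OF k(1), of "(s, m)"] that
      by auto
    have C': "F m \<in> carrier B" "K m \<in> carrier B"
      using maps_carrier[OF homo_imp(1)[OF assms(1)] that(2)]
        maps_carrier[OF homo_imp(1)[OF assms(2)] that(2)] .
    show ?thesis
      unfolding \<Phi>_mult[OF C] \<Phi>_mult[OF C'] using f(4) k(4) that by simp
  qed
  then show ?thesis
    unfolding homotopic_over_def homotopic_with_def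
    using f(2,3) k(2,3) B.continuous_map_multI[OF f(1) k(1)]
    by (intro exI[of _ "\<lambda>z. f z \<otimes>\<^bsub>B\<^esub> k z"]) simp
qed

lemma pull_closed:
  "F \<in> maps \<Longrightarrow> p \<in> topspace (total (pull M F)) \<Longrightarrow> g \<in> carrier G \<Longrightarrow>
    ract (pull M F) p g \<in> topspace (total (pull M F))"
proof -
  assume F: "F \<in> maps" and p: "p \<in> topspace (total (pull M F))" and g: "g \<in> carrier G"
  interpret P: bibundle G M "pull M F" H t
    by (rule bibundle_locale[OF G.topological_group_axioms pull_bibundle]) (use F in simp)
  show ?thesis by (rule P.ract_closed[OF p g])
qed

lemma \<Psi>_eqI:
  assumes F: "F \<in> maps" and iso: "bibundle_iso G (pull M F) P"
  shows "bibundle_class H G t M P = \<Psi> F"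
  unfolding \<Psi>_def by (rule bibundle_class_eq[OF iso pull_closed[OF F], symmetric])

text \<open>This is where the injection \<open>j\<close> enters. The product of two classes is a
  union over their representatives, and equality of classes is exploited through a common member;
  both would fail for empty classes.\<close>

lemma \<Psi>_nonempty: assumes "F \<in> maps" shows "\<exists>P. P \<in> \<Psi> F"
proof -
  have "continuous_map M (gtop B) F" using assms by simp
  from bibundle_copy_exists[OF G.topological_group_axioms pull_bibundle[OF this] j]
  show ?thesis unfolding \<Psi>_def bibundle_class_def mem_Collect_eq .
qed

text \<open>One inclusion is the existence of classifying maps. The other says that a pullback,
  although carried by another type, has the class of some bibundle in \<open>'p\<close>.\<close>

lemma carrier_Bibun: "carrier (pi0_Bibun H G t \<alpha> M) = \<Psi> ` maps"
proof -
  have "bibundle_class H G t M P \<in> \<Psi> ` maps" if P: "is_bibundle H G t M P" for P :: "('p, 'm, 'g, 'h) bibundle"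
  proof -
    interpret P: bibundle G M P H t by (rule bibundle_locale[OF G.topological_group_axioms P])
    obtain F where F: "F \<in> maps" "bibundle_iso G P (pull M F)"
      using classifying_map_exists[OF M P] by auto
    have "bibundle_class H G t M P = \<Psi> F"
      unfolding \<Psi>_def by (rule bibundle_class_eq[OF F(2) P.ract_closed])
    then show ?thesis using F(1) by blast
  qed
  moreover have "\<Psi> F \<in> bibundle_class H G t M ` {P :: ('p, 'm, 'g, 'h) bibundle. is_bibundle H G t M P}"
    if F: "F \<in> maps" for F
  proof -
    obtain P :: "('p, 'm, 'g, 'h) bibundle" where P: "is_bibundle H G t M P" "bibundle_iso G (pull M F) P"
      using \<Psi>_nonempty[OF F] unfolding \<Psi>_def bibundle_class_def by blast
    then show ?thesis using \<Psi>_eqI[OF F P(2)] by blast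
  qed
  ultimately have "bibundle_class H G t M ` {P :: ('p, 'm, 'g, 'h) bibundle. is_bibundle H G t M P} = \<Psi> ` maps"
    by (intro equalityI subsetI) auto
  then show ?thesis unfolding pi0_Bibun_def by simp
qed

lemma mult_Bibun:
  assumes F: "F \<in> maps" and F': "F' \<in> maps"
  shows "\<Psi> F \<otimes>\<^bsub>pi0_Bibun H G t \<alpha> M\<^esub> \<Psi> F' = \<Psi> (mprod F F')"
proof -
  have "bibundle_class H G t M (tensor H G \<alpha> P Q) = \<Psi> (mprod F F')"
    if P: "P \<in> \<Psi> F" and Q: "Q \<in> \<Psi> F'" for P Q
  proof (rule \<Psi>_eqI[OF mprod_closed[OF F F']], rule tensor_pull)
    show "is_bibundle H G t M P" "is_bibundle H G t M Q"
      using P Q by (simp_all add: \<Psi>_def bibundle_class_def)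
    show "continuous_map M (gtop B) F" "continuous_map M (gtop B) F'" using F F' by simp_all
    have iso: "bibundle_iso G (pull M F) P" "bibundle_iso G (pull M F') Q"
      using P Q by (simp_all add: \<Psi>_def bibundle_class_def)
    show "bibundle_iso G P (pull M F)" by (rule bibundle_iso_sym[OF iso(1) pull_closed[OF F]])
    show "bibundle_iso G Q (pull M F')" by (rule bibundle_iso_sym[OF iso(2) pull_closed[OF F']])
  qed
  moreover obtain P Q where "P \<in> \<Psi> F" "Q \<in> \<Psi> F'" using \<Psi>_nonempty[OF F] \<Psi>_nonempty[OF F'] by blast
  ultimately have "(\<Union>P\<in>\<Psi> F. \<Union>Q\<in>\<Psi> F'. bibundle_class H G t M (tensor H G \<alpha> P Q)) = \<Psi> (mprod F F')"
    by blast
  then show ?thesis by (simp add: pi0_Bibun_def)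
qed

lemma const_one: "(\<lambda>m. \<one>\<^bsub>B\<^esub>) \<in> maps"
  using B.one_closed by (simp add: B.topspace_gtop)

lemma \<Psi>_null_iff:
  assumes K: "K \<in> maps"
  shows "\<Psi> K = \<Psi> (\<lambda>m. \<one>\<^bsub>B\<^esub>) \<longleftrightarrow>
    (\<exists>x. continuous_map M (gtop E) x \<and> (\<forall>m\<in>topspace M. snd (x m) = \<one>\<^bsub>H\<^esub> \<and> E.\<pi> (x m) = K m))"
    (is "_ \<longleftrightarrow> ?lift K")
proof -
  let ?U = "unit_bibundle G t M"
  have bU: "is_bibundle H G t M ?U"
    by (rule unit_bibundle[OF G.topological_group_axioms H.topological_group_axioms t_hom t_continuous])
  interpret U: bibundle G M ?U H t by (rule bibundle_locale[OF G.topological_group_axioms bU])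
  have lift1: "?lift (\<lambda>m. \<one>\<^bsub>B\<^esub>)"
  proof (intro exI conjI ballI)
    show "continuous_map M (gtop E) (\<lambda>m. \<one>\<^bsub>E\<^esub>)" using E.topspace_gtop by simp
  qed (use \<pi>_one in auto)
  have iso1: "bibundle_iso G ?U (pull M (\<lambda>m. \<one>\<^bsub>B\<^esub>))"
    using const_one lift1 by (subst unit_iso_iff) simp_all
  have unit: "bibundle_class H G t M ?U = \<Psi> (\<lambda>m. \<one>\<^bsub>B\<^esub>)"
    unfolding \<Psi>_def by (rule bibundle_class_eq[OF iso1 U.ract_closed])
  have "\<Psi> K = \<Psi> (\<lambda>m. \<one>\<^bsub>B\<^esub>) \<longleftrightarrow> bibundle_iso G ?U (pull M K)"
  proof
    assume "bibundle_iso G ?U (pull M K)"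
    then show "\<Psi> K = \<Psi> (\<lambda>m. \<one>\<^bsub>B\<^esub>)"
      unfolding unit[symmetric] unfolding \<Psi>_def by (rule bibundle_class_eq[OF _ U.ract_closed, symmetric])
  next
    assume eq: "\<Psi> K = \<Psi> (\<lambda>m. \<one>\<^bsub>B\<^esub>)"
    \<comment> \<open>Pullbacks are not members of their own classes, as these live in
      \<open>'p\<close>. Equality of two classes becomes an isomorphism of the pullbacks only by way
      of a common representative.\<close>
    obtain R where "R \<in> \<Psi> K" using \<Psi>_nonempty[OF K] by blast
    then have R: "bibundle_iso G (pull M K) R" "bibundle_iso G (pull M (\<lambda>m. \<one>\<^bsub>B\<^esub>)) R"
      using eq by (auto simp: \<Psi>_def bibundle_class_def)
    have "bibundle_iso G R (pull M K)" by (rule bibundle_iso_sym[OF R(1) pull_closed[OF K]])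
    then show "bibundle_iso G ?U (pull M K)"
      using bibundle_iso_trans[OF bibundle_iso_trans[OF iso1 R(2)]] by blast
  qed
  also have "\<dots> \<longleftrightarrow> ?lift K" using K by (intro unit_iso_iff) simp
  finally show ?thesis .
qed

lemma one_Bibun: "\<one>\<^bsub>pi0_Bibun H G t \<alpha> M\<^esub> = \<Psi> (\<lambda>m. \<one>\<^bsub>B\<^esub>)"
proof -
  let ?U = "unit_bibundle G t M"
  have bU: "is_bibundle H G t M ?U"
    by (rule unit_bibundle[OF G.topological_group_axioms H.topological_group_axioms t_hom t_continuous])
  interpret U: bibundle G M ?U H t by (rule bibundle_locale[OF G.topological_group_axioms bU])
  have "bibundle_iso G ?U (pull M (\<lambda>m. \<one>\<^bsub>B\<^esub>))"
    using const_one \<Psi>_null_iff[OF const_one] by (subst unit_iso_iff) simp_all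
  from bibundle_class_eq[OF this U.ract_closed] show ?thesis
    unfolding \<Psi>_def by (simp add: pi0_Bibun_def)
qed

text \<open>Both sides are equivalent to a lift of \<open>K\<close> with \<open>H\<close>-component
  \<open>1\<close>: a null homotopy provides one by \<open>null_homotopic_lift\<close>, a lift is
  contracted by \<open>lift_imp_null_homotopic\<close>, and \<open>\<Psi>_null_iff\<close> matches
  lifts with triviality of the pullback.\<close>

lemma homo_null_iff:
  assumes K: "K \<in> maps"
  shows "homo K (\<lambda>m. \<one>\<^bsub>B\<^esub>) \<longleftrightarrow> \<Psi> K = \<Psi> (\<lambda>m. \<one>\<^bsub>B\<^esub>)"
proof
  assume "homo K (\<lambda>m. \<one>\<^bsub>B\<^esub>)"
  then have "homo (\<lambda>m. \<one>\<^bsub>B\<^esub>) K" by (rule homo_sym)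
  from this[unfolded homotopic_over_def homotopic_with_def]
  obtain h where h: "continuous_map (prod_topology (top_of_set {0..1::real}) M) (gtop B) h"
      "\<forall>x. h (0, x) = \<one>\<^bsub>B\<^esub>" "\<forall>x. h (1, x) = K x"
      "\<forall>s\<in>{0..1}. \<forall>m\<in>topspace M. \<Phi> (h (s, m)) = \<Phi> \<one>\<^bsub>B\<^esub>"
    by (elim exE conjE)
  have "\<exists>x. continuous_map M (gtop E) x \<and>
      (\<forall>m\<in>topspace M. snd (x m) = \<one>\<^bsub>H\<^esub> \<and> E.\<pi> (x m) = h (1, m))"
    by (rule null_homotopic_lift[OF M h(1)]) (use h in auto)
  then show "\<Psi> K = \<Psi> (\<lambda>m. \<one>\<^bsub>B\<^esub>)" unfolding \<Psi>_null_iff[OF K] using h(3) by simp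
next
  assume "\<Psi> K = \<Psi> (\<lambda>m. \<one>\<^bsub>B\<^esub>)"
  then obtain x where "continuous_map M (gtop E) x"
      "\<forall>m\<in>topspace M. snd (x m) = \<one>\<^bsub>H\<^esub> \<and> E.\<pi> (x m) = K m"
    unfolding \<Psi>_null_iff[OF K] by blast
  then have "homotopic_with (\<lambda>F. \<forall>m\<in>topspace M. \<Phi> (F m) = \<Phi> \<one>\<^bsub>B\<^esub>) M (gtop B) K (\<lambda>m. \<one>\<^bsub>B\<^esub>)"
    by (intro lift_imp_null_homotopic) auto
  then have "homo (\<lambda>m. \<one>\<^bsub>B\<^esub>) K" unfolding homotopic_over_def by (rule homotopic_with_symD)
  then show "homo K (\<lambda>m. \<one>\<^bsub>B\<^esub>)" by (rule homo_sym)
qed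

text \<open>Maps are total functions whose values outside \<open>M\<close> carry no meaning; the
  pullback sees only the points of \<open>M\<close>, so even the bibundles are equal.\<close>

lemma \<Psi>_cong:
  assumes F: "F \<in> maps" and eq: "\<And>m. m \<in> topspace M \<Longrightarrow> F m = F' m"
  shows "\<Psi> F = \<Psi> F'"
proof -
  let ?X = "prod_topology M (gtop E)" and ?S = "\<lambda>F. {(m, x). F m = E.\<pi> x}"
  have "topspace ?X \<inter> ?S F = topspace ?X \<inter> ?S F'" using eq by auto
  then have "subtopology ?X (?S F) = subtopology ?X (?S F')" by (metis subtopology_restrict)
  then have "pull M F = pull M F'"
    unfolding pullback_bibundle_def by (simp add: EB_simps)
  then show ?thesis by (simp add: \<Psi>_def)
qed

lemma homo_iff:
  assumes F: "F \<in> maps" and F': "F' \<in> maps"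
  shows "homo F F' \<longleftrightarrow> \<Psi> F = \<Psi> F'"
proof -
  define I where "I = (\<lambda>m. inv\<^bsub>B\<^esub> F m)"
  \<comment> \<open>Multiplication by \<open>F\<close> or by its inverse respects homotopy and, by
    \<open>mult_Bibun\<close>, also \<Psi>. So each of the two equalities of classes for
    \<open>F\<close> and \<open>F'\<close> is equivalent to the one for \<open>K\<close> and the
    constant map.\<close>
  define K where "K = mprod I F'"
  have I: "I \<in> maps" using F by (simp add: I_def B.continuous_map_invI)
  have K: "K \<in> maps" unfolding K_def by (rule mprod_closed[OF I F'])
  have FK: "mprod F K m = F' m" and IF: "mprod I F m = \<one>\<^bsub>B\<^esub>" and F1: "mprod F (\<lambda>m. \<one>\<^bsub>B\<^esub>) m = F m"
    if "m \<in> topspace M" for m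
    using maps_carrier[OF F that] maps_carrier[OF F' that]
    by (simp_all add: K_def I_def B.m_assoc[symmetric])
  have hF: "homo F F" by (rule homo_eqI[OF F refl])
  have FKm: "mprod F K \<in> maps" and IFm: "mprod I F \<in> maps" and F1m: "mprod F (\<lambda>m. \<one>\<^bsub>B\<^esub>) \<in> maps"
    using mprod_closed F K I const_one by blast+
  have "homo F F' \<longleftrightarrow> homo K (\<lambda>m. \<one>\<^bsub>B\<^esub>)"
  proof
    assume "homo F F'"
    then have "homo (mprod I F) K" unfolding K_def by (rule homo_mprod[OF homo_eqI[OF I refl]])
    then show "homo K (\<lambda>m. \<one>\<^bsub>B\<^esub>)" using homo_trans[OF homo_sym homo_eqI[OF IFm IF]] by blast
  next
    assume "homo K (\<lambda>m. \<one>\<^bsub>B\<^esub>)"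
    then have "homo (mprod F K) (mprod F (\<lambda>m. \<one>\<^bsub>B\<^esub>))" by (rule homo_mprod[OF hF])
    then show "homo F F'"
      using homo_trans[OF homo_sym[OF homo_trans[OF _ homo_eqI[OF F1m F1]]] homo_eqI[OF FKm FK]] by blast
  qed
  also have "\<dots> \<longleftrightarrow> \<Psi> K = \<Psi> (\<lambda>m. \<one>\<^bsub>B\<^esub>)" by (rule homo_null_iff[OF K])
  also have "\<dots> \<longleftrightarrow> \<Psi> F = \<Psi> F'"
  proof
    assume eq: "\<Psi> K = \<Psi> (\<lambda>m. \<one>\<^bsub>B\<^esub>)"
    have "\<Psi> F' = \<Psi> (mprod F K)" by (rule \<Psi>_cong[OF FKm FK, symmetric])
    also have "\<dots> = \<Psi> (mprod F (\<lambda>m. \<one>\<^bsub>B\<^esub>))"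
      unfolding mult_Bibun[OF F K, symmetric] eq by (rule mult_Bibun[OF F const_one])
    also have "\<dots> = \<Psi> F" by (rule \<Psi>_cong[OF F1m F1])
    finally show "\<Psi> F = \<Psi> F'" ..
  next
    assume eq: "\<Psi> F = \<Psi> F'"
    have "\<Psi> K = \<Psi> (mprod I F)"
      unfolding K_def mult_Bibun[OF I F', symmetric] eq[symmetric] by (rule mult_Bibun[OF I F])
    also have "\<dots> = \<Psi> (\<lambda>m. \<one>\<^bsub>B\<^esub>)" by (rule \<Psi>_cong[OF IFm IF])
    finally show "\<Psi> K = \<Psi> (\<lambda>m. \<one>\<^bsub>B\<^esub>)" .
  qed
  finally show ?thesis .
qed

lemma mult_homotopy_classes:
  assumes F: "F \<in> maps" and F': "F' \<in> maps"
  shows "hc F \<otimes>\<^bsub>homotopy_classes_over \<Phi> M B\<^esub> hc F' = hc (mprod F F')"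
proof -
  have "hc (mprod K K') = hc (mprod F F')" if "K \<in> hc F" "K' \<in> hc F'" for K K'
  proof -
    have h: "homo F K" "homo F' K'" using that by (simp_all add: homotopy_class_over_def)
    show ?thesis
      using hc_eq_iff[OF mprod_closed[OF homo_imp(2)[OF h(1)] homo_imp(2)[OF h(2)]]] homo_mprod[OF h] by blast
  qed
  moreover have "F \<in> hc F" "F' \<in> hc F'"
    using homo_eqI[OF F refl] homo_eqI[OF F' refl] by (simp_all add: homotopy_class_over_def)
  ultimately have "(\<Union>K\<in>hc F. \<Union>K'\<in>hc F'. hc (mprod K K')) = hc (mprod F F')" by blast
  then show ?thesis by (simp add: homotopy_classes_over_def)
qed

lemma carrier_homotopy_classes: "carrier (homotopy_classes_over \<Phi> M B) = hc ` maps"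
  and one_homotopy_classes: "\<one>\<^bsub>homotopy_classes_over \<Phi> M B\<^esub> = hc (\<lambda>m. \<one>\<^bsub>B\<^esub>)"
  by (simp_all add: homotopy_classes_over_def)

lemma hc_cong:
  assumes "F \<in> maps" "\<And>m. m \<in> topspace M \<Longrightarrow> F m = F' m"
  shows "hc F = hc F'"
proof -
  have h: "homo F F'" by (rule homo_eqI[OF assms])
  show ?thesis using hc_eq_iff[OF homo_imp(2)[OF h]] h by blast
qed

lemma mprod_laws:
  assumes "F \<in> maps" "F' \<in> maps" "F'' \<in> maps" "m \<in> topspace M"
  shows "mprod (mprod F F') F'' m = mprod F (mprod F' F'') m" "mprod (\<lambda>m. \<one>\<^bsub>B\<^esub>) F m = F m"
    "mprod (\<lambda>m. inv\<^bsub>B\<^esub> F m) F m = \<one>\<^bsub>B\<^esub>"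
  using maps_carrier[OF assms(1,4)] maps_carrier[OF assms(2,4)] maps_carrier[OF assms(3,4)]
  by (simp_all add: B.m_assoc)

lemma inverse_maps: "F \<in> maps \<Longrightarrow> (\<lambda>m. inv\<^bsub>B\<^esub> F m) \<in> maps"
  by (simp add: B.continuous_map_invI)

text \<open>Applied to \<Psi> and to \<open>hc\<close>. The group laws of pointwise multiplication
  hold only at points of \<open>M\<close>, and a map \<open>f\<close> that ignores the other values
  turns them into equations.\<close>

lemma group_laws:
  fixes f :: "('m \<Rightarrow> ('e \<times> 'h) set) \<Rightarrow> 'z"
  assumes cong: "\<And>F F'. F \<in> maps \<Longrightarrow> (\<And>m. m \<in> topspace M \<Longrightarrow> F m = F' m) \<Longrightarrow> f F = f F'"
  shows "F \<in> maps \<Longrightarrow> F' \<in> maps \<Longrightarrow> F'' \<in> maps \<Longrightarrow>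
      f (mprod (mprod F F') F'') = f (mprod F (mprod F' F''))"
    and "F \<in> maps \<Longrightarrow> f (mprod (\<lambda>m. \<one>\<^bsub>B\<^esub>) F) = f F"
    and "F \<in> maps \<Longrightarrow> \<exists>F'\<in>maps. f (mprod F' F) = f (\<lambda>m. \<one>\<^bsub>B\<^esub>)"
proof -
  assume F: "F \<in> maps"
  show "f (mprod (\<lambda>m. \<one>\<^bsub>B\<^esub>) F) = f F"
    by (rule cong[OF mprod_closed[OF const_one F] mprod_laws(2)[OF F F F]])
  show "\<exists>F'\<in>maps. f (mprod F' F) = f (\<lambda>m. \<one>\<^bsub>B\<^esub>)"
    by (rule bexI[OF _ inverse_maps[OF F]],
        rule cong[OF mprod_closed[OF inverse_maps[OF F] F] mprod_laws(3)[OF F F F]])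
  assume F': "F' \<in> maps" and F'': "F'' \<in> maps"
  show "f (mprod (mprod F F') F'') = f (mprod F (mprod F' F''))"
    by (rule cong[OF mprod_closed[OF mprod_closed[OF F F'] F''] mprod_laws(1)[OF F F' F'']])
qed

theorem classification:
  defines "Bibun \<equiv> pi0_Bibun H G t \<alpha> M :: ('p, 'm, 'g, 'h) bibundle set monoid"
  shows "group Bibun" and "group (homotopy_classes_over \<Phi> M B)"
    and "\<exists>\<theta>\<in>iso Bibun (homotopy_classes_over \<Phi> M B).
     \<forall>F\<in>maps. inv_into (carrier Bibun) \<theta> (hc F) = bibundle_class H G t M (pull M F)"
proof -
  note car = carrier_Bibun[folded Bibun_def] and mul = mult_Bibun[folded Bibun_def]
  show "group Bibun"
    by (rule group_of_image[where f=\<Psi> and C=maps and m=mprod and e="\<lambda>m. \<one>\<^bsub>B\<^esub>"])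
      (rule car mul one_Bibun[folded Bibun_def] mprod_closed const_one group_laws[where f=\<Psi>, OF \<Psi>_cong]; assumption)+
  show "group (homotopy_classes_over \<Phi> M B)"
    by (rule group_of_image[where f=hc and C=maps and m=mprod and e="\<lambda>m. \<one>\<^bsub>B\<^esub>"])
      (rule carrier_homotopy_classes mult_homotopy_classes one_homotopy_classes mprod_closed const_one
        group_laws[where f=hc, OF hc_cong]; assumption)+
  show "\<exists>\<theta>\<in>iso Bibun (homotopy_classes_over \<Phi> M B).
     \<forall>F\<in>maps. inv_into (carrier Bibun) \<theta> (hc F) = bibundle_class H G t M (pull M F)"
    unfolding \<Psi>_def[symmetric]
  proof (rule iso_of_images[where f=hc and f'=\<Psi> and C=maps and m=mprod])
    show "hc F = hc F' \<longleftrightarrow> \<Psi> F = \<Psi> F'" if "F \<in> maps" "F' \<in> maps" for F F'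
      unfolding hc_eq_iff[OF that(2)] by (rule homo_iff[OF that])
  qed (rule carrier_homotopy_classes mult_homotopy_classes car mul mprod_closed; assumption)+
qed

end

end

theorem theorem3p15:
  fixes H :: "'h topgroup" and G :: "'g topgroup" and t :: "'g \<Rightarrow> 'h" and \<alpha> :: "'h \<Rightarrow> 'g \<Rightarrow> 'g"
    and EG :: "'e topgroup" and i :: "'g \<Rightarrow> 'e" and \<epsilon> :: "'h \<Rightarrow> 'e \<Rightarrow> 'e"
    and M :: "'m topology"
    and Bibun :: "('p, 'm, 'g, 'h) bibundle set monoid"
  defines "E \<equiv> E_bibundle H G t EG i \<epsilon>"
    and "B \<equiv> B_group H G t EG i \<epsilon>"
    and "\<Phi> \<equiv> type_map H G t"
    and "Bibun \<equiv> pi0_Bibun H G t \<alpha> M"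
  assumes "standard_crossed_module H G t \<alpha>"
    and "EG_model H G t \<alpha> EG i \<epsilon>"
    and "paracompact_space M"
    and "\<exists>j :: 'm \<times> 'g \<Rightarrow> 'p. inj_on j (topspace M \<times> carrier G)"
  shows "is_bibundle H G t (gtop B) E \<and>
    group Bibun \<and>
    group (homotopy_classes_over \<Phi> M B) \<and>
    (\<exists>\<theta>\<in>iso Bibun (homotopy_classes_over \<Phi> M B).
       \<forall>F. continuous_map M (gtop B) F \<longrightarrow>
         inv_into (carrier Bibun) \<theta> (homotopy_class_over \<Phi> M (gtop B) F) =
           bibundle_class H G t M (pullback_bibundle M F E))"
proof -
  interpret bibundle_model H G t \<alpha> EG i \<epsilon>
    using assms(5,6) by (rule bibundle_model.intro)
  obtain j :: "'m \<times> 'g \<Rightarrow> 'p" where j: "inj_on j (topspace M \<times> carrier G)"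
    using assms(8) by blast
  note c = classification[OF assms(7) j]
  show ?thesis
    unfolding assms(1-4)
  proof (intro conjI EB_bibundle c(1,2))
    from c(3) show "\<exists>\<theta>\<in>iso (pi0_Bibun H G t \<alpha> M :: ('p, 'm, 'g, 'h) bibundle set monoid)
        (homotopy_classes_over (type_map H G t) M (B_group H G t EG i \<epsilon>)).
      \<forall>F. continuous_map M (gtop (B_group H G t EG i \<epsilon>)) F \<longrightarrow>
        inv_into (carrier (pi0_Bibun H G t \<alpha> M)) \<theta>
          (homotopy_class_over (type_map H G t) M (gtop (B_group H G t EG i \<epsilon>)) F) =
        bibundle_class H G t M (pullback_bibundle M F (E_bibundle H G t EG i \<epsilon>))"
      by simp
  qed
qed

end
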